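(* For $c\in\{2,3\}$, the problem Max-$c$-Permutation CSP Above Average can be solved in time $2^{O(k)}\cdot|I|^{O(1)}$, where $k$ is the parameter and $|I|$ the input size.
   Context: Max-$c$-Permutation CSP Above Average: fix a finite set $\mathbb{P}$ of predicates $P:\mathbb{S}_{c'}\to\{0,1\}$ with $c'\le c$, where $\mathbb{S}_{c'}$ is the set of permutations of $\{1,\dots,c'\}$. An instance consists of a variable set $V$ with $|V|=n$, constraints $(f_i,S_i,w_i)$ with $f_i\in\mathbb{P}$, $S_i$ an ordered tuple of $c'$ distinct variables, $w_i$ a positive integer, and an integer parameter $k\ge0$. A bijection $\phi:V\to\{1,\dots,n\}$ satisfies $(f_i,S_i,w_i)$ if $f_i$ evaluates to $1$ on the relative order of $\phi$ restricted to $S_i$, viewed as an element of $\mathbb{S}_{c'}$. With $W$ the total weight and $\rho$ the expected fraction of weight satisfied by a uniformly random bijection, the question is whether some bijection satisfies constraints of total weight at least $\rho W+k/(c!\,4^c)$. *)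

theory Defs
  imports
    "HOL-Probability.Probability_Mass_Function"
    "HOL-Library.FuncSet"
    "HOL-Library.Discrete_Functions"
begin

section \<open>Permutation constraint satisfaction\<close>

definition perms :: "nat \<Rightarrow> (nat \<Rightarrow> nat) set" where
  "perms a = {\<pi>. \<pi> permutes {1..a}}"

type_synonym predicate = "nat \<times> ((nat \<Rightarrow> nat) \<Rightarrow> nat)"

definition predicates :: "nat \<Rightarrow> predicate set" where
  "predicates c = {(a, P). a \<le> c \<and> P \<in> perms a \<rightarrow>\<^sub>E {0, 1}}"

record constr =
  pred :: predicate
  scope :: "nat list"
  weight :: nat

record inst =
  vars :: "nat list"
  constrs :: "constr list"
  param :: nat

text \<open>Variables are named by arbitrary natural numbers. The variable set is given as a list without
  repetitions, and the constraints form a list, so that a constraint may occur several times.\<close>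

definition wf_constr :: "predicate set \<Rightarrow> nat set \<Rightarrow> constr \<Rightarrow> bool" where
  "wf_constr PP V C \<longleftrightarrow> pred C \<in> PP \<and> length (scope C) = fst (pred C) \<and>
     distinct (scope C) \<and> set (scope C) \<subseteq> V \<and> 0 < weight C"

definition instances :: "predicate set \<Rightarrow> inst set" where
  "instances PP = {I. distinct (vars I) \<and> (\<forall>C\<in>set (constrs I). wf_constr PP (set (vars I)) C)}"

definition orderings :: "nat set \<Rightarrow> (nat \<Rightarrow> nat) set" where
  "orderings V = {\<phi> \<in> V \<rightarrow>\<^sub>E {1..card V}. bij_betw \<phi> V {1..card V}}"

text \<open>The relative order of \<open>\<phi>\<close> on a tuple \<open>S\<close>: position \<open>i\<close> is sent to the rank of
  \<open>\<phi>\<close> at the \<open>i\<close>-th entry among all values of \<open>\<phi>\<close> on \<open>S\<close> (positions and ranks start at 1).\<close>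

definition rel_order :: "(nat \<Rightarrow> nat) \<Rightarrow> nat list \<Rightarrow> nat \<Rightarrow> nat" where
  "rel_order \<phi> S i =
     (if i \<in> {1..length S}
      then card {j \<in> {1..length S}. \<phi> (S ! (j - 1)) \<le> \<phi> (S ! (i - 1))}
      else i)"

definition satisfies :: "(nat \<Rightarrow> nat) \<Rightarrow> constr \<Rightarrow> bool" where
  "satisfies \<phi> C \<longleftrightarrow> snd (pred C) (rel_order \<phi> (scope C)) = 1"

definition total_weight :: "inst \<Rightarrow> nat" where
  "total_weight I = (\<Sum>C\<leftarrow>constrs I. weight C)"

definition sat_weight :: "inst \<Rightarrow> (nat \<Rightarrow> nat) \<Rightarrow> nat" where
  "sat_weight I \<phi> = (\<Sum>C\<leftarrow>filter (satisfies \<phi>) (constrs I). weight C)"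

text \<open>If there are no constraints, \<open>avg_fraction\<close> is 0 by \<open>x / 0 = 0\<close>; it is only used multiplied by
  the total weight.\<close>

definition avg_fraction :: "inst \<Rightarrow> real" where
  "avg_fraction I = measure_pmf.expectation (pmf_of_set (orderings (set (vars I))))
     (\<lambda>\<phi>. real (sat_weight I \<phi>) / real (total_weight I))"

definition above_average :: "nat \<Rightarrow> inst \<Rightarrow> bool" where
  "above_average c I \<longleftrightarrow> (\<exists>\<phi>\<in>orderings (set (vars I)).
     real (sat_weight I \<phi>)
       \<ge> avg_fraction I * real (total_weight I) + real (param I) / (fact c * 4 ^ c))"

section \<open>Encoding of instances and input size\<close>

text \<open>Predicates range over a fixed finite set, so they enter the input only through a
  numbering \<open>code\<close> of that set.\<close>

definition enc_constr :: "(predicate \<Rightarrow> nat) \<Rightarrow> constr \<Rightarrow> nat list" where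
  "enc_constr code C = code (pred C) # length (scope C) # scope C @ [weight C]"

definition encode :: "(predicate \<Rightarrow> nat) \<Rightarrow> inst \<Rightarrow> nat list" where
  "encode code I =
     param I # length (vars I) # vars I
     @ length (constrs I) # concat (map (enc_constr code) (constrs I))"

text \<open>Total number of binary digits; \<open>floor_log x + 1\<close> is the length of the binary
  representation of \<open>x\<close>, with 0 having one digit.\<close>

definition bit_size :: "nat list \<Rightarrow> nat" where
  "bit_size xs = (\<Sum>x\<leftarrow>xs. floor_log x + 1)"

section \<open>Random access machines\<close>

text \<open>A random access machine with uniform cost measure. The arithmetic operations are addition,
  (truncated) subtraction and division by two, as usual in parameterized complexity. As there is no
  multiplication, a step makes the largest number among input, registers and program constants
  longer by at most one bit, so that time is polynomially related to time on Turing machines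
  with input size measured in bits.
  The input is a read-only sequence of numbers, separate from the work registers, which
  are initially 0.\<close>

datatype instr =
    SetConst nat nat      \<comment> \<open>\<open>r\<^sub>i := n\<close>\<close>
  | Add nat nat nat       \<comment> \<open>\<open>r\<^sub>i := r\<^sub>j + r\<^sub>l\<close>\<close>
  | Sub nat nat nat       \<comment> \<open>\<open>r\<^sub>i := r\<^sub>j - r\<^sub>l\<close>, truncated at 0\<close>
  | Half nat nat          \<comment> \<open>\<open>r\<^sub>i := r\<^sub>j div 2\<close>\<close>
  | Load nat nat          \<comment> \<open>\<open>r\<^sub>i := r\<close> at address \<open>r\<^sub>j\<close>\<close>
  | Store nat nat         \<comment> \<open>\<open>r\<close> at address \<open>r\<^sub>i := r\<^sub>j\<close>\<close>
  | InputLength nat       \<comment> \<open>\<open>r\<^sub>i :=\<close> number of input entries\<close>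
  | ReadInput nat nat     \<comment> \<open>\<open>r\<^sub>i :=\<close> input entry number \<open>r\<^sub>j\<close>, counted from 0; 0 if there is none\<close>
  | Jump nat
  | JumpZero nat nat      \<comment> \<open>jump to the second argument if \<open>r\<^sub>i = 0\<close>\<close>

type_synonym program = "instr list"
type_synonym config = "nat \<times> (nat \<Rightarrow> nat)"

fun exec :: "nat list \<Rightarrow> instr \<Rightarrow> config \<Rightarrow> config" where
  "exec xs (SetConst i n) (pc, r) = (pc + 1, r(i := n))"
| "exec xs (Add i j l) (pc, r) = (pc + 1, r(i := r j + r l))"
| "exec xs (Sub i j l) (pc, r) = (pc + 1, r(i := r j - r l))"
| "exec xs (Half i j) (pc, r) = (pc + 1, r(i := r j div 2))"
| "exec xs (Load i j) (pc, r) = (pc + 1, r(i := r (r j)))"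
| "exec xs (Store i j) (pc, r) = (pc + 1, r(r i := r j))"
| "exec xs (InputLength i) (pc, r) = (pc + 1, r(i := length xs))"
| "exec xs (ReadInput i j) (pc, r) =
     (pc + 1, r(i := (if r j < length xs then xs ! r j else 0)))"
| "exec xs (Jump l) (pc, r) = (l, r)"
| "exec xs (JumpZero i l) (pc, r) = (if r i = 0 then l else pc + 1, r)"

text \<open>The machine halts when the program counter leaves the program; halted configurations
  are left unchanged by \<open>step\<close>.\<close>

definition step :: "program \<Rightarrow> nat list \<Rightarrow> config \<Rightarrow> config" where
  "step p xs cfg = (if fst cfg < length p then exec xs (p ! fst cfg) cfg else cfg)"

definition run :: "program \<Rightarrow> nat list \<Rightarrow> nat \<Rightarrow> config" where
  "run p xs t = (step p xs ^^ t) (0, \<lambda>_. 0)"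

definition halts_within :: "program \<Rightarrow> nat list \<Rightarrow> nat \<Rightarrow> nat \<Rightarrow> bool" where
  "halts_within p xs t out \<longleftrightarrow> length p \<le> fst (run p xs t) \<and> snd (run p xs t) 0 = out"

end

theory Submission
  imports Defs
begin

text \<open>Label every variable with a random bucket in \<open>{0,1,2,3}\<close>, order the variables by bucket and break
  ties at random. The expected satisfied weight, as a function \<open>G\<close> of the labels, is a sum of functions of
  at most three labels whose values are multiples of 1/6, and its mean is the average over all orderings.

  A function of bounded degree with integer values exceeds its mean somewhere by at least a constant
  times the number of its relevant coordinates: take a maximal family of disjoint coordinate sets on
  which a mixed difference of top degree does not vanish. If the family is large, gain a constant on
  each of its members in turn; otherwise fix the few coordinates it covers, which lowers the degree.
  So the answer is yes if \<open>G\<close> depends on the labels of more than \<open>O(k)\<close> variables.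

  A variable whose label is irrelevant to \<open>G\<close> may be moved freely in every ordering, so otherwise only
  the order of \<open>O(k)\<close> variables matters. As constraints have arity at most three, the best order is
  found by dynamic programming over the \<open>2\<^sup>O\<^sup>(\<^sup>k\<^sup>)\<close> sets of variables placed so far: the relative order on
  a constraint is known as soon as its second element is placed.\<close>

section \<open>Set functions of bounded degree\<close>

text \<open>Orderings do not form a product space, so arguments about functions of few independent
  coordinates do not apply to them directly. Independent bucket labels supply such coordinates, and
  bucket order with random ties is again a uniform ordering, so the mean is unchanged while the
  function becomes local. Encoding a label by two bits makes it a set function of degree at most 3 *
  2 = 6. Scaling by 6, a common multiple of 1!, 2! and 3!, makes it integral, without which a
  nonzero difference could be arbitrarily small. Four buckets are what the exchange of two
  neighbours needs: one for the elements before them, one for each of the two, one for those after.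

  Fixing coordinates could make many relevant ones disappear. But a nonzero function of degree d
  survives a 2^-d fraction of all restrictions, so a constant fraction of the relevant coordinates
  is kept on average and the induction on the degree loses only constants.

  The machine cannot multiply, so weighted sums are evaluated from finite tables, indexed by
  predicate and labels, that are wired into the program.\<close>

definition mdiff :: "'a set \<Rightarrow> ('a set \<Rightarrow> real) \<Rightarrow> 'a set \<Rightarrow> real" where
  "mdiff T F X = (\<Sum>Y\<in>Pow T. (-1) ^ card (T - Y) * F ((X - T) \<union> Y))"

text \<open>Equivalent to being a multilinear polynomial of degree at most \<open>d\<close> in the
  membership indicators of the elements of \<open>W\<close>, but expressed without coefficients, so
  that sums and restrictions can be treated directly.\<close>

definition deg_le :: "nat \<Rightarrow> 'a set \<Rightarrow> ('a set \<Rightarrow> real) \<Rightarrow> bool" where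
  "deg_le d W F \<longleftrightarrow> (\<forall>T X. T \<subseteq> W \<longrightarrow> X \<subseteq> W \<longrightarrow> d < card T \<longrightarrow> mdiff T F X = 0)"

definition relevant :: "'a set \<Rightarrow> ('a set \<Rightarrow> real) \<Rightarrow> 'a set" where
  "relevant W F = {v \<in> W. \<exists>X\<subseteq>W. F (insert v X) \<noteq> F (X - {v})}"

definition avg :: "'a set \<Rightarrow> ('a set \<Rightarrow> real) \<Rightarrow> real" where
  "avg W F = (\<Sum>X\<in>Pow W. F X) / 2 ^ card W"

section \<open>Calculus of mixed differences\<close>

lemma sum_Pow_insert:
  assumes "finite T" "t \<notin> T"
  shows "(\<Sum>Y\<in>Pow (insert t T). h Y) = (\<Sum>Y\<in>Pow T. h Y + h (insert t Y))"
proof -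
  have "inj_on (insert t) (Pow T)"
    using assms(2) by (auto simp: inj_on_def)
  moreover have "Pow T \<inter> insert t ` Pow T = {}"
    using assms(2) by auto
  ultimately show ?thesis
    using assms(1) by (simp add: Pow_insert sum.union_disjoint sum.reindex sum.distrib)
qed

lemma mdiff_insert:
  assumes "finite T" "t \<notin> T"
  shows "mdiff (insert t T) F X = mdiff T F (insert t X) - mdiff T F (X - {t})"
proof -
  have "mdiff (insert t T) F X
      = (\<Sum>Y\<in>Pow T. (-1) ^ card (insert t T - Y) * F ((X - insert t T) \<union> Y)
           + (-1) ^ card (insert t T - insert t Y) * F ((X - insert t T) \<union> insert t Y))"
    unfolding mdiff_def by (rule sum_Pow_insert[OF assms])
  also have "\<dots> = (\<Sum>Y\<in>Pow T. (-1) ^ card (T - Y) * F ((insert t X - T) \<union> Y)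
                      - (-1) ^ card (T - Y) * F ((X - {t} - T) \<union> Y))"
  proof (rule sum.cong[OF refl])
    fix Y assume "Y \<in> Pow T"
    then have Y: "Y \<subseteq> T" "t \<notin> Y" using assms by auto
    have 1: "insert t T - Y = insert t (T - Y)" using Y by auto
    have "card (insert t T - Y) = Suc (card (T - Y))"
      unfolding 1 using assms by simp
    moreover have "insert t T - insert t Y = T - Y" using assms Y by auto
    moreover have "(X - insert t T) \<union> insert t Y = (insert t X - T) \<union> Y" using assms by auto
    moreover have "(X - insert t T) \<union> Y = (X - {t} - T) \<union> Y" by auto
    ultimately show "(-1) ^ card (insert t T - Y) * F ((X - insert t T) \<union> Y)
           + (-1) ^ card (insert t T - insert t Y) * F ((X - insert t T) \<union> insert t Y)
        = (-1) ^ card (T - Y) * F ((insert t X - T) \<union> Y)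
                      - (-1) ^ card (T - Y) * F ((X - {t} - T) \<union> Y)"
      by simp
  qed
  finally show ?thesis by (simp add: mdiff_def sum_subtractf)
qed

lemma mdiff_const:
  assumes "finite T" "T \<noteq> {}"
  shows "mdiff T (\<lambda>_. c) X = 0"
proof -
  obtain t where t: "t \<in> T" using assms by blast
  have "mdiff (insert t (T - {t})) (\<lambda>_. c) X = 0"
    by (subst mdiff_insert) (use assms in \<open>auto simp: mdiff_def\<close>)
  then show ?thesis using t by (simp add: insert_absorb)
qed

text \<open>Some \<open>t\<close> in \<open>T\<close> lies outside \<open>D\<close>, so
  \<open>F\<close> does not see it and the two terms of \<open>mdiff_insert\<close> for
  \<open>t\<close> cancel. This bounds the degree of a sum of local terms.\<close>

lemma mdiff_local:
  assumes "finite T" "\<not> T \<subseteq> D" "\<And>X. F X = F (X \<inter> D)"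
  shows "mdiff T F X = 0"
proof -
  obtain t where t: "t \<in> T" "t \<notin> D" using assms by blast
  have "F ((insert t X - (T - {t})) \<union> Y) = F ((X - {t} - (T - {t})) \<union> Y)" for Y
  proof -
    have "((insert t X - (T - {t})) \<union> Y) \<inter> D = ((X - {t} - (T - {t})) \<union> Y) \<inter> D"
      using t by auto
    then show ?thesis by (metis assms(3))
  qed
  then have "mdiff (insert t (T - {t})) F X = 0"
    by (subst mdiff_insert) (use assms(1) in \<open>auto simp: mdiff_def\<close>)
  then show ?thesis using t by (simp add: insert_absorb)
qed

lemma mdiff_sum_list:
  "mdiff T (\<lambda>X. \<Sum>c\<leftarrow>cs. F c X) X = (\<Sum>c\<leftarrow>cs. mdiff T (F c) X)"
  by (induction cs) (simp_all add: mdiff_def distrib_left sum.distrib)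

lemma mdiff_sum:
  "mdiff T (\<lambda>X. \<Sum>c\<in>A. F c X) X = (\<Sum>c\<in>A. mdiff T (F c) X)"
  unfolding mdiff_def by (subst sum.swap) (simp add: sum_distrib_left)

lemma mdiff_divide: "mdiff T (\<lambda>X. F X / c) X = mdiff T F X / c"
  by (simp add: mdiff_def sum_divide_distrib)

lemma mdiff_single: "mdiff {v} F X = F (insert v X) - F (X - {v})"
  using mdiff_insert[of "{}" v F X] by (simp add: mdiff_def)

text \<open>Shows that differencing in one direction does not raise the degree. Differencing twice
  in direction \<open>v\<close> gives 0 because the first difference no longer sees
  \<open>v\<close>.\<close>

lemma mdiff_comm_single:
  assumes "finite T"
  shows "mdiff T (mdiff {v} F) X = (if v \<in> T then 0 else mdiff (insert v T) F X)"
proof (cases "v \<in> T")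
  case True
  then have "mdiff T (mdiff {v} F) X = 0"
    by (intro mdiff_local[of _ "- {v}"]) (use assms in \<open>auto simp: mdiff_single\<close>,
        (metis Diff_Compl Int_absorb Int_commute Diff_eq Int_assoc insert_Diff_single Diff_Diff_Int insert_Diff Int_insert_left)+)
  then show ?thesis using True by simp
next
  case False
  have "(insert v ((X - T) \<union> Y)) = (insert v X - T) \<union> Y" for Y using False by auto
  moreover have "((X - T) \<union> Y) - {v} = (X - {v} - T) \<union> Y" if "Y \<in> Pow T" for Y using False that by auto
  ultimately show ?thesis using False
    by (simp add: mdiff_insert[OF assms] mdiff_single[abs_def] mdiff_def[of T] right_diff_distrib sum_subtractf)
qed

lemma mdiff_mono_zero:
  assumes "finite T" "t \<notin> T" "mdiff (insert t T) F X = 0"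
  shows "mdiff T F (insert t X) = mdiff T F (X - {t})"
  using assms by (simp add: mdiff_insert)

text \<open>Adding an element outside \<open>T\<close> to the base point changes the difference by
  one of the next order, which vanishes; elements of \<open>T\<close> in the base point are
  overwritten anyway. It applies when \<open>T\<close> has top degree or is maximal with a
  nonvanishing difference.\<close>

lemma mdiff_independent:
  assumes "finite W" "finite T" "T \<subseteq> W"
    and "\<And>t X. t \<in> W - T \<Longrightarrow> X \<subseteq> W \<Longrightarrow> mdiff (insert t T) F X = 0"
    and "X \<subseteq> W"
  shows "mdiff T F X = mdiff T F {}"
  using finite_subset[OF \<open>X \<subseteq> W\<close> \<open>finite W\<close>] \<open>X \<subseteq> W\<close>
proof (induction X rule: finite_induct)
  case (insert t X)
  show ?case
  proof (cases "t \<in> T")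
    case True
    then have "insert t X - T = X - T" by auto
    then show ?thesis using insert by (simp add: mdiff_def)
  next
    case False
    with mdiff_mono_zero[of T t F X] assms insert show ?thesis by auto
  qed
qed simp

section \<open>Averages over subsets and gains above them\<close>

lemma exists_ge_avg:
  assumes "finite A" "A \<noteq> {}"
  shows "\<exists>x\<in>A. (\<Sum>y\<in>A. h y) / card A \<le> (h x :: real)"
proof (rule ccontr)
  assume "\<not> ?thesis"
  then have "\<And>x. x \<in> A \<Longrightarrow> h x < (\<Sum>y\<in>A. h y) / card A" by auto
  then have "(\<Sum>x\<in>A. h x) < (\<Sum>x\<in>A. (\<Sum>y\<in>A. h y) / card A)"
    by (intro sum_strict_mono) (use assms in auto)
  then show False using assms by simp
qed

lemma exists_ge_avg_Pow:
  assumes "finite W" shows "\<exists>X\<subseteq>W. avg W F \<le> F X"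
  using exists_ge_avg[of "Pow W" F] assms by (auto simp: avg_def card_Pow)

lemma sum_Pow_Un:
  assumes "finite A" "finite B" "A \<inter> B = {}"
  shows "(\<Sum>X\<in>Pow (A \<union> B). h X) = (\<Sum>Z\<in>Pow A. \<Sum>Y\<in>Pow B. h (Z \<union> Y))"
proof -
  have "(\<Sum>X\<in>Pow (A \<union> B). h X) = (\<Sum>(Z, Y)\<in>Pow A \<times> Pow B. h (Z \<union> Y))"
    by (rule sum.reindex_bij_witness[of _ "\<lambda>(Z, Y). Z \<union> Y" "\<lambda>X. (X \<inter> A, X \<inter> B)"])
       (use assms in \<open>auto simp flip: Int_Un_distrib simp: Int_absorb2\<close>)
  then show ?thesis using assms by (simp add: sum.cartesian_product)
qed

lemma avg_split:
  assumes "finite W" "U \<subseteq> W"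
  shows "avg W F = avg U (\<lambda>a. avg (W - U) (\<lambda>Z. F (Z \<union> a)))"
proof -
  have fin: "finite U" "finite (W - U)" using assms finite_subset by auto
  have "(\<Sum>X\<in>Pow (U \<union> (W - U)). F X) = (\<Sum>a\<in>Pow U. \<Sum>Z\<in>Pow (W - U). F (a \<union> Z))"
    by (rule sum_Pow_Un) (use fin in auto)
  moreover have "card W = card U + card (W - U)"
    using assms fin by (metis card_Diff_subset card_mono le_add_diff_inverse)
  ultimately show ?thesis using assms
    by (simp add: avg_def power_add sum_divide_distrib Un_absorb1 Un_commute mult.commute)
qed

text \<open>A family of disjoint sets on which the mixed difference of \<open>F\<close> is a nonzero constant can be
  treated one set at a time: averaging over one member keeps the differences on the others.\<close>

lemma max_ge_disjoint_family:
  assumes "finite M" "finite W" "e > 0"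
    and "\<And>T. T \<in> M \<Longrightarrow> T \<subseteq> W \<and> card T = e"
    and "pairwise disjnt M"
    and "\<And>T. T \<in> M \<Longrightarrow> \<exists>\<delta>. 1 \<le> \<bar>\<delta>\<bar> \<and> (\<forall>X\<subseteq>W. mdiff T F X = \<delta>)"
  shows "\<exists>X\<subseteq>W. avg W F + real (card M) / 2 ^ (e + 1) \<le> F X"
  using assms(1,2,4-)
proof (induction M arbitrary: W F rule: finite_induct)
  case empty
  then show ?case using exists_ge_avg_Pow by auto
next
  case (insert T M)
  define A where "A Z = avg T (\<lambda>Y. F (Z \<union> Y))" for Z
  define W' where "W' = W - T"
  have T: "T \<subseteq> W" "card T = e" using insert.prems by auto
  have finT: "finite T" using finite_subset[OF T(1) insert.prems(1)] .
  have disj: "T' \<inter> T = {}" if "T' \<in> M" for T'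
    using insert.prems(3) insert.hyps that unfolding pairwise_insert disjnt_def by auto
  have "\<exists>Z\<subseteq>W'. avg W' A + real (card M) / 2 ^ (e + 1) \<le> A Z"
  proof (rule insert.IH)
    show "finite W'" using insert.prems by (simp add: W'_def)
    show "T' \<subseteq> W' \<and> card T' = e" if "T' \<in> M" for T'
      using insert.prems(2)[of T'] disj[of T'] that unfolding W'_def by auto
    show "pairwise disjnt M" using insert.prems(3) by (simp add: pairwise_insert)
    show "\<exists>\<delta>. 1 \<le> \<bar>\<delta>\<bar> \<and> (\<forall>X\<subseteq>W'. mdiff T' A X = \<delta>)" if "T' \<in> M" for T'
    proof -
      obtain \<delta> where d: "1 \<le> \<bar>\<delta>\<bar>" "\<And>X. X \<subseteq> W \<Longrightarrow> mdiff T' F X = \<delta>"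
        using insert.prems(4)[of T'] \<open>T' \<in> M\<close> by auto
      have "mdiff T' A X = \<delta>" if "X \<subseteq> W'" for X
      proof -
        have "mdiff T' A X = (\<Sum>Y\<in>Pow T. mdiff T' (\<lambda>Z. F (Z \<union> Y)) X) / 2 ^ card T"
          unfolding A_def avg_def mdiff_divide mdiff_sum ..
        also have "(\<Sum>Y\<in>Pow T. mdiff T' (\<lambda>Z. F (Z \<union> Y)) X) = (\<Sum>Y\<in>Pow T. \<delta>)"
        proof (rule sum.cong[OF refl])
          fix Y assume Y: "Y \<in> Pow T"
          then have "X - T' \<union> Y' \<union> Y = (X \<union> Y) - T' \<union> Y'" for Y'
            using disj[OF \<open>T' \<in> M\<close>] by auto
          then have "mdiff T' (\<lambda>Z. F (Z \<union> Y)) X = mdiff T' F (X \<union> Y)"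
            by (simp add: mdiff_def)
          then show "mdiff T' (\<lambda>Z. F (Z \<union> Y)) X = \<delta>"
            using d(2)[of "X \<union> Y"] Y T that by (auto simp: W'_def)
        qed
        finally show ?thesis using finT by (simp add: card_Pow)
      qed
      then show ?thesis using d by blast
    qed
  qed
  then obtain Z where Z: "Z \<subseteq> W'" "avg W' A + real (card M) / 2 ^ (e + 1) \<le> A Z" by blast
  have W'A: "avg W' A = avg W F"
    using avg_split[of W W' F] insert.prems(1) T
    by (simp add: W'_def A_def[abs_def] double_diff Un_commute)
  obtain \<delta> where d: "1 \<le> \<bar>\<delta>\<bar>" "\<And>X. X \<subseteq> W \<Longrightarrow> mdiff T F X = \<delta>"
    using insert.prems(4)[of T] by auto
  \<comment> \<open>The deviations \<open>g\<close> from the mean sum to 0, so their absolute values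
    add up to twice the sum of the positive parts. They also add up to at least
    \<open>\<bar>\<delta>\<bar>\<close>, hence to at least 1. With 2^e summands, one deviation must
    reach 1 / 2^(e+1).\<close>
  have "\<exists>Y\<subseteq>T. A Z + 1 / 2 ^ (e + 1) \<le> F (Z \<union> Y)"
  proof (rule ccontr)
    assume neg: "\<not> ?thesis"
    define g where "g Y = F (Z \<union> Y) - A Z" for Y
    have lt: "g Y < 1 / 2 ^ (e + 1)" if "Y \<in> Pow T" for Y
    proof (rule ccontr)
      assume "\<not> g Y < 1 / 2 ^ (e + 1)"
      then have "A Z + 1 / 2 ^ (e + 1) \<le> F (Z \<union> Y)" unfolding g_def by linarith
      then show False using neg that by blast
    qed
    have g0: "(\<Sum>Y\<in>Pow T. g Y) = 0"
      using finT by (simp add: g_def sum_subtractf A_def avg_def card_Pow)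
    have ZT: "Z - T = Z" using Z W'_def by auto
    have "mdiff T g {} = mdiff T F Z - mdiff T (\<lambda>_. A Z) Z"
      by (simp add: mdiff_def g_def ZT right_diff_distrib sum_subtractf)
    also have "\<dots> = \<delta>"
      using d(2)[of Z] Z finT T \<open>e > 0\<close> by (subst mdiff_const) (auto simp: W'_def)
    finally have "\<bar>\<delta>\<bar> = \<bar>\<Sum>Y\<in>Pow T. (-1) ^ card (T - Y) * g Y\<bar>" by (simp add: mdiff_def)
    also have "\<dots> \<le> (\<Sum>Y\<in>Pow T. \<bar>(-1) ^ card (T - Y) * g Y\<bar>)" by (rule sum_abs)
    also have "\<dots> = (\<Sum>Y\<in>Pow T. 2 * max (g Y) 0 - g Y)"
      by (intro sum.cong) (auto simp: abs_mult max_def)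
    also have "\<dots> = (\<Sum>Y\<in>Pow T. 2 * max (g Y) 0)"
      by (simp add: sum_subtractf g0)
    also have "\<dots> < (\<Sum>Y\<in>Pow T. 2 * (1 / 2 ^ (e + 1)))"
    proof (rule sum_strict_mono)
      fix Y assume "Y \<in> Pow T"
      then show "2 * max (g Y) 0 < 2 * (1 / 2 ^ (e + 1))"
        using lt[of Y] by (simp add: max_def)
    qed (use finT in auto)
    also have "\<dots> = 1" using finT T by (simp add: card_Pow)
    finally show False using d(1) by simp
  qed
  then obtain Y where "Y \<subseteq> T" "A Z + 1 / 2 ^ (e + 1) \<le> F (Z \<union> Y)" by blast
  then show ?case using Z W'A T insert.hyps
    by (intro exI[of _ "Z \<union> Y"]) (auto simp: W'_def add_divide_distrib)
qed

text \<open>An estimate of Schwartz-Zippel type. For \<open>R\<close> maximal with a nonvanishing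
  mixed difference, that difference is a nonzero constant and \<open>R\<close> has at most
  \<open>d\<close> elements. So however the coordinates outside \<open>R\<close> are fixed, some
  choice inside \<open>R\<close> makes \<open>H\<close> nonzero: every pattern on
  \<open>U - R\<close> extends to a good restriction on \<open>U\<close>.\<close>

lemma nonzero_fraction:
  assumes "finite W" "U \<subseteq> W" "deg_le d W H" "X0 \<subseteq> W" "H X0 \<noteq> 0"
  shows "2 ^ card U \<le> 2 ^ d * card {a \<in> Pow U. \<exists>Z\<subseteq>W - U. H (Z \<union> a) \<noteq> 0}"
proof -
  define RR where "RR = {R \<in> Pow W. \<exists>X\<subseteq>W. mdiff R H X \<noteq> 0}"
  have "finite RR" using assms by (simp add: RR_def)
  moreover have "{} \<in> RR" using assms by (auto simp: RR_def mdiff_def)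
  ultimately obtain R where R: "R \<in> RR" "\<And>R'. R' \<in> RR \<Longrightarrow> R \<subseteq> R' \<Longrightarrow> R' = R"
    using finite_has_maximal[of RR] by (metis empty_iff)
  have RW: "R \<subseteq> W" "finite R" using R(1) assms finite_subset by (auto simp: RR_def)
  have cR: "card R \<le> d"
    using R(1) assms(3) unfolding RR_def deg_le_def by (force simp: not_less[symmetric])
  have const: "mdiff R H X = mdiff R H {}" if "X \<subseteq> W" for X
  proof (rule mdiff_independent[OF \<open>finite W\<close> RW(2,1) _ that])
    fix t X assume t: "t \<in> W - R" "X \<subseteq> W"
    show "mdiff (insert t R) H X = 0"
    proof (rule ccontr)
      assume "mdiff (insert t R) H X \<noteq> 0"
      then have "insert t R \<in> RR" using t RW by (auto simp: RR_def)
      then show False using R(2)[of "insert t R"] t by auto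
    qed
  qed
  have nz: "\<exists>Y\<subseteq>R. H (X - R \<union> Y) \<noteq> 0" if "X \<subseteq> W" for X
  proof (rule ccontr)
    assume "\<not> ?thesis"
    then have "mdiff R H X = 0" by (auto simp: mdiff_def)
    then have "mdiff R H {} = 0" using const[OF that] by simp
    moreover obtain X' where "X' \<subseteq> W" "mdiff R H X' \<noteq> 0" using R(1) by (auto simp: RR_def)
    ultimately show False using const[of X'] by simp
  qed
  let ?G = "{a \<in> Pow U. \<exists>Z\<subseteq>W - U. H (Z \<union> a) \<noteq> 0}"
  have finU: "finite U" using assms finite_subset by auto
  have "Pow (U - R) \<subseteq> (\<lambda>a. a - R) ` ?G"
  proof
    fix b assume b: "b \<in> Pow (U - R)"
    obtain Y where Y: "Y \<subseteq> R" "H (b - R \<union> Y) \<noteq> 0" using nz[of b] b assms by blast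
    \<comment> \<open>The part of \<open>Y\<close> inside \<open>U\<close> joins the restriction and
      the part outside becomes its completion \<open>Z\<close>; removing \<open>R\<close> then
      recovers \<open>b\<close>.\<close>
    have "b - R \<union> Y = (Y - U) \<union> (b \<union> (Y \<inter> U))" using b by auto
    then have "H ((Y - U) \<union> (b \<union> (Y \<inter> U))) \<noteq> 0" using Y(2) by simp
    moreover have "Y - U \<subseteq> W - U" "b \<union> (Y \<inter> U) \<in> Pow U" using Y b RW by auto
    ultimately have "b \<union> (Y \<inter> U) \<in> ?G" by blast
    moreover have "b = b \<union> (Y \<inter> U) - R" using Y b by auto
    ultimately show "b \<in> (\<lambda>a. a - R) ` ?G" by blast
  qed
  then have "card (Pow (U - R)) \<le> card ?G"
    by (rule surj_card_le[rotated]) (use finU in auto)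
  then have "2 ^ card (U - R) \<le> card ?G" using finU by (simp add: card_Pow)
  moreover have "card U \<le> d + card (U - R)"
    using diff_card_le_card_Diff[OF RW(2), of U] cR by simp
  then have "(2::nat) ^ card U \<le> 2 ^ d * 2 ^ card (U - R)"
    unfolding power_add[symmetric] by (intro power_increasing) auto
  ultimately show ?thesis by (meson le_trans mult_le_mono2)
qed

lemma maximal_disjoint_family:
  assumes "finite \<T>" "{} \<notin> \<T>"
  obtains M where "M \<subseteq> \<T>" "pairwise disjnt M" "\<And>T. T \<in> \<T> \<Longrightarrow> T \<inter> \<Union>M \<noteq> {}"
proof -
  define FF where "FF = {M \<in> Pow \<T>. pairwise disjnt M}"
  have "finite FF" "{} \<in> FF" using assms by (auto simp: FF_def)
  then obtain M where M: "M \<in> FF" "\<And>M'. M' \<in> FF \<Longrightarrow> M \<subseteq> M' \<Longrightarrow> M' = M"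
    using finite_has_maximal[of FF] by (metis empty_iff)
  have "T \<inter> \<Union>M \<noteq> {}" if "T \<in> \<T>" for T
  proof
    assume *: "T \<inter> \<Union>M = {}"
    then have "insert T M \<in> FF"
      using M(1) that unfolding FF_def by (auto simp: pairwise_insert disjnt_def)
    then have "T \<in> M" using M(2) by blast
    then have "T = {}" using * by blast
    then show False using that assms by simp
  qed
  then show ?thesis using that M(1) unfolding FF_def by blast
qed

text \<open>With \<open>m\<close> members in the family and \<open>r\<close> relevant coordinates,
  gaining on the members yields \<open>c1 * m\<close> and restricting yields
  \<open>c2 * (r - (d + 1) * m)\<close>. On either side of r = 2 (d + 1) m, one of the two is at
  least \<open>\<eta> * r\<close>. Integrality keeps nonzero top differences at 1 or more in
  absolute value, so \<open>\<epsilon>\<close> does not depend on \<open>W\<close> or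
  \<open>F\<close>.\<close>

lemma max_ge_avg_plus_relevant:
  "\<exists>\<epsilon>::real. \<epsilon> > 0 \<and> (\<forall>W F. finite W \<longrightarrow> deg_le d W F \<longrightarrow> (\<forall>X\<subseteq>W. F X \<in> \<int>) \<longrightarrow>
     (\<exists>X\<subseteq>W. avg W F + \<epsilon> * card (relevant W F) \<le> F X))"
proof (induction d)
  case 0
  have "relevant W F = {}" if "deg_le 0 W F" for W :: "'a set" and F
  proof -
    have "F (insert v X) = F (X - {v})" if "v \<in> W" "X \<subseteq> W" for v X
      using \<open>deg_le 0 W F\<close> that by (force simp: deg_le_def mdiff_single dest: spec[of _ "{v}"])
    then show ?thesis by (auto simp: relevant_def)
  qed
  then show ?case using exists_ge_avg_Pow by (intro exI[of _ 1]) auto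
next
  case (Suc d)
  then obtain \<epsilon> :: real where eps: "\<epsilon> > 0" and IH:
    "\<And>(W :: 'a set) F. finite W \<Longrightarrow> deg_le d W F \<Longrightarrow> (\<And>X. X \<subseteq> W \<Longrightarrow> F X \<in> \<int>) \<Longrightarrow>
     \<exists>X\<subseteq>W. avg W F + \<epsilon> * card (relevant W F) \<le> F X"
    by blast
  \<comment> \<open>\<open>c1\<close> is the gain per member in
    \<open>max_ge_disjoint_family\<close> for sets of size d + 1; \<open>c2\<close> is the inductive
    gain reduced by the survival fraction of \<open>nonzero_fraction\<close>.\<close>
  define c1 :: real where "c1 = 1 / 2 ^ (d + 2)"
  define c2 :: real where "c2 = \<epsilon> / 2 ^ (d + 1)"
  define \<eta> where "\<eta> = min (c1 / (2 * (d + 1))) (c2 / 2)"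
  have pos: "c1 > 0" "c2 > 0" using eps by (auto simp: c1_def c2_def)
  have "\<exists>X\<subseteq>W. avg W F + \<eta> * card (relevant W F) \<le> F X"
    if W: "finite W" and deg: "deg_le (Suc d) W F" and int: "\<And>X. X \<subseteq> W \<Longrightarrow> F X \<in> \<int>"
    for W :: "'a set" and F
  proof -
    define \<T> where "\<T> = {T \<in> Pow W. card T = d + 1 \<and> (\<exists>X\<subseteq>W. mdiff T F X \<noteq> 0)}"
    have "finite \<T>" "{} \<notin> \<T>" using W by (auto simp: \<T>_def)
    then obtain M where M: "M \<subseteq> \<T>" "pairwise disjnt M" "\<And>T. T \<in> \<T> \<Longrightarrow> T \<inter> \<Union>M \<noteq> {}"
      by (rule maximal_disjoint_family) blast
    define U where "U = \<Union>M"
    define m where "m = card M"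
    define r where "r = card (relevant W F)"
    have finM: "finite M" using M(1) \<open>finite \<T>\<close> finite_subset by auto
    have UW: "U \<subseteq> W" using M(1) by (auto simp: U_def \<T>_def)
    have finU: "finite U" using UW W finite_subset by auto
    have "card U \<le> (\<Sum>T\<in>M. card T)" unfolding U_def by (rule card_Union_le_sum_card)
    also have "\<dots> = (d + 1) * m" using M(1) by (simp add: \<T>_def m_def subset_iff)
    finally have cU: "card U \<le> (d + 1) * m" .
    have 1: "\<exists>X\<subseteq>W. avg W F + c1 * m \<le> F X"
    proof -
      have "\<exists>X\<subseteq>W. avg W F + real (card M) / 2 ^ ((d + 1) + 1) \<le> F X"
      proof (rule max_ge_disjoint_family[OF finM W _ _ M(2)])
        fix T assume "T \<in> M"
        then have T: "T \<subseteq> W" "card T = d + 1" "\<exists>X\<subseteq>W. mdiff T F X \<noteq> 0"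
          using M(1) by (auto simp: \<T>_def)
        then show "T \<subseteq> W \<and> card T = d + 1" by simp
        have finT: "finite T" using T W finite_subset by auto
        have const: "mdiff T F X = mdiff T F {}" if "X \<subseteq> W" for X
        proof (rule mdiff_independent[OF W finT T(1) _ that])
          fix t X assume "t \<in> W - T" "X \<subseteq> W"
          then show "mdiff (insert t T) F X = 0"
            using deg T finT by (auto simp: deg_le_def)
        qed
        have "mdiff T F {} \<in> \<int>"
          unfolding mdiff_def using int T by (intro Ints_sum Ints_mult Ints_power) auto
        moreover have "mdiff T F {} \<noteq> 0" using T(3) const by metis
        ultimately have "1 \<le> \<bar>mdiff T F {}\<bar>" by (rule Ints_nonzero_abs_ge1)
        then show "\<exists>\<delta>. 1 \<le> \<bar>\<delta>\<bar> \<and> (\<forall>X\<subseteq>W. mdiff T F X = \<delta>)" using const by blast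
      qed simp
      then show ?thesis by (simp add: c1_def m_def)
    qed
    have 2: "\<exists>X\<subseteq>W. avg W F + c2 * (real r - (d + 1) * m) \<le> F X"
    proof -
      define Fa where "Fa a Z = F (Z \<union> a)" for a Z
      define rel where "rel a = relevant (W - U) (Fa a)" for a
      have "\<exists>X\<subseteq>W - U. avg (W - U) (Fa a) + \<epsilon> * card (rel a) \<le> Fa a X" if "a \<subseteq> U" for a
        unfolding rel_def
      proof (rule IH)
        show "deg_le d (W - U) (Fa a)"
          unfolding deg_le_def
        proof (intro allI impI)
          fix T X assume T: "T \<subseteq> W - U" "X \<subseteq> W - U" "d < card T"
          have "X - T \<union> Y \<union> a = (X \<union> a) - T \<union> Y" for Y using T that by auto
          then have "mdiff T (Fa a) X = mdiff T F (X \<union> a)" by (simp add: mdiff_def Fa_def)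
          \<comment> \<open>A set of size d + 1 inside \<open>W - U\<close> misses \<open>U\<close>,
            so by maximality of \<open>M\<close> its differences vanish; larger sets are covered by
            the degree of \<open>F\<close>.\<close>
          also have "\<dots> = 0"
          proof (cases "card T = d + 1")
            case True
            then have "T \<notin> \<T>" using M(3)[of T] T by (auto simp: U_def)
            moreover have "X \<union> a \<subseteq> W" using T that UW by auto
            ultimately show ?thesis using T True by (auto simp: \<T>_def)
          next
            case False
            then show ?thesis using deg T that UW unfolding deg_le_def
              by (metis Diff_subset Suc_eq_plus1 Suc_lessI Un_least dual_order.trans)
          qed
          finally show "mdiff T (Fa a) X = 0" .
        qed
        show "Fa a X \<in> \<int>" if "X \<subseteq> W - U" for X
          using int[of "X \<union> a"] that \<open>a \<subseteq> U\<close> UW by (auto simp: Fa_def)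
      qed (use W in auto)
      then have max_a: "\<exists>X\<subseteq>W. avg (W - U) (Fa a) + \<epsilon> * card (rel a) \<le> F X" if "a \<subseteq> U" for a
        using that UW unfolding Fa_def by (metis Diff_subset Un_least dual_order.trans)
      \<comment> \<open>Relevance of \<open>v\<close> means that the difference \<open>H\<close> in
        direction \<open>v\<close> is not identically 0, and relevance after fixing \<open>a\<close>
        that \<open>H\<close> is not identically 0 on that fibre. So \<open>nonzero_fraction\<close>
        counts the restrictions that keep \<open>v\<close> relevant.\<close>
      have frac: "2 ^ card U \<le> 2 ^ (d + 1) * real (card {a \<in> Pow U. v \<in> rel a})"
        if v: "v \<in> relevant W F - U" for v
      proof -
        define H where "H = mdiff {v} F"
        obtain X0 where X0: "X0 \<subseteq> W" "H X0 \<noteq> 0"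
          using v unfolding relevant_def H_def mdiff_single by auto
        have vW: "v \<in> W - U" using v by (auto simp: relevant_def)
        have "deg_le (d + 1) W H"
          unfolding deg_le_def
        proof (intro allI impI)
          fix T X assume T: "T \<subseteq> W" "X \<subseteq> W" "d + 1 < card T"
          then have "finite T" using W finite_subset by auto
          then show "mdiff T H X = 0"
            using T deg vW unfolding H_def deg_le_def by (auto simp: mdiff_comm_single)
        qed
        then have "2 ^ card U \<le> 2 ^ (d + 1) * card {a \<in> Pow U. \<exists>Z\<subseteq>W - U. H (Z \<union> a) \<noteq> 0}"
          using nonzero_fraction[of W U "d + 1" H X0] W UW X0 by blast
        also have "{a \<in> Pow U. \<exists>Z\<subseteq>W - U. H (Z \<union> a) \<noteq> 0} = {a \<in> Pow U. v \<in> rel a}"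
        proof -
          have H: "H (Z \<union> a) = Fa a (insert v Z) - Fa a (Z - {v})" if "a \<subseteq> U" for a Z
          proof -
            have "(Z \<union> a) - {v} = (Z - {v}) \<union> a" using that vW by auto
            then show ?thesis by (simp add: H_def mdiff_single Fa_def)
          qed
          then have "(\<exists>Z\<subseteq>W - U. H (Z \<union> a) \<noteq> 0) \<longleftrightarrow> v \<in> rel a" if "a \<subseteq> U" for a
            using vW that by (simp add: rel_def relevant_def)
          then show ?thesis by blast
        qed
        finally have "2 ^ card U \<le> 2 ^ (d + 1) * card {a \<in> Pow U. v \<in> rel a}" .
        then have "real (2 ^ card U) \<le> real (2 ^ (d + 1) * card {a \<in> Pow U. v \<in> rel a})"
          by (rule of_nat_mono)
        then show ?thesis by simp
      qed
      have rr: "real r - (d + 1) * m \<le> card (relevant W F - U)"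
      proof -
        have "r \<le> card (relevant W F - U) + card U"
          unfolding r_def using diff_card_le_card_Diff[OF finU] by (simp add: le_diff_conv)
        then have "r \<le> card (relevant W F - U) + (d + 1) * m" using cU by simp
        then have "real r \<le> real (card (relevant W F - U) + (d + 1) * m)" by (rule of_nat_mono)
        then show ?thesis by simp
      qed
      have finrel: "finite (relevant W F)" "finite (rel a)" for a
        using W by (auto simp: relevant_def rel_def)
      \<comment> \<open>Double counting of the pairs of a coordinate and a restriction that keeps it
        relevant.\<close>
      have "card (relevant W F - U) * 2 ^ card U
          = (\<Sum>v\<in>relevant W F - U. (2::real) ^ card U)" by simp
      also have "\<dots> \<le> (\<Sum>v\<in>relevant W F - U. 2 ^ (d + 1) * real (card {a \<in> Pow U. v \<in> rel a}))"
        by (intro sum_mono frac)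
      also have "\<dots> = 2 ^ (d + 1) * (\<Sum>v\<in>relevant W F - U. \<Sum>a\<in>Pow U. of_bool (v \<in> rel a))"
        using finU by (simp add: sum_distrib_left Int_def flip: sum_distrib_left)
      also have "(\<Sum>v\<in>relevant W F - U. \<Sum>a\<in>Pow U. of_bool (v \<in> rel a))
           = (\<Sum>a\<in>Pow U. \<Sum>v\<in>relevant W F - U. (of_bool (v \<in> rel a) :: real))"
        by (rule sum.swap)
      also have "\<dots> \<le> (\<Sum>a\<in>Pow U. real (card (rel a)))"
      proof (rule sum_mono)
        fix a
        have "(\<Sum>v\<in>relevant W F - U. (of_bool (v \<in> rel a) :: real))
            = card ((relevant W F - U) \<inter> rel a)"
          using finrel by (simp add: Int_def)
        also have "\<dots> \<le> card (rel a)" using finrel by (simp add: card_mono)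
        finally show "(\<Sum>v\<in>relevant W F - U. (of_bool (v \<in> rel a) :: real)) \<le> card (rel a)" .
      qed
      also have "\<dots> = 2 ^ card U * avg U (\<lambda>a. card (rel a))" by (simp add: avg_def)
      finally have "card (relevant W F - U) \<le> 2 ^ (d + 1) * avg U (\<lambda>a. card (rel a))"
        by (simp add: mult.left_commute)
      then have "c2 * card (relevant W F - U) \<le> \<epsilon> * avg U (\<lambda>a. card (rel a))"
        using eps by (simp add: c2_def field_simps)
      moreover have "c2 * (real r - (d + 1) * m) \<le> c2 * card (relevant W F - U)"
        using rr pos by (intro mult_left_mono) auto
      moreover have "avg W F + \<epsilon> * avg U (\<lambda>a. card (rel a))
          = avg U (\<lambda>a. avg (W - U) (Fa a) + \<epsilon> * card (rel a))"
        unfolding avg_split[OF W UW, of F] Fa_def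
        by (simp add: avg_def[of U] sum.distrib add_divide_distrib flip: sum_distrib_left)
      \<comment> \<open>Choosing \<open>a\<close> at least average for the sum of both terms
        balances the conditional mean against the number of surviving coordinates.\<close>
      moreover obtain a where "a \<subseteq> U" "avg U (\<lambda>a. avg (W - U) (Fa a) + \<epsilon> * card (rel a))
          \<le> avg (W - U) (Fa a) + \<epsilon> * card (rel a)"
        using exists_ge_avg_Pow[OF finU] by blast
      moreover obtain X where "X \<subseteq> W" "avg (W - U) (Fa a) + \<epsilon> * card (rel a) \<le> F X"
        using max_a[OF \<open>a \<subseteq> U\<close>] by blast
      ultimately show ?thesis by (intro exI[of _ X]) linarith
    qed
    show ?thesis
    proof (cases "2 * ((d + 1) * m) \<ge> r")
      case True
      then have "real r \<le> real (2 * ((d + 1) * m))" by (rule of_nat_mono)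
      then have "c1 / (2 * (d + 1)) * r \<le> c1 / (2 * (d + 1)) * (2 * (d + 1) * m)"
        using pos by (intro mult_left_mono) (auto simp: algebra_simps)
      also have "\<dots> = c1 * m" by (simp add: field_simps)
      finally have "\<eta> * r \<le> c1 * m" unfolding \<eta>_def
        by (smt (verit) min.cobounded1 mult_right_mono of_nat_0_le_iff)
      moreover obtain X where "X \<subseteq> W" "avg W F + c1 * m \<le> F X" using 1 by blast
      ultimately show ?thesis by (intro exI[of _ X]) (simp add: r_def)
    next
      case False
      then have "real (2 * ((d + 1) * m)) \<le> real r" by (intro of_nat_mono) simp
      then have "c2 * (r / 2) \<le> c2 * (real r - (d + 1) * m)"
        using pos by (intro mult_left_mono) (auto simp: algebra_simps)
      moreover have "\<eta> * r \<le> c2 / 2 * r"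
        unfolding \<eta>_def by (intro mult_right_mono min.cobounded2) simp
      moreover obtain X where "X \<subseteq> W" "avg W F + c2 * (real r - (d + 1) * m) \<le> F X"
        using 2 by blast
      ultimately show ?thesis by (intro exI[of _ X]) (simp add: r_def)
    qed
  qed
  moreover have "\<eta> > 0" using pos by (simp add: \<eta>_def)
  ultimately show ?case by blast
qed

text \<open>Once all proper subsets of \<open>R\<close> give 0, the mixed difference over
  \<open>R\<close> reduces to \<open>F R\<close>, and it vanishes if \<open>R\<close> has more than
  \<open>d\<close> elements. Thus polynomially many evaluations certify that a function of bounded
  degree is 0.\<close>

lemma deg_le_vanish:
  assumes "deg_le d W F" "\<And>R. R \<subseteq> W \<Longrightarrow> card R \<le> d \<Longrightarrow> F R = 0" "finite R" "R \<subseteq> W"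
  shows "F R = 0"
  using assms(3,4)
proof (induction R rule: finite_psubset_induct)
  case (psubset R)
  show ?case
  proof (cases "card R \<le> d")
    case False
    then have "mdiff R F R = 0" using assms(1) psubset.prems by (auto simp: deg_le_def)
    moreover have "mdiff R F R = (\<Sum>Y\<in>Pow R. if Y = R then F R else 0)"
      unfolding mdiff_def using psubset by (intro sum.cong) auto
    ultimately show ?thesis using psubset.hyps by simp
  qed (use assms psubset in auto)
qed

section \<open>Random orderings\<close>

lemma rel_order_eqI:
  assumes "length S = length S'"
    and "\<And>i j. i < length S \<Longrightarrow> j < length S \<Longrightarrow> f (S ! i) \<le> f (S ! j) \<longleftrightarrow> g (S' ! i) \<le> g (S' ! j)"
  shows "rel_order f S = rel_order g S'"
proof
  fix i
  show "rel_order f S i = rel_order g S' i"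
  proof (cases "i \<in> {1..length S}")
    case True
    then have "{j \<in> {1..length S}. f (S ! (j - 1)) \<le> f (S ! (i - 1))}
        = {j \<in> {1..length S'}. g (S' ! (j - 1)) \<le> g (S' ! (i - 1))}"
      using assms by auto
    then show ?thesis using True assms(1) by (simp add: rel_order_def)
  qed (use assms(1) in \<open>auto simp: rel_order_def\<close>)
qed

lemma rel_order_cong:
  assumes "\<And>u v. u \<in> set S \<Longrightarrow> v \<in> set S \<Longrightarrow> f u \<le> f v \<longleftrightarrow> g u \<le> g v"
  shows "rel_order f S = rel_order g S"
  using assms by (intro rel_order_eqI) auto

lemma rel_order_map: "rel_order f (map g S) = rel_order (\<lambda>v. f (g v)) S"
  by (intro rel_order_eqI) auto

lemma rel_order_range:
  assumes "i \<in> {1..length S}" shows "rel_order h S i \<in> {1..length S}"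
proof -
  let ?A = "{j \<in> {1..length S}. h (S ! (j - 1)) \<le> h (S ! (i - 1))}"
  have "card {i} \<le> card ?A" using assms by (intro card_mono) auto
  moreover have "card ?A \<le> card {1..length S}" by (intro card_mono) auto
  ultimately show ?thesis using assms by (simp add: rel_order_def)
qed

lemma rel_order_le_iff:
  assumes "i \<in> {1..length S}" "j \<in> {1..length S}"
  shows "rel_order h S i \<le> rel_order h S j \<longleftrightarrow> h (S ! (i - 1)) \<le> h (S ! (j - 1))"
proof -
  let ?A = "\<lambda>i. {j \<in> {1..length S}. h (S ! (j - 1)) \<le> h (S ! (i - 1))}"
  show ?thesis
  proof (cases "h (S ! (i - 1)) \<le> h (S ! (j - 1))")
    case True
    then have "card (?A i) \<le> card (?A j)" by (intro card_mono) auto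
    then show ?thesis using True assms by (simp add: rel_order_def)
  next
    case False
    have "card (?A j) < card (?A i)"
    proof (rule psubset_card_mono)
      have "?A j \<subseteq> ?A i" using False by auto
      moreover have "i \<in> ?A i - ?A j" using assms False by simp
      ultimately show "?A j \<subset> ?A i" by blast
    qed simp
    then show ?thesis using False assms by (simp add: rel_order_def)
  qed
qed

lemma rel_order_perms:
  assumes "distinct S" "inj_on h (set S)"
  shows "rel_order h S \<in> perms (length S)"
proof -
  have inj: "inj_on (rel_order h S) {1..length S}"
  proof (rule inj_onI)
    fix i j assume ij: "i \<in> {1..length S}" "j \<in> {1..length S}" "rel_order h S i = rel_order h S j"
    then have "h (S ! (i - 1)) = h (S ! (j - 1))"
      using rel_order_le_iff[of i S j h] rel_order_le_iff[of j S i h] by simp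
    moreover have "i - 1 < length S" "j - 1 < length S" using ij by auto
    ultimately have "i - 1 = j - 1"
      using assms by (metis inj_onD nth_eq_iff_index_eq nth_mem)
    then show "i = j" using ij by auto
  qed
  moreover have "rel_order h S ` {1..length S} \<subseteq> {1..length S}"
    using rel_order_range by blast
  ultimately have "rel_order h S ` {1..length S} = {1..length S}"
    by (intro endo_inj_surj) auto
  then have "bij_betw (rel_order h S) {1..length S} {1..length S}"
    using inj by (simp add: bij_betw_def)
  then have "rel_order h S permutes {1..length S}"
    by (rule bij_imp_permutes) (auto simp: rel_order_def)
  then show ?thesis by (simp add: perms_def)
qed

lemma perms_range: "\<pi> \<in> perms a \<Longrightarrow> i \<in> {1..a} \<Longrightarrow> \<pi> i \<in> {1..a}"
  unfolding perms_def mem_Collect_eq by (rule iffD2[OF permutes_in_image])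

lemma finite_perms [simp]: "finite (perms a)"
  by (simp add: perms_def finite_permutations)

lemma card_perms: "card (perms a) = fact a"
  by (simp add: perms_def card_permutations)

text \<open>\<open>\<sigma>\<close> maps the positions counted by the rank on the left bijectively
  onto those counted on the right.\<close>

lemma rel_order_compose:
  assumes "\<sigma> \<in> perms (length S)"
    and "\<And>i. i \<in> {1..length S} \<Longrightarrow> \<rho> (S ! (i - 1)) = S ! (\<sigma> i - 1)"
  shows "rel_order (\<lambda>v. h (\<rho> v)) S = rel_order h S \<circ> \<sigma>"
proof
  fix i
  have \<sigma>: "\<sigma> permutes {1..length S}" using assms(1) by (simp add: perms_def)
  show "rel_order (\<lambda>v. h (\<rho> v)) S i = (rel_order h S \<circ> \<sigma>) i"
  proof (cases "i \<in> {1..length S}")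
    case True
    have "\<sigma> ` {j \<in> {1..length S}. h (S ! (\<sigma> j - 1)) \<le> h (S ! (\<sigma> i - 1))}
        = {j \<in> {1..length S}. h (S ! (j - 1)) \<le> h (S ! (\<sigma> i - 1))}" (is "\<sigma> ` ?A = ?B")
    proof
      show "\<sigma> ` ?A \<subseteq> ?B" using permutes_in_image[OF \<sigma>] by auto
      show "?B \<subseteq> \<sigma> ` ?A"
      proof
        fix j assume j: "j \<in> ?B"
        then have "inv \<sigma> j \<in> {1..length S}" "\<sigma> (inv \<sigma> j) = j"
          using permutes_in_image[OF permutes_inv[OF \<sigma>]] permutes_inverses[OF \<sigma>] by auto
        then show "j \<in> \<sigma> ` ?A" using j by (intro image_eqI[of _ _ "inv \<sigma> j"]) auto
      qed
    qed
    then have "card ?A = card ?B" using card_image[OF permutes_inj_on[OF \<sigma>], of ?A] by simp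
    moreover have "{j \<in> {1..length S}. h (\<rho> (S ! (j - 1))) \<le> h (\<rho> (S ! (i - 1)))} = ?A"
      unfolding assms(2)[OF True] by (rule Collect_cong) (use assms(2) in metis)
    moreover have "\<sigma> i \<in> {1..length S}" by (rule perms_range[OF assms(1) True])
    ultimately show ?thesis using True unfolding rel_order_def comp_def by (simp only: if_True)
  next
    case False
    then have "\<sigma> i = i" using permutes_not_in[OF \<sigma>] by blast
    then show ?thesis using False by (auto simp: rel_order_def)
  qed
qed

text \<open>Transports a permutation of positions to one of variables, the form in which symmetries
  act on a sample space.\<close>

lemma exists_permutation_lift:
  assumes "distinct S" "\<sigma> \<in> perms (length S)"
  obtains \<rho> where "\<rho> permutes set S" "\<And>i. i \<in> {1..length S} \<Longrightarrow> \<rho> (S ! (i - 1)) = S ! (\<sigma> i - 1)"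
proof -
  define f where "f i = S ! (i - 1)" for i
  have bij: "bij_betw f {1..length S} (set S)"
  proof -
    have "bij_betw ((!) S) {..<length S} (set S)" by (rule bij_betw_nth[OF assms(1)]) auto
    moreover have "bij_betw (\<lambda>i. i - 1) {1..length S} {..<length S}"
      by (rule bij_betw_byWitness[of _ Suc]) auto
    ultimately show ?thesis unfolding f_def using bij_betw_trans[unfolded o_def] by fast
  qed
  let ?\<rho> = "\<lambda>x. if x \<in> set S then f (\<sigma> (inv_into {1..length S} f x)) else x"
  have "?\<rho> permutes set S"
    using permutes_bij_inv_into[OF _ bij, of \<sigma>] assms(2) by (simp add: perms_def)
  moreover have "?\<rho> (S ! (i - 1)) = S ! (\<sigma> i - 1)" if "i \<in> {1..length S}" for i
  proof -
    have "inv_into {1..length S} f (f i) = i"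
      using bij that by (simp add: bij_betw_def inv_into_f_f)
    moreover have "f i \<in> set S" using bij that by (auto simp: bij_betw_def)
    ultimately show ?thesis by (simp add: f_def)
  qed
  ultimately show ?thesis using that by blast
qed

text \<open>Replacing \<open>\<omega>\<close> by its image under the action leaves the sum unchanged
  and precomposes the relative order by \<open>\<sigma>\<close>; letting \<open>\<sigma>\<close>
  vary runs through all permutations for each fixed \<open>\<omega>\<close>. Kept abstract since it
  serves both plain orderings and pairs of label bits and orderings, and comparing the two yields
  \<open>avg_G\<close>.\<close>

lemma uniform_rel_order:
  fixes F :: "(nat \<Rightarrow> nat) \<Rightarrow> nat"
  assumes "distinct S"
    and inj: "\<And>\<omega>. \<omega> \<in> \<Omega> \<Longrightarrow> inj_on (key \<omega>) (set S)"
    and act: "\<And>\<rho>. \<rho> permutes set S \<Longrightarrow>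
      \<exists>\<alpha>. bij_betw \<alpha> \<Omega> \<Omega> \<and> (\<forall>\<omega>\<in>\<Omega>. \<forall>v\<in>set S. key (\<alpha> \<omega>) v = key \<omega> (\<rho> v))"
  shows "fact (length S) * (\<Sum>\<omega>\<in>\<Omega>. F (rel_order (key \<omega>) S))
       = card \<Omega> * (\<Sum>\<pi>\<in>perms (length S). F \<pi>)"
proof -
  let ?P = "perms (length S)"
  have *: "(\<Sum>\<omega>\<in>\<Omega>. F (rel_order (key \<omega>) S)) = (\<Sum>\<omega>\<in>\<Omega>. F (rel_order (key \<omega>) S \<circ> \<sigma>))"
    if \<sigma>: "\<sigma> \<in> ?P" for \<sigma>
  proof -
    obtain \<rho> where \<rho>: "\<rho> permutes set S"
      "\<And>i. i \<in> {1..length S} \<Longrightarrow> \<rho> (S ! (i - 1)) = S ! (\<sigma> i - 1)"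
      using exists_permutation_lift[OF assms(1) \<sigma>] by blast
    obtain \<alpha> where \<alpha>: "bij_betw \<alpha> \<Omega> \<Omega>" "\<And>\<omega> v. \<omega> \<in> \<Omega> \<Longrightarrow> v \<in> set S \<Longrightarrow> key (\<alpha> \<omega>) v = key \<omega> (\<rho> v)"
      using act[OF \<rho>(1)] by blast
    have "(\<Sum>\<omega>\<in>\<Omega>. F (rel_order (key \<omega>) S)) = (\<Sum>\<omega>\<in>\<Omega>. F (rel_order (key (\<alpha> \<omega>)) S))"
      by (rule sum.reindex_bij_betw[OF \<alpha>(1), symmetric])
    also have "\<dots> = (\<Sum>\<omega>\<in>\<Omega>. F (rel_order (\<lambda>v. key \<omega> (\<rho> v)) S))"
      using \<alpha>(2) by (intro sum.cong refl arg_cong[of _ _ F] rel_order_cong) auto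
    also have "\<dots> = (\<Sum>\<omega>\<in>\<Omega>. F (rel_order (key \<omega>) S \<circ> \<sigma>))"
      using rel_order_compose[OF \<sigma> \<rho>(2)] by simp
    finally show ?thesis .
  qed
  have "fact (length S) * (\<Sum>\<omega>\<in>\<Omega>. F (rel_order (key \<omega>) S))
      = (\<Sum>\<sigma>\<in>?P. \<Sum>\<omega>\<in>\<Omega>. F (rel_order (key \<omega>) S))"
    by (simp add: card_perms)
  also have "\<dots> = (\<Sum>\<sigma>\<in>?P. \<Sum>\<omega>\<in>\<Omega>. F (rel_order (key \<omega>) S \<circ> \<sigma>))"
    using * by (rule sum.cong[OF refl])
  also have "\<dots> = (\<Sum>\<omega>\<in>\<Omega>. \<Sum>\<sigma>\<in>?P. F (rel_order (key \<omega>) S \<circ> \<sigma>))"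
    by (rule sum.swap)
  also have "\<dots> = (\<Sum>\<omega>\<in>\<Omega>. \<Sum>\<pi>\<in>?P. F \<pi>)"
  proof (rule sum.cong[OF refl])
    fix \<omega> assume "\<omega> \<in> \<Omega>"
    then have p: "rel_order (key \<omega>) S permutes {1..length S}"
      using rel_order_perms[OF assms(1) inj] by (simp add: perms_def)
    have "bij_betw (\<lambda>\<sigma>. rel_order (key \<omega>) S \<circ> \<sigma>) ?P ?P"
      unfolding perms_def
      by (rule bij_betw_byWitness[of _ "\<lambda>\<sigma>. inv (rel_order (key \<omega>) S) \<circ> \<sigma>"])
         (use p permutes_inv[OF p] permutes_compose in \<open>auto simp: permutes_inv_o[OF p] simp flip: comp_assoc\<close>)
    then show "(\<Sum>\<sigma>\<in>?P. F (rel_order (key \<omega>) S \<circ> \<sigma>)) = (\<Sum>\<pi>\<in>?P. F \<pi>)"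
      by (rule sum.reindex_bij_betw)
  qed
  finally show ?thesis by simp
qed

section \<open>Orderings as ranks of injective functions\<close>

lemma orderings_inj: "\<phi> \<in> orderings V \<Longrightarrow> inj_on \<phi> V"
  by (auto simp: orderings_def bij_betw_def)

lemma orderings_range: "\<phi> \<in> orderings V \<Longrightarrow> v \<in> V \<Longrightarrow> \<phi> v \<in> {1..card V}"
  by (auto simp: orderings_def bij_betw_def)

lemma finite_orderings: "finite V \<Longrightarrow> finite (orderings V)"
  unfolding orderings_def by (rule finite_subset[of _ "V \<rightarrow>\<^sub>E {1..card V}"]) (auto intro: finite_PiE)

lemma ordering_of_inj:
  fixes h :: "nat \<Rightarrow> nat"
  assumes "finite V" "inj_on h V"
  obtains \<phi> where "\<phi> \<in> orderings V" "\<And>u v. u \<in> V \<Longrightarrow> v \<in> V \<Longrightarrow> \<phi> u \<le> \<phi> v \<longleftrightarrow> h u \<le> h v"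
proof -
  define \<phi> where "\<phi> = restrict (\<lambda>v. card {u \<in> V. h u \<le> h v}) V"
  have le: "\<phi> u \<le> \<phi> v \<longleftrightarrow> h u \<le> h v" if "u \<in> V" "v \<in> V" for u v
  proof (cases "h u \<le> h v")
    case True
    then have "card {w \<in> V. h w \<le> h u} \<le> card {w \<in> V. h w \<le> h v}"
      using assms by (intro card_mono) auto
    then show ?thesis using True that by (simp add: \<phi>_def)
  next
    case False
    have "card {w \<in> V. h w \<le> h v} < card {w \<in> V. h w \<le> h u}"
    proof (rule psubset_card_mono)
      have "u \<in> {w \<in> V. h w \<le> h u} - {w \<in> V. h w \<le> h v}" using that False by simp
      moreover have "{w \<in> V. h w \<le> h v} \<subseteq> {w \<in> V. h w \<le> h u}" using False by auto
      ultimately show "{w \<in> V. h w \<le> h v} \<subset> {w \<in> V. h w \<le> h u}" by blast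
    qed (use assms in simp)
    then show ?thesis using False that by (simp add: \<phi>_def)
  qed
  have inj: "inj_on \<phi> V"
  proof (rule inj_onI)
    fix u v assume uv: "u \<in> V" "v \<in> V" "\<phi> u = \<phi> v"
    then have "h u = h v" using le[OF uv(1,2)] le[OF uv(2,1)] by simp
    then show "u = v" using assms(2) uv by (simp add: inj_on_eq_iff)
  qed
  have "\<phi> ` V \<subseteq> {1..card V}"
  proof
    fix i assume "i \<in> \<phi> ` V"
    then obtain v where v: "v \<in> V" "i = card {u \<in> V. h u \<le> h v}" by (auto simp: \<phi>_def)
    have "card {v} \<le> card {u \<in> V. h u \<le> h v}" using v assms by (intro card_mono) auto
    moreover have "card {u \<in> V. h u \<le> h v} \<le> card V" using assms by (intro card_mono) auto
    ultimately show "i \<in> {1..card V}" using v by simp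
  qed
  then have "\<phi> ` V = {1..card V}"
    using card_image[OF inj] by (intro card_subset_eq) auto
  then have "\<phi> \<in> orderings V"
    using inj by (auto simp: orderings_def bij_betw_def \<phi>_def)
  then show ?thesis using that le by blast
qed

lemma orderings_nonempty: "finite V \<Longrightarrow> orderings V \<noteq> {}"
  by (rule ordering_of_inj[of V id]) auto

lemma bij_betw_compose_orderings:
  assumes "\<rho> permutes V"
  shows "bij_betw (\<lambda>\<phi>. \<phi> \<circ> \<rho>) (orderings V) (orderings V)"
proof -
  have *: "\<phi> \<circ> \<rho> \<in> orderings V" if "\<phi> \<in> orderings V" "\<rho> permutes V" for \<phi> \<rho>
  proof -
    have "bij_betw (\<phi> \<circ> \<rho>) V {1..card V}"
      using that permutes_imp_bij[OF that(2)] bij_betw_trans by (auto simp: orderings_def)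
    moreover have "\<phi> \<circ> \<rho> \<in> extensional V"
      using that permutes_not_in[OF that(2)] by (auto simp: orderings_def PiE_def extensional_def)
    ultimately show ?thesis unfolding orderings_def PiE_def by (auto simp: bij_betw_def)
  qed
  show ?thesis
    by (rule bij_betw_byWitness[of _ "\<lambda>\<phi>. \<phi> \<circ> inv \<rho>"])
       (use * assms permutes_inv[OF assms] in
         \<open>auto simp: comp_assoc permutes_inv_o[OF assms]\<close>)
qed

lemma sum_orderings_rel_order:
  fixes F :: "(nat \<Rightarrow> nat) \<Rightarrow> nat"
  assumes "distinct S" "set S \<subseteq> V"
  shows "fact (length S) * (\<Sum>\<phi>\<in>orderings V. F (rel_order \<phi> S))
       = card (orderings V) * (\<Sum>\<pi>\<in>perms (length S). F \<pi>)"
proof (rule uniform_rel_order[OF assms(1), where key = "\<lambda>\<phi>. \<phi>"])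
  show "inj_on \<phi> (set S)" if "\<phi> \<in> orderings V" for \<phi>
    using orderings_inj[OF that] assms(2) inj_on_subset by blast
  show "\<exists>\<alpha>. bij_betw \<alpha> (orderings V) (orderings V) \<and> (\<forall>\<omega>\<in>orderings V. \<forall>v\<in>set S. \<alpha> \<omega> v = \<omega> (\<rho> v))"
    if "\<rho> permutes set S" for \<rho>
    using bij_betw_compose_orderings[OF permutes_subset[OF that assms(2)]] by fastforce
qed

lemma lex_le_iff:
  fixes x y i j m :: nat
  assumes "i < m" "j < m"
  shows "m * x + i \<le> m * y + j \<longleftrightarrow> x < y \<or> x = y \<and> i \<le> j"
proof -
  consider "x < y" | "x = y" | "y < x" by linarith
  then show ?thesis
  proof cases
    case 1
    then have "m * (x + 1) \<le> m * y" by (intro mult_le_mono2) simp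
    then show ?thesis using 1 assms by simp
  next
    case 3
    then have "m * (y + 1) \<le> m * x" by (intro mult_le_mono2) simp
    then show ?thesis using 3 assms by simp
  qed simp
qed

section \<open>Bucket labellings and essential variables\<close>

lemma sum_list_sum_swap:
  "(\<Sum>c\<leftarrow>cs. \<Sum>\<omega>\<in>A. f c \<omega>) = (\<Sum>\<omega>\<in>A. \<Sum>c\<leftarrow>cs. (f c \<omega> :: 'a :: comm_monoid_add))"
  by (induction cs) (simp_all add: sum.distrib)

lemma sum_list_filter_if:
  "(\<Sum>c\<leftarrow>filter P cs. f c) = (\<Sum>c\<leftarrow>cs. if P c then f c else (0 :: 'a :: comm_monoid_add))"
  by (induction cs) simp_all

text \<open>Lexicographic by label and then by \<open>\<pi>\<close>, packed into one number: the
  factor 4 exceeds every value of \<open>\<pi>\<close> at arity at most 3, and \<open>Suc\<close>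
  passes from list indices to the positions 1, 2, 3.\<close>

definition bucket_order :: "nat list \<Rightarrow> (nat \<Rightarrow> nat) \<Rightarrow> nat \<Rightarrow> nat" where
  "bucket_order ls \<pi> = rel_order (\<lambda>i. 4 * ls ! i + \<pi> (Suc i)) [0..<length ls]"

lemma bucket_order_eqI:
  assumes "length ls \<le> 3" "\<pi> \<in> perms (length ls)" "length S = length ls"
    and "\<And>i j. i < length ls \<Longrightarrow> j < length ls \<Longrightarrow>
      g (S ! i) \<le> g (S ! j) \<longleftrightarrow> ls ! i < ls ! j \<or> ls ! i = ls ! j \<and> \<pi> (Suc i) \<le> \<pi> (Suc j)"
  shows "bucket_order ls \<pi> = rel_order g S"
  unfolding bucket_order_def
proof (rule rel_order_eqI)
  fix i j assume "i < length [0..<length ls]" "j < length [0..<length ls]"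
  then have ij: "i < length ls" "j < length ls" by auto
  then have "\<pi> (Suc i) < 4" "\<pi> (Suc j) < 4"
    using perms_range[OF assms(2), of "Suc i"] perms_range[OF assms(2), of "Suc j"] assms(1) by auto
  then show "4 * ls ! ([0..<length ls] ! i) + \<pi> (Suc ([0..<length ls] ! i))
      \<le> 4 * ls ! ([0..<length ls] ! j) + \<pi> (Suc ([0..<length ls] ! j)) \<longleftrightarrow> g (S ! i) \<le> g (S ! j)"
    using ij assms(4) by (simp add: lex_le_iff)
qed (use assms(3) in simp)

text \<open>6 is the least common multiple of the factorials of 0, 1, 2 and 3, so the division is
  exact.\<close>

lemma six_div_fact: "a \<le> 3 \<Longrightarrow> (6 div fact a) * fact a = (6 :: nat)"
proof -
  assume "a \<le> 3"
  then have "a = 0 \<or> a = 1 \<or> a = 2 \<or> a = 3" by arith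
  then show ?thesis by (auto simp: fact_numeral)
qed

text \<open>Six times the probability that \<open>P\<close> is satisfied by ordering its arguments by their labels
  and breaking ties at random.\<close>

definition bucket_table :: "predicate \<Rightarrow> nat list \<Rightarrow> nat" where
  "bucket_table P ls = (6 div fact (fst P)) * (\<Sum>\<pi>\<in>perms (fst P). snd P (bucket_order ls \<pi>))"

text \<open>All sums over constraints that the machine evaluates have this shape:
  \<open>bucket_table\<close>, \<open>gain_table\<close> and \<open>mean_table\<close> are plugged
  in for \<open>t\<close>, so one program scheme serves all three.\<close>

definition table_sum :: "(predicate \<Rightarrow> nat list \<Rightarrow> nat) \<Rightarrow> inst \<Rightarrow> (nat \<Rightarrow> nat) \<Rightarrow> nat" where
  "table_sum t I h = (\<Sum>C\<leftarrow>constrs I. weight C * t (pred C) (map h (scope C)))"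

lemma table_sum_cong:
  assumes "\<And>C. C \<in> set (constrs I) \<Longrightarrow> t (pred C) (map h (scope C)) = t' (pred C) (map h' (scope C))"
  shows "table_sum t I h = table_sum t' I h'"
  unfolding table_sum_def using assms by (simp cong: map_cong)

text \<open>At most three labels are nonzero, which leaves polynomially many labellings to test;
  \<open>inessential_G\<close> shows that they suffice. The update of \<open>v\<close> comes last,
  so coincidences among \<open>u\<close>, \<open>v\<close> and \<open>w\<close> are harmless and
  cover the cases with fewer nonzero labels.\<close>

definition essential :: "inst \<Rightarrow> nat set" where
  "essential I = {v \<in> set (vars I). \<exists>u\<in>set (vars I). \<exists>w\<in>set (vars I). \<exists>p<4. \<exists>q<4. \<exists>r<4.
     table_sum bucket_table I ((\<lambda>_. 0)(w := r, u := q, v := p))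
       \<noteq> table_sum bucket_table I ((\<lambda>_. 0)(w := r, u := q, v := 0))}"

text \<open>Each variable owns two coordinates, the binary digits of its label, so that labellings
  become subsets and the results on set functions apply.\<close>

definition bits_label :: "(nat \<times> bool) set \<Rightarrow> nat \<Rightarrow> nat" where
  "bits_label X v = of_bool ((v, False) \<in> X) + 2 * of_bool ((v, True) \<in> X)"

definition label_bits :: "nat set \<Rightarrow> (nat \<Rightarrow> nat) \<Rightarrow> (nat \<times> bool) set" where
  "label_bits V x = {(v, b). v \<in> V \<and> (if b then 2 \<le> x v else odd (x v))}"

lemma bits_label_label_bits:
  assumes "v \<in> V" "x v < 4" shows "bits_label (label_bits V x) v = x v"
proof -
  have "x v = 0 \<or> x v = 1 \<or> x v = 2 \<or> x v = 3" using assms(2) by arith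
  then show ?thesis using assms(1) by (auto simp: bits_label_def label_bits_def)
qed

locale csp_instance =
  fixes PP :: "predicate set" and I :: inst
  assumes inst: "I \<in> instances PP" and arity: "PP \<subseteq> predicates 3"
begin

abbreviation "VV \<equiv> set (vars I)"
abbreviation "G \<equiv> table_sum bucket_table I"

lemma constrD:
  assumes "C \<in> set (constrs I)"
  shows "length (scope C) = fst (pred C)" "distinct (scope C)" "set (scope C) \<subseteq> VV" "0 < weight C"
    "fst (pred C) \<le> 3"
    "\<And>\<pi>. \<pi> \<in> perms (fst (pred C)) \<Longrightarrow> snd (pred C) \<pi> = 0 \<or> snd (pred C) \<pi> = 1"
proof -
  have wf: "wf_constr PP VV C" using inst assms by (simp add: instances_def)
  then show "length (scope C) = fst (pred C)" "distinct (scope C)" "set (scope C) \<subseteq> VV" "0 < weight C"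
    by (auto simp: wf_constr_def)
  have "pred C \<in> predicates 3" using wf arity by (auto simp: wf_constr_def)
  then show "fst (pred C) \<le> 3"
    "\<And>\<pi>. \<pi> \<in> perms (fst (pred C)) \<Longrightarrow> snd (pred C) \<pi> = 0 \<or> snd (pred C) \<pi> = 1"
    by (auto simp: predicates_def dest!: PiE_mem)
qed

lemma sat_weight_eq:
  assumes "inj_on h VV"
  shows "sat_weight I h = (\<Sum>C\<leftarrow>constrs I. weight C * snd (pred C) (rel_order h (scope C)))"
proof -
  have "(if satisfies h C then weight C else 0) = weight C * snd (pred C) (rel_order h (scope C))"
    if C: "C \<in> set (constrs I)" for C
  proof -
    have "rel_order h (scope C) \<in> perms (fst (pred C))"
      using rel_order_perms[of "scope C" h] constrD[OF C] inj_on_subset[OF assms] by simp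
    from constrD(6)[OF C this] show ?thesis by (auto simp: satisfies_def)
  qed
  then show ?thesis
    unfolding sat_weight_def sum_list_filter_if by (simp cong: map_cong)
qed

lemma sat_weight_cong:
  assumes "\<And>u v. u \<in> VV \<Longrightarrow> v \<in> VV \<Longrightarrow> h u \<le> h v \<longleftrightarrow> h' u \<le> h' v"
  shows "sat_weight I h = sat_weight I h'"
proof -
  have "rel_order h (scope C) = rel_order h' (scope C)" if "C \<in> set (constrs I)" for C
    using assms constrD(3)[OF that] by (intro rel_order_cong) auto
  then have "filter (satisfies h) (constrs I) = filter (satisfies h') (constrs I)"
    by (intro filter_cong) (auto simp: satisfies_def)
  then show ?thesis by (simp add: sat_weight_def)
qed

text \<open>The product of \<open>\<rho>\<close> and \<open>W\<close> in the problem, free of the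
  division by the total weight.\<close>

definition mean_weight :: real where
  "mean_weight = (\<Sum>\<phi>\<in>orderings VV. real (sat_weight I \<phi>)) / card (orderings VV)"

lemma avg_fraction_eq: "avg_fraction I * real (total_weight I) = mean_weight"
proof (cases "total_weight I = 0")
  case True
  have "constrs I = []"
  proof (rule ccontr)
    assume "constrs I \<noteq> []"
    then obtain C where C: "C \<in> set (constrs I)" by (cases "constrs I") auto
    then have "weight C \<le> total_weight I"
      unfolding total_weight_def by (intro member_le_sum_list) auto
    then show False using True constrD(4)[OF C] by simp
  qed
  then show ?thesis using True by (simp add: mean_weight_def sat_weight_def)
next
  case False
  have "avg_fraction I = (\<Sum>\<phi>\<in>orderings VV. real (sat_weight I \<phi>) / real (total_weight I)) / card (orderings VV)"
    unfolding avg_fraction_def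
    by (rule integral_pmf_of_set) (simp_all add: orderings_nonempty finite_orderings)
  then show ?thesis using False by (simp add: mean_weight_def flip: sum_divide_distrib)
qed

text \<open>The bucket order with ties broken by \<open>\<phi>\<close>, packed into one number: the
  factor exceeds every value of \<open>\<phi>\<close>.\<close>

definition key :: "(nat \<Rightarrow> nat) \<Rightarrow> (nat \<Rightarrow> nat) \<Rightarrow> nat \<Rightarrow> nat" where
  "key x \<phi> v = (card VV + 1) * x v + \<phi> v"

lemma key_le_iff:
  assumes "\<phi> \<in> orderings VV" "u \<in> VV" "v \<in> VV"
  shows "key x \<phi> u \<le> key x \<phi> v \<longleftrightarrow> x u < x v \<or> x u = x v \<and> \<phi> u \<le> \<phi> v"
  unfolding key_def using orderings_range[OF assms(1)] assms(2,3)
  by (intro lex_le_iff) (auto simp: le_imp_less_Suc)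

lemma key_inj:
  assumes "\<phi> \<in> orderings VV" shows "inj_on (key x \<phi>) VV"
proof (rule inj_onI)
  fix u v assume uv: "u \<in> VV" "v \<in> VV" "key x \<phi> u = key x \<phi> v"
  then have "\<phi> u = \<phi> v"
    using key_le_iff[OF assms uv(1,2), of x] key_le_iff[OF assms uv(2,1), of x] by auto
  then show "u = v" using orderings_inj[OF assms] uv by (simp add: inj_on_eq_iff)
qed

text \<open>A uniform ordering of all variables breaks ties within one scope by a uniform
  permutation, so the local table agrees with the global experiment.\<close>

lemma bucket_table_orderings:
  assumes C: "C \<in> set (constrs I)"
  shows "card (orderings VV) * bucket_table (pred C) (map x (scope C))
       = 6 * (\<Sum>\<phi>\<in>orderings VV. snd (pred C) (rel_order (key x \<phi>) (scope C)))"
proof -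
  let ?S = "scope C" and ?P = "pred C"
  define F where "F \<pi> = snd ?P (bucket_order (map x ?S) \<pi>)" for \<pi>
  note S = constrD[OF C]
  have "F (rel_order \<phi> ?S) = snd ?P (rel_order (key x \<phi>) ?S)" if \<phi>: "\<phi> \<in> orderings VV" for \<phi>
  proof -
    have "rel_order \<phi> ?S \<in> perms (length ?S)"
      by (rule rel_order_perms[OF S(2) inj_on_subset[OF orderings_inj[OF \<phi>] S(3)]])
    then have "bucket_order (map x ?S) (rel_order \<phi> ?S) = rel_order (key x \<phi>) ?S"
    proof (intro bucket_order_eqI)
      fix i j assume "i < length (map x ?S)" "j < length (map x ?S)"
      then have ij: "i < length ?S" "j < length ?S" by auto
      then have "?S ! i \<in> VV" "?S ! j \<in> VV" using S(3) by auto
      then show "key x \<phi> (?S ! i) \<le> key x \<phi> (?S ! j) \<longleftrightarrow> map x ?S ! i < map x ?S ! j \<or>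
          map x ?S ! i = map x ?S ! j \<and> rel_order \<phi> ?S (Suc i) \<le> rel_order \<phi> ?S (Suc j)"
        using ij rel_order_le_iff[of "Suc i" ?S "Suc j" \<phi>] by (simp add: key_le_iff[OF \<phi>])
    qed (use S in simp_all)
    then show ?thesis by (simp add: F_def)
  qed
  then have "fact (fst ?P) * (\<Sum>\<phi>\<in>orderings VV. snd ?P (rel_order (key x \<phi>) ?S))
      = card (orderings VV) * (\<Sum>\<pi>\<in>perms (fst ?P). F \<pi>)"
    using sum_orderings_rel_order[OF S(2,3), of F] S(1) by simp
  moreover have "(6 div fact (fst ?P)) * fact (fst ?P) = (6 :: nat)"
    by (rule six_div_fact[OF S(5)])
  moreover have "bucket_table ?P (map x ?S) = (6 div fact (fst ?P)) * (\<Sum>\<pi>\<in>perms (fst ?P). F \<pi>)"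
    by (simp add: bucket_table_def F_def)
  moreover have "N * (d * x) = (6 :: nat) * y" if "f * y = N * x" "d * f = 6" for N d x y f :: nat
  proof -
    have "N * (d * x) = d * (N * x)" by simp
    also have "\<dots> = d * f * y" using that(1) by simp
    finally show ?thesis using that(2) by simp
  qed
  ultimately show ?thesis by simp
qed

lemma G_orderings:
  "card (orderings VV) * G x = 6 * (\<Sum>\<phi>\<in>orderings VV. sat_weight I (key x \<phi>))"
proof -
  have "card (orderings VV) * G x
      = (\<Sum>C\<leftarrow>constrs I. weight C * (card (orderings VV) * bucket_table (pred C) (map x (scope C))))"
    by (simp add: table_sum_def mult.left_commute flip: sum_list_const_mult)
  also have "\<dots> = (\<Sum>C\<leftarrow>constrs I. weight C * (6 * (\<Sum>\<phi>\<in>orderings VV. snd (pred C) (rel_order (key x \<phi>) (scope C)))))"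
    using bucket_table_orderings[of _ x] by (simp cong: map_cong)
  also have "\<dots> = 6 * (\<Sum>C\<leftarrow>constrs I. \<Sum>\<phi>\<in>orderings VV. weight C * snd (pred C) (rel_order (key x \<phi>) (scope C)))"
    by (simp add: mult.left_commute sum_distrib_left flip: sum_list_const_mult)
  also have "\<dots> = 6 * (\<Sum>\<phi>\<in>orderings VV. sat_weight I (key x \<phi>))"
    by (simp add: sum_list_sum_swap sat_weight_eq[OF key_inj])
  finally show ?thesis .
qed

text \<open>Permutations of the scope act on label bits and orderings simultaneously, so the
  relative order under \<open>key\<close> is uniform, just as for a plain ordering. Bucketing
  therefore does not change the mean.\<close>

lemma sum_bits_orderings:
  assumes C: "C \<in> set (constrs I)"
  shows "(\<Sum>X\<in>Pow (VV \<times> UNIV). \<Sum>\<phi>\<in>orderings VV. snd (pred C) (rel_order (key (bits_label X) \<phi>) (scope C)))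
       = 2 ^ card (VV \<times> (UNIV :: bool set)) * (\<Sum>\<phi>\<in>orderings VV. snd (pred C) (rel_order \<phi> (scope C)))"
proof -
  let ?S = "scope C" and ?P = "pred C"
  let ?W = "VV \<times> (UNIV :: bool set)"
  note S = constrD[OF C]
  have "fact (length ?S) * (\<Sum>\<omega>\<in>Pow ?W \<times> orderings VV. snd ?P (rel_order ((\<lambda>(X, \<phi>). key (bits_label X) \<phi>) \<omega>) ?S))
      = card (Pow ?W \<times> orderings VV) * (\<Sum>\<pi>\<in>perms (length ?S). snd ?P \<pi>)"
  proof (rule uniform_rel_order[OF S(2)])
    show "inj_on ((\<lambda>(X, \<phi>). key (bits_label X) \<phi>) \<omega>) (set ?S)" if "\<omega> \<in> Pow ?W \<times> orderings VV" for \<omega>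
      using that inj_on_subset[OF key_inj S(3)] by auto
    fix \<rho> assume "\<rho> permutes set ?S"
    then have \<rho>: "\<rho> permutes VV" by (rule permutes_subset) (rule S(3))
    \<comment> \<open>\<open>\<beta> \<rho> X\<close> gives \<open>v\<close> the label that
      \<open>X\<close> gives \<open>\<rho> v\<close>, matching the precomposition of
      \<open>\<phi>\<close> by \<open>\<rho>\<close>.\<close>
    define \<beta> where "\<beta> \<rho> X = {(v, b). (\<rho> v, b) \<in> X}" for \<rho> :: "nat \<Rightarrow> nat" and X :: "(nat \<times> bool) set"
    have "\<beta> \<rho> X \<in> Pow ?W" if "X \<in> Pow ?W" "\<rho> permutes VV" for X \<rho>
      using that permutes_in_image[OF that(2)] by (auto simp: \<beta>_def)
    then have "bij_betw (\<beta> \<rho>) (Pow ?W) (Pow ?W)"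
      by (intro bij_betw_byWitness[of _ "\<beta> (inv \<rho>)"])
         (use \<rho> permutes_inv[OF \<rho>] permutes_inverses[OF \<rho>] in \<open>auto simp: \<beta>_def\<close>)
    then have "bij_betw (map_prod (\<beta> \<rho>) (\<lambda>\<phi>. \<phi> \<circ> \<rho>)) (Pow ?W \<times> orderings VV) (Pow ?W \<times> orderings VV)"
      by (rule bij_betw_map_prod) (rule bij_betw_compose_orderings[OF \<rho>])
    moreover have "(\<lambda>(X, \<phi>). key (bits_label X) \<phi>) (map_prod (\<beta> \<rho>) (\<lambda>\<phi>. \<phi> \<circ> \<rho>) \<omega>) v
        = (\<lambda>(X, \<phi>). key (bits_label X) \<phi>) \<omega> (\<rho> v)" for \<omega> v
      by (cases \<omega>) (simp add: key_def bits_label_def \<beta>_def)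
    ultimately show "\<exists>\<alpha>. bij_betw \<alpha> (Pow ?W \<times> orderings VV) (Pow ?W \<times> orderings VV) \<and>
       (\<forall>\<omega>\<in>Pow ?W \<times> orderings VV. \<forall>v\<in>set ?S. (\<lambda>(X, \<phi>). key (bits_label X) \<phi>) (\<alpha> \<omega>) v
          = (\<lambda>(X, \<phi>). key (bits_label X) \<phi>) \<omega> (\<rho> v))" by blast
  qed
  moreover have "card (Pow ?W \<times> orderings VV) * (\<Sum>\<pi>\<in>perms (length ?S). snd ?P \<pi>)
      = 2 ^ card ?W * (fact (length ?S) * (\<Sum>\<phi>\<in>orderings VV. snd ?P (rel_order \<phi> ?S)))"
    unfolding sum_orderings_rel_order[OF S(2,3)] by (simp add: card_cartesian_product card_Pow)
  ultimately have "fact (length ?S) * (\<Sum>X\<in>Pow ?W. \<Sum>\<phi>\<in>orderings VV. snd ?P (rel_order (key (bits_label X) \<phi>) ?S))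
     = fact (length ?S) * (2 ^ card ?W * (\<Sum>\<phi>\<in>orderings VV. snd ?P (rel_order \<phi> ?S)))"
    by (simp add: sum.cartesian_product case_prod_beta mult.left_commute del: card_cartesian_product)
  then show ?thesis by simp
qed

lemma avg_G: "avg (VV \<times> UNIV) (\<lambda>X. real (G (bits_label X))) = 6 * mean_weight"
proof -
  let ?W = "VV \<times> (UNIV :: bool set)"
  let ?N = "card (orderings VV)"
  have N: "?N > 0" by (simp add: card_gt_0_iff orderings_nonempty finite_orderings)
  have "?N * (\<Sum>X\<in>Pow ?W. G (bits_label X))
      = 6 * (\<Sum>X\<in>Pow ?W. \<Sum>\<phi>\<in>orderings VV. sat_weight I (key (bits_label X) \<phi>))"
    unfolding sum_distrib_left[of ?N] G_orderings sum_distrib_left[of 6] ..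
  also have "(\<Sum>X\<in>Pow ?W. \<Sum>\<phi>\<in>orderings VV. sat_weight I (key (bits_label X) \<phi>))
      = (\<Sum>C\<leftarrow>constrs I. weight C * (\<Sum>X\<in>Pow ?W. \<Sum>\<phi>\<in>orderings VV.
           snd (pred C) (rel_order (key (bits_label X) \<phi>) (scope C))))"
    by (simp add: sat_weight_eq[OF key_inj] sum_distrib_left sum_list_sum_swap)
  also have "\<dots> = (\<Sum>C\<leftarrow>constrs I. weight C * (2 ^ card ?W * (\<Sum>\<phi>\<in>orderings VV. snd (pred C) (rel_order \<phi> (scope C)))))"
    using sum_bits_orderings by (simp cong: map_cong del: card_cartesian_product)
  also have "\<dots> = 2 ^ card ?W * (\<Sum>\<phi>\<in>orderings VV. sat_weight I \<phi>)"
    by (simp add: sat_weight_eq[OF orderings_inj] mult.left_commute sum_distrib_left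
        sum_list_sum_swap[symmetric] flip: sum_list_const_mult del: card_cartesian_product)
  finally have "real (?N * (\<Sum>X\<in>Pow ?W. G (bits_label X)))
     = real (6 * (2 ^ card ?W * (\<Sum>\<phi>\<in>orderings VV. sat_weight I \<phi>)))" by simp
  then show ?thesis using N
    by (simp add: avg_def mean_weight_def field_simps del: card_cartesian_product)
qed

text \<open>\<open>G x\<close> is six times the mean satisfied weight over all tie-breaks, so some
  tie-break does at least as well; its key is then replaced by ranks to get a genuine
  ordering.\<close>

lemma exists_ordering_ge_G:
  obtains \<phi> where "\<phi> \<in> orderings VV" "G x \<le> 6 * sat_weight I \<phi>"
proof -
  let ?N = "card (orderings VV)"
  have fin: "finite (orderings VV)" "orderings VV \<noteq> {}"
    by (simp_all add: orderings_nonempty finite_orderings)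
  then obtain \<phi> where \<phi>: "\<phi> \<in> orderings VV"
    "(\<Sum>\<phi>\<in>orderings VV. real (sat_weight I (key x \<phi>))) / ?N \<le> real (sat_weight I (key x \<phi>))"
    using exists_ge_avg by blast
  have "real (?N * G x) = real (6 * (\<Sum>\<phi>\<in>orderings VV. sat_weight I (key x \<phi>)))"
    unfolding G_orderings ..
  moreover have N: "real ?N > 0" using fin by (simp add: card_gt_0_iff)
  then have "(\<Sum>\<phi>\<in>orderings VV. real (sat_weight I (key x \<phi>))) \<le> ?N * real (sat_weight I (key x \<phi>))"
    using \<phi>(2) by (simp add: field_simps)
  ultimately have "?N * real (G x) \<le> ?N * real (6 * sat_weight I (key x \<phi>))" by simp
  then have "real (G x) \<le> real (6 * sat_weight I (key x \<phi>))" using N by simp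
  moreover obtain \<psi> where \<psi>: "\<psi> \<in> orderings VV"
    "\<And>u v. u \<in> VV \<Longrightarrow> v \<in> VV \<Longrightarrow> \<psi> u \<le> \<psi> v \<longleftrightarrow> key x \<phi> u \<le> key x \<phi> v"
    using ordering_of_inj[OF _ key_inj[OF \<phi>(1)]] by blast
  moreover have "sat_weight I \<psi> = sat_weight I (key x \<phi>)" by (rule sat_weight_cong) (rule \<psi>(2))
  ultimately show ?thesis using that[of \<psi>] by simp
qed

text \<open>A constraint sees at most three variables with two bits each, so
  \<open>mdiff_local\<close> kills its differences of order above 6.\<close>

lemma deg_le_G: "deg_le 6 (VV \<times> UNIV) (\<lambda>X. real (G (bits_label X)))"
  unfolding deg_le_def
proof (intro allI impI)
  fix T X assume T: "T \<subseteq> VV \<times> (UNIV :: bool set)" "6 < card T"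
  then have finT: "finite T" by (meson List.finite_set finite_SigmaI finite finite_subset)
  have "mdiff T (\<lambda>X. real (weight C * bucket_table (pred C) (map (bits_label X) (scope C)))) X = 0"
    if C: "C \<in> set (constrs I)" for C
  proof (rule mdiff_local[OF finT, of "set (scope C) \<times> UNIV"])
    have "card (set (scope C) \<times> (UNIV :: bool set)) \<le> 6"
      using constrD(1,5)[OF C] card_length[of "scope C"] by (simp add: card_cartesian_product)
    then show "\<not> T \<subseteq> set (scope C) \<times> UNIV"
      using T(2) card_mono[of "set (scope C) \<times> (UNIV :: bool set)" T] by auto
    have "map (bits_label X) (scope C) = map (bits_label (X \<inter> set (scope C) \<times> UNIV)) (scope C)" for X
      by (simp add: bits_label_def)
    then show "real (weight C * bucket_table (pred C) (map (bits_label X) (scope C)))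
       = real (weight C * bucket_table (pred C) (map (bits_label (X \<inter> set (scope C) \<times> UNIV)) (scope C)))" for X
      by metis
  qed
  then have "mdiff T (\<lambda>X. \<Sum>C\<leftarrow>constrs I. real (weight C * bucket_table (pred C) (map (bits_label X) (scope C)))) X = 0"
    unfolding mdiff_sum_list by (simp cong: map_cong)
  moreover have "real (G (bits_label X)) = (\<Sum>C\<leftarrow>constrs I. real (weight C * bucket_table (pred C) (map (bits_label X) (scope C))))" for X
    unfolding table_sum_def by (simp add: comp_def flip: sum_list_of_nat)
  ultimately show "mdiff T (\<lambda>X. real (G (bits_label X))) X = 0" by simp
qed

lemma G_cong: "(\<And>v. v \<in> VV \<Longrightarrow> x v = y v) \<Longrightarrow> G x = G y"
  using constrD(3) by (intro table_sum_cong arg_cong2[of _ _ _ _ bucket_table]) (auto simp: subset_iff)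

text \<open>Resetting the label of \<open>v\<close> clears its two bits one after the other, so if
  \<open>G\<close> changes, one of them is relevant. Distinct variables own distinct bits, hence
  there are at least as many relevant coordinates as essential variables.\<close>

lemma essential_relevant:
  "essential I \<subseteq> fst ` relevant (VV \<times> UNIV) (\<lambda>X. real (G (bits_label X)))"
proof
  fix v assume v: "v \<in> essential I"
  then obtain u w p q r where pqr: "p < 4" "q < 4" "r < 4" "v \<in> VV"
    "G ((\<lambda>_. 0)(w := r, u := q, v := p)) \<noteq> G ((\<lambda>_. 0)(w := r, u := q, v := 0))"
    by (auto simp: essential_def)
  let ?W = "VV \<times> (UNIV :: bool set)"
  let ?F = "\<lambda>X. real (G (bits_label X))"
  define x where "x = (\<lambda>_. 0)(w := r, u := q, v := p)"
  define X where "X = label_bits VV x"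
  have XW: "X \<subseteq> ?W" by (auto simp: X_def label_bits_def)
  have 1: "bits_label X a = x a" if "a \<in> VV" for a
    unfolding X_def by (rule bits_label_label_bits[OF that]) (use pqr in \<open>simp add: x_def\<close>)
  have 2: "bits_label (X - {(v, False)} - {(v, True)}) a = (x(v := 0)) a" if "a \<in> VV" for a
    using 1[OF that] by (auto simp: bits_label_def)
  have "x(v := 0) = (\<lambda>_. 0)(w := r, u := q, v := 0)" by (simp add: x_def)
  then have ne: "?F X \<noteq> ?F (X - {(v, False)} - {(v, True)})"
    using pqr(5) G_cong[of "bits_label X" x, OF 1]
      G_cong[of "bits_label (X - {(v, False)} - {(v, True)})" "x(v := 0)", OF 2]
    by (simp add: x_def del: fun_upd_apply)
  show "v \<in> fst ` relevant ?W ?F"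
  proof (rule ccontr)
    assume "v \<notin> fst ` relevant ?W ?F"
    then have "(v, b) \<notin> relevant ?W ?F" for b by force
    then have *: "?F (insert (v, b) Y) = ?F (Y - {(v, b)})" if "Y \<subseteq> ?W" for b Y
      using pqr(4) that by (auto simp: relevant_def)
    have **: "?F Y = ?F (Y - {(v, b)})" if "Y \<subseteq> ?W" for b Y
      using *[OF that, of b] by (cases "(v, b) \<in> Y") (auto simp: insert_absorb)
    have "?F X = ?F (X - {(v, False)} - {(v, True)})"
      using **[OF XW, of False] **[of "X - {(v, False)}" True] XW by auto
    then show False using ne by simp
  qed
qed

end

text \<open>With \<open>K\<close> at least 6 / \<open>\<epsilon>\<close>, the gain over the mean of
  \<open>G\<close> is at least six times the parameter, that is, the parameter itself in units of
  satisfied weight. The threshold asks only for k / (c! 4^c), which is at most k.\<close>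

lemma essential_bound:
  "\<exists>K::nat. \<forall>PP I. PP \<subseteq> predicates 3 \<longrightarrow> I \<in> instances PP \<longrightarrow>
     K * param I \<le> card (essential I) \<longrightarrow> above_average c I"
proof -
  obtain \<epsilon> :: real where eps: "\<epsilon> > 0"
    "\<And>(W :: (nat \<times> bool) set) F. finite W \<Longrightarrow> deg_le 6 W F \<Longrightarrow> (\<forall>X\<subseteq>W. F X \<in> \<int>) \<Longrightarrow>
     \<exists>X\<subseteq>W. avg W F + \<epsilon> * card (relevant W F) \<le> F X"
    using max_ge_avg_plus_relevant[of 6] by blast
  define K where "K = nat \<lceil>6 / \<epsilon>\<rceil>"
  have K: "6 \<le> \<epsilon> * K"
  proof -
    have "6 / \<epsilon> \<le> real K" unfolding K_def by linarith
    then show ?thesis using eps(1) by (simp add: field_simps)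
  qed
  have "above_average c I" if PP: "PP \<subseteq> predicates 3" and I: "I \<in> instances PP"
    and big: "K * param I \<le> card (essential I)" for PP I
  proof -
    interpret csp_instance PP I using PP I by unfold_locales
    let ?W = "VV \<times> (UNIV :: bool set)"
    let ?F = "\<lambda>X. real (G (bits_label X))"
    obtain X where X: "avg ?W ?F + \<epsilon> * card (relevant ?W ?F) \<le> ?F X"
      using eps(2)[OF _ deg_le_G] by auto
    have "finite (relevant ?W ?F)" by (simp add: relevant_def)
    then have "card (essential I) \<le> card (relevant ?W ?F)"
      using essential_relevant by (rule surj_card_le)
    then have "K * param I \<le> card (relevant ?W ?F)" using big by simp
    then have "real (K * param I) \<le> real (card (relevant ?W ?F))" by (rule of_nat_mono)
    then have "\<epsilon> * real (K * param I) \<le> \<epsilon> * card (relevant ?W ?F)"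
      using eps(1) by (intro mult_left_mono) auto
    moreover have "6 * real (param I) \<le> (\<epsilon> * K) * param I"
      using K by (intro mult_right_mono) auto
    ultimately have "6 * mean_weight + 6 * param I \<le> ?F X"
      using X by (simp add: avg_G)
    moreover obtain \<phi> where \<phi>: "\<phi> \<in> orderings VV" "G (bits_label X) \<le> 6 * sat_weight I \<phi>"
      by (rule exists_ordering_ge_G)
    moreover have "real (G (bits_label X)) \<le> real (6 * sat_weight I \<phi>)"
      using \<phi>(2) by (rule of_nat_mono)
    ultimately have "mean_weight + param I \<le> sat_weight I \<phi>" by simp
    moreover have "real (param I) / (fact c * 4 ^ c) \<le> param I"
    proof -
      have "(1 :: real) \<le> fact c * 4 ^ c"
        using mult_mono[of 1 "fact c :: real" 1 "4 ^ c"] by simp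
      then show ?thesis by (simp add: divide_le_eq mult_le_cancel_left1)
    qed
    ultimately show ?thesis using \<phi>(1) unfolding above_average_def avg_fraction_eq by force
  qed
  then show ?thesis by blast
qed

section \<open>Moving inessential variables\<close>

lemma bucket_table_cong:
  assumes "length ls = fst P" "length ls' = fst P" "fst P \<le> 3"
    and "\<And>i j. i < fst P \<Longrightarrow> j < fst P \<Longrightarrow> ls ! i \<le> ls ! j \<longleftrightarrow> ls' ! i \<le> ls' ! j"
  shows "bucket_table P ls = bucket_table P ls'"
proof -
  have "bucket_order ls \<pi> = bucket_order ls' \<pi>" if "\<pi> \<in> perms (fst P)" for \<pi>
    unfolding bucket_order_def[of ls']
  proof (rule bucket_order_eqI)
    fix i j assume "i < length ls" "j < length ls"
    then have ij: "i < fst P" "j < fst P" using assms by auto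
    then have "\<pi> (Suc i) < 4" "\<pi> (Suc j) < 4"
      using perms_range[OF that, of "Suc i"] perms_range[OF that, of "Suc j"] assms(3) by auto
    then show "4 * ls' ! ([0..<length ls'] ! i) + \<pi> (Suc ([0..<length ls'] ! i))
        \<le> 4 * ls' ! ([0..<length ls'] ! j) + \<pi> (Suc ([0..<length ls'] ! j))
      \<longleftrightarrow> ls ! i < ls ! j \<or> ls ! i = ls ! j \<and> \<pi> (Suc i) \<le> \<pi> (Suc j)"
      using ij assms(2) assms(4)[of i j] assms(4)[of j i] by (auto simp: lex_le_iff)
  qed (use assms that in auto)
  then show ?thesis by (simp add: bucket_table_def)
qed

text \<open>Without ties every tie-break produces the same order, so the average collapses to a
  single value.\<close>

lemma bucket_table_distinct:
  assumes "length ls = fst P" "fst P \<le> 3" "distinct ls"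
  shows "bucket_table P ls = 6 * snd P (rel_order id ls)"
proof -
  have "bucket_order ls \<pi> = rel_order id ls" if "\<pi> \<in> perms (fst P)" for \<pi>
    by (rule bucket_order_eqI) (use assms that in \<open>auto simp: nth_eq_iff_index_eq\<close>)
  then have "bucket_table P ls = (6 div fact (fst P)) * (fact (fst P) * snd P (rel_order id ls))"
    by (simp add: bucket_table_def card_perms)
  then show ?thesis using six_div_fact[OF assms(2)] by (simp flip: mult.assoc)
qed

section \<open>Orderings as lists without repetitions\<close>

primrec pos :: "nat list \<Rightarrow> nat \<Rightarrow> nat" where
  "pos [] v = 0"
| "pos (y # ys) v = (if v = y then 0 else Suc (pos ys v))"

lemma pos_append: "pos (xs @ ys) v = (if v \<in> set xs then pos xs v else length xs + pos ys v)"
  by (induction xs) auto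

lemma pos_less: "v \<in> set ys \<Longrightarrow> pos ys v < length ys"
  by (induction ys) auto

lemma nth_pos: "v \<in> set ys \<Longrightarrow> ys ! pos ys v = v"
  by (induction ys) auto

lemma pos_inj: "inj_on (pos ys) (set ys)"
  by (metis inj_onI nth_pos)

lemma pos_sorted:
  assumes "finite V" "inj_on (h :: nat \<Rightarrow> nat) V"
  obtains ys where "distinct ys" "set ys = V"
    "\<And>u v. u \<in> V \<Longrightarrow> v \<in> V \<Longrightarrow> pos ys u \<le> pos ys v \<longleftrightarrow> h u \<le> h v"
proof -
  define ys where "ys = sort_key h (sorted_list_of_set V)"
  have ys: "distinct ys" "set ys = V" "sorted (map h ys)" using assms by (auto simp: ys_def)
  have less: "h (ys ! i) < h (ys ! j)" if "i < j" "j < length ys" for i j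
  proof -
    have "h (ys ! i) \<le> h (ys ! j)" using ys(3) that by (simp add: sorted_iff_nth_mono)
    moreover have "ys ! i \<noteq> ys ! j" using ys(1) that by (simp add: nth_eq_iff_index_eq)
    then have "h (ys ! i) \<noteq> h (ys ! j)"
      using assms(2) ys(2) that nth_mem[of i ys] nth_mem[of j ys] by (simp add: inj_on_eq_iff)
    ultimately show ?thesis by simp
  qed
  have "pos ys u \<le> pos ys v \<longleftrightarrow> h u \<le> h v" if "u \<in> V" "v \<in> V" for u v
    using less[of "pos ys u" "pos ys v"] less[of "pos ys v" "pos ys u"] that
      pos_less[of u ys] pos_less[of v ys] nth_pos[of u ys] nth_pos[of v ys] ys(2)
    by (metis leD linorder_le_less_linear nle_le order_less_imp_le)
  then show ?thesis using that ys by blast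
qed

text \<open>An ordering built from the back: label 0 marks the elements that still have to be placed, label
  1 the one being placed and label 2 those placed already. A constraint is charged when the second
  of its elements in the final order is placed, since then its relative order is known. The
  factor \<open>384 = 3! 4\<^sup>3\<close> clears the denominators of the threshold.\<close>

definition gain_table :: "predicate \<Rightarrow> nat list \<Rightarrow> nat" where
  "gain_table P ls = (if distinct ls \<and> 0 \<in> set ls \<and> 1 \<in> set ls then 384 * snd P (rel_order id ls) else 0)"

definition place_label :: "nat set \<Rightarrow> nat \<Rightarrow> nat \<Rightarrow> nat" where
  "place_label Z y v = (if v = y then 1 else if v \<in> Z then 2 else 0)"

text \<open>Each charge may depend on the set of later elements but not on their order, which is
  what makes a dynamic program over subsets possible.\<close>

primrec suffix_sum :: "(nat set \<Rightarrow> nat \<Rightarrow> nat) \<Rightarrow> nat list \<Rightarrow> nat" where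
  "suffix_sum f [] = 0"
| "suffix_sum f (y # ys) = f (set ys) y + suffix_sum f ys"

text \<open>For the induction, \<open>ys\<close> is a suffix of the final order: scope elements
  outside \<open>ys\<close> stand in front of it, and rank 0 for them is faithful as long as at most
  one is left. While two or more are left, nothing has been charged.\<close>

lemma suffix_sum_constraint:
  assumes "distinct ys" "distinct S" "2 \<le> length S" "length S \<le> 3"
  shows "suffix_sum (\<lambda>Z y. gain_table P (map (place_label Z y) S)) ys
     = (if card (set S - set ys) \<le> 1
        then 384 * snd P (rel_order (\<lambda>v. if v \<in> set ys then Suc (pos ys v) else 0) S) else 0)"
  using assms(1)
proof (induction ys)
  case Nil
  then show ?case using assms distinct_card[of S] by simp
next
  case (Cons y ys)
  let ?B = "set S - set (y # ys)"
  let ?ls = "map (place_label (set ys) y) S"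
  let ?h = "\<lambda>ys v. if v \<in> set ys then Suc (pos ys v) else 0"
  have y: "y \<notin> set ys" "distinct ys" using Cons.prems by auto
  show ?case
  proof (cases "y \<in> set S")
    case False
    then have "1 \<notin> set ?ls" by (auto simp: place_label_def)
    then have 0: "gain_table P ?ls = 0" by (simp add: gain_table_def)
    have "?B = set S - set ys" using False by auto
    moreover have "rel_order (?h ys) S = rel_order (?h (y # ys)) S"
      using False by (intro rel_order_cong) auto
    ultimately show ?thesis using Cons.IH[OF y(2)] 0 by simp
  next
    case True
    have B: "set S - set ys = insert y ?B" "y \<notin> ?B" using True y by auto
    have cB: "card (set S - set ys) = Suc (card ?B)"
      unfolding B(1) by (rule card_insert_disjoint) (use B(2) in auto)
    \<comment> \<open>\<open>?B\<close> holds the scope elements still unplaced after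
      \<open>y\<close>. If none is left, label 0 is absent; if two or more are left, they share
      label 0. With exactly one left the labels are distinct, since a third element bears label 2,
      and they reproduce the final order.\<close>
    consider "card ?B = 0" | "card ?B = 1" | "2 \<le> card ?B" by linarith
    then show ?thesis
    proof cases
      case 1
      then have "?B = {}" by simp
      then have "set S \<subseteq> set (y # ys)" by blast
      then have "0 \<notin> set ?ls" by (auto simp: place_label_def)
      then have 0: "gain_table P ?ls = 0" by (simp add: gain_table_def)
      have "rel_order (?h ys) S = rel_order (?h (y # ys)) S"
        using \<open>set S \<subseteq> set (y # ys)\<close> y by (intro rel_order_cong) auto
      moreover have "card ?B \<le> 1" "card (set S - set ys) \<le> 1" using 1 cB by linarith+
      ultimately show ?thesis by (simp only: suffix_sum.simps Cons.IH[OF y(2)] 0 if_True add_0)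
    next
      case 2
      then obtain b where b: "?B = {b}" by (auto simp: card_1_singleton_iff)
      have "card (set S) \<le> 3" using assms card_length[of S] by linarith
      have "card (set S - {b, y}) \<le> 1"
      proof -
        have "b \<in> set S" "b \<noteq> y" using b by auto
        then have "card (set S - {b, y}) = card (set S) - 2"
          using True by (subst card_Diff_subset) auto
        then show ?thesis using \<open>card (set S) \<le> 3\<close> by simp
      qed
      then have le1: "u = v" if "u \<in> set S - {b, y}" "v \<in> set S - {b, y}" for u v
        using that by (metis card_le_Suc0_iff_eq One_nat_def List.finite_set finite_Diff)
      have oth: "v \<in> set ys" if "v \<in> set S - {b, y}" for v using b that by auto
      have bn: "b \<notin> set ys" "b \<noteq> y" "b \<in> set S" using b by auto
      have inj: "inj_on (place_label (set ys) y) (set S)"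
      proof (rule inj_onI)
        fix u v assume uv: "u \<in> set S" "v \<in> set S" "place_label (set ys) y u = place_label (set ys) y v"
        show "u = v"
          using uv le1[of u v] oth[of u] oth[of v] bn unfolding place_label_def
          by (cases "u = y"; cases "v = y"; cases "u = b"; cases "v = b") (auto split: if_splits)
      qed
      then have "distinct ?ls" using assms(2) by (simp add: distinct_map)
      moreover have "1 \<in> set ?ls" using True by (force simp: place_label_def)
      moreover have "0 \<in> set ?ls" using bn by (force simp: place_label_def)
      moreover have "rel_order id ?ls = rel_order (?h (y # ys)) S"
        unfolding rel_order_map
      proof (rule rel_order_cong)
        fix u v assume uv: "u \<in> set S" "v \<in> set S"
        show "id (place_label (set ys) y u) \<le> id (place_label (set ys) y v) \<longleftrightarrow> ?h (y # ys) u \<le> ?h (y # ys) v"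
          using uv le1[of u v] oth[of u] oth[of v] bn y unfolding place_label_def
          by (cases "u = y"; cases "v = y"; cases "u = b"; cases "v = b") auto
      qed
      ultimately have "gain_table P ?ls = 384 * snd P (rel_order (?h (y # ys)) S)"
        by (simp add: gain_table_def)
      moreover have "card ?B \<le> 1" "\<not> card (set S - set ys) \<le> 1" using 2 cB by linarith+
      ultimately show ?thesis by (simp only: suffix_sum.simps Cons.IH[OF y(2)] if_True if_False add_0_right)
    next
      case 3
      have "\<not> distinct ?ls"
      proof
        assume "distinct ?ls"
        then have inj: "inj_on (place_label (set ys) y) (set S)" by (simp add: distinct_map)
        have "u = v" if "u \<in> ?B" "v \<in> ?B" for u v
          by (rule inj_onD[OF inj]) (use that in \<open>auto simp: place_label_def\<close>)
        then have "card ?B \<le> 1" by (simp add: card_le_Suc0_iff_eq)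
        then show False using 3 by simp
      qed
      then have "gain_table P ?ls = 0" by (simp add: gain_table_def)
      moreover have "\<not> card ?B \<le> 1" "\<not> card (set S - set ys) \<le> 1" using 3 cB by linarith+
      ultimately show ?thesis by (simp only: suffix_sum.simps Cons.IH[OF y(2)] if_False add_0_right)
    qed
  qed
qed

definition gain :: "inst \<Rightarrow> nat set \<Rightarrow> nat \<Rightarrow> nat" where
  "gain I Z y = table_sum gain_table I (place_label Z y)"

text \<open>Constraints of arity at most 1 contribute the same to every ordering and are left out.\<close>

definition mean_table :: "predicate \<Rightarrow> nat list \<Rightarrow> nat" where
  "mean_table P ls =
     (if fst P \<le> 1 then 0 else 64 * (6 div fact (fst P)) * (\<Sum>\<pi>\<in>perms (fst P). snd P \<pi>))"

context csp_instance
begin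

text \<open>Fixing all labels but that of \<open>v\<close>, the effect of changing the label of \<open>v\<close> is a sum of functions
  of at most two other labels. Hence it vanishes identically once it vanishes whenever at most two
  other labels are nonzero, which is what membership in \<open>essential\<close> tests.\<close>

lemma inessential_G:
  assumes v: "v \<in> VV - essential I" and x: "\<And>u. x u < 4" and p: "p < 4"
  shows "G (x(v := p)) = G (x(v := 0))"
proof -
  define xR where "xR R u = (if u \<in> R then x u else 0)" for R u
  define t where "t C y = real (weight C * bucket_table (pred C) (map y (scope C)))" for C :: constr and y
  define H where "H R = (\<Sum>C\<leftarrow>constrs I. t C ((xR R)(v := p)) - t C ((xR R)(v := 0)))" for R
  have H: "H R = real (G ((xR R)(v := p))) - real (G ((xR R)(v := 0)))" for R
    unfolding H_def t_def table_sum_def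
    by (simp add: sum_list_subtractf flip: sum_list_of_nat) (simp add: comp_def)
  have "deg_le 2 VV H"
    unfolding deg_le_def
  proof (intro allI impI)
    fix T X assume T: "T \<subseteq> VV" "2 < card T"
    then have finT: "finite T" using finite_subset by blast
    have "mdiff T (\<lambda>R. t C ((xR R)(v := p)) - t C ((xR R)(v := 0))) X = 0"
      if C: "C \<in> set (constrs I)" for C
    proof (cases "v \<in> set (scope C)")
      case False
      then have "t C ((xR R)(v := p)) = t C ((xR R)(v := 0))" for R
      proof -
        have "map ((xR R)(v := p)) (scope C) = map ((xR R)(v := 0)) (scope C)" using False by auto
        then show ?thesis by (simp only: t_def)
      qed
      then show ?thesis by (simp add: mdiff_def)
    next
      case True
      show ?thesis
      proof (rule mdiff_local[OF finT, of "set (scope C) - {v}"])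
        have "card (set (scope C) - {v}) \<le> 2"
          using True constrD(1,5)[OF C] card_length[of "scope C"] by simp
        then show "\<not> T \<subseteq> set (scope C) - {v}"
          using T(2) card_mono[of "set (scope C) - {v}" T] by auto
        show "t C ((xR R)(v := p)) - t C ((xR R)(v := 0))
          = t C ((xR (R \<inter> (set (scope C) - {v})))(v := p)) - t C ((xR (R \<inter> (set (scope C) - {v})))(v := 0))" for R
        proof -
          have "map ((xR R)(v := q)) (scope C) = map ((xR (R \<inter> (set (scope C) - {v})))(v := q)) (scope C)" for q
            by (auto simp: xR_def)
          then show ?thesis by (simp only: t_def)
        qed
      qed
    qed
    then show "mdiff T H X = 0"
      unfolding H_def mdiff_sum_list by (simp cong: map_cong)
  qed
  moreover have "H R = 0" if R: "R \<subseteq> VV" "card R \<le> 2" for R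
  proof -
    have "finite R" using R finite_subset by blast
    \<comment> \<open>\<open>v\<close> may serve as padding when \<open>R\<close> has fewer than two
      elements, since the last update overwrites its label.\<close>
    have "\<exists>u w. u \<in> VV \<and> w \<in> VV \<and> R \<subseteq> {u, w} \<and> {u, w} \<subseteq> insert v R"
    proof -
      consider "card R = 0" | "card R = 1" | "card R = 2" using R by linarith
      then show ?thesis
      proof cases
        case 1
        then show ?thesis using v \<open>finite R\<close> by (intro exI[of _ v]) auto
      next
        case 2
        then obtain u where "R = {u}" by (auto simp: card_1_singleton_iff)
        then show ?thesis using R by (intro exI[of _ u]) auto
      next
        case 3
        then obtain u w where "R = {u, w}" by (auto simp: card_2_iff)
        then show ?thesis using R by (intro exI[of _ u] exI[of _ w]) auto
      qed
    qed
    then obtain u w where uw: "u \<in> VV" "w \<in> VV" "R \<subseteq> {u, w}" "{u, w} \<subseteq> insert v R" by blast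
    have eq: "(xR R)(v := q) = (\<lambda>_. 0)(w := xR R w, u := xR R u, v := q)" for q
      using uw(3) by (auto simp: xR_def fun_eq_iff)
    have "xR R u < 4" "xR R w < 4" using x by (auto simp: xR_def)
    then have "G ((\<lambda>_. 0)(w := xR R w, u := xR R u, v := p)) = G ((\<lambda>_. 0)(w := xR R w, u := xR R u, v := 0))"
      using v uw(1,2) p unfolding essential_def by blast
    then show ?thesis unfolding H eq by simp
  qed
  ultimately have "H VV = 0" by (intro deg_le_vanish[of 2 VV H VV]) auto
  moreover have "G ((xR VV)(v := q)) = G (x(v := q))" for q
    by (rule G_cong) (simp add: xR_def)
  ultimately show ?thesis unfolding H by simp
qed

text \<open>Give the elements of \<open>xs\<close>, \<open>v\<close>, \<open>u\<close> and the elements of \<open>zs\<close> the labels 0, 1, 2 and 3.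
  Exchanging the labels of \<open>v\<close> and \<open>u\<close> changes \<open>G\<close> by the same amount as the swap changes six times
  the satisfied weight. If \<open>v\<close> does not matter to \<open>G\<close>, then neither does the exchange, since buckets 1
  and 2 contain nothing but \<open>v\<close> and \<open>u\<close>.\<close>

lemma sat_weight_swap:
  assumes ys: "distinct (xs @ v # u # zs)" "set (xs @ v # u # zs) = VV" and v: "v \<notin> essential I"
  shows "sat_weight I (pos (xs @ v # u # zs)) = sat_weight I (pos (xs @ u # v # zs))"
proof -
  define \<phi> where "\<phi> = pos (xs @ v # u # zs)"
  define \<psi> where "\<psi> = pos (xs @ u # v # zs)"
  define x :: "nat \<Rightarrow> nat" where
    "x w = (if w \<in> set xs then 0 else if w = v then 1 else if w = u then 2 else 3)" for w
  define y :: "nat \<Rightarrow> nat" where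
    "y w = (if w \<in> set xs then 0 else if w = v then 2 else if w = u then 1 else 3)" for w
  have uv: "u \<noteq> v" "u \<notin> set xs" "v \<notin> set xs" "u \<notin> set zs" "v \<notin> set zs"
    "\<And>w. w \<in> set xs \<Longrightarrow> w \<notin> set zs" "v \<in> VV" "u \<in> VV"
    using ys by auto
  have inj: "inj_on \<phi> VV" "inj_on \<psi> VV"
  proof -
    have "set (xs @ u # v # zs) = VV" using ys(2) by auto
    then show "inj_on \<phi> VV" "inj_on \<psi> VV"
      using pos_inj[of "xs @ v # u # zs"] pos_inj[of "xs @ u # v # zs"] ys(2)
      by (simp_all only: \<phi>_def \<psi>_def)
  qed
  have xs_less: "pos xs w < length xs" if "w \<in> set xs" for w using that by (rule pos_less)
  \<comment> \<open>A scope with both \<open>u\<close> and \<open>v\<close> has at most one more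
    element, so its labels are distinct and its table entry is exact. In any other scope neither the
    swap nor the exchange of labels affects a comparison.\<close>
  have C: "6 * snd (pred C) (rel_order \<phi> (scope C)) + bucket_table (pred C) (map y (scope C))
      = 6 * snd (pred C) (rel_order \<psi> (scope C)) + bucket_table (pred C) (map x (scope C))"
    if C: "C \<in> set (constrs I)" for C
  proof (cases "u \<in> set (scope C) \<and> v \<in> set (scope C)")
    case True
    let ?S = "scope C"
    note S = constrD[OF C]
    have "card (set ?S - {u, v}) \<le> 1"
    proof -
      have "card (set ?S - {u, v}) = card (set ?S) - 2"
        using True uv(1) by (subst card_Diff_subset) auto
      then show ?thesis using S(1,5) card_length[of ?S] by linarith
    qed
    then have le1: "a = b" if "a \<in> set ?S - {u, v}" "b \<in> set ?S - {u, v}" for a b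
      using that by (metis card_le_Suc0_iff_eq One_nat_def List.finite_set finite_Diff)
    have "inj_on x (set ?S)"
    proof (rule inj_onI)
      fix a b assume ab: "a \<in> set ?S" "b \<in> set ?S" "x a = x b"
      show "a = b" using ab le1[of a b] uv(1-3) by (auto simp: x_def split: if_splits)
    qed
    moreover have "inj_on y (set ?S)"
    proof (rule inj_onI)
      fix a b assume ab: "a \<in> set ?S" "b \<in> set ?S" "y a = y b"
      show "a = b" using ab le1[of a b] uv(1-3) by (auto simp: y_def split: if_splits)
    qed
    ultimately have "distinct (map x ?S)" "distinct (map y ?S)" using S(2) by (auto simp: distinct_map)
    then have "bucket_table (pred C) (map x ?S) = 6 * snd (pred C) (rel_order x ?S)"
      "bucket_table (pred C) (map y ?S) = 6 * snd (pred C) (rel_order y ?S)"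
      using S by (simp_all add: bucket_table_distinct rel_order_map)
    moreover have "rel_order x ?S = rel_order \<phi> ?S"
    proof (rule rel_order_cong)
      fix a b assume ab: "a \<in> set ?S" "b \<in> set ?S"
      show "x a \<le> x b \<longleftrightarrow> \<phi> a \<le> \<phi> b"
        using ab le1[of a b] uv xs_less[of a] xs_less[of b] by (auto simp: x_def \<phi>_def pos_append)
    qed
    moreover have "rel_order y ?S = rel_order \<psi> ?S"
    proof (rule rel_order_cong)
      fix a b assume ab: "a \<in> set ?S" "b \<in> set ?S"
      show "y a \<le> y b \<longleftrightarrow> \<psi> a \<le> \<psi> b"
        using ab le1[of a b] uv xs_less[of a] xs_less[of b] by (auto simp: y_def \<psi>_def pos_append)
    qed
    ultimately show ?thesis by simp
  next
    case False
    let ?S = "scope C"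
    have "rel_order \<phi> ?S = rel_order \<psi> ?S"
    proof (rule rel_order_cong)
      fix a b assume ab: "a \<in> set ?S" "b \<in> set ?S"
      show "\<phi> a \<le> \<phi> b \<longleftrightarrow> \<psi> a \<le> \<psi> b"
        using ab False uv xs_less[of a] xs_less[of b] by (auto simp: \<phi>_def \<psi>_def pos_append)
    qed
    moreover have "bucket_table (pred C) (map x ?S) = bucket_table (pred C) (map y ?S)"
    proof (rule bucket_table_cong)
      fix i j assume "i < fst (pred C)" "j < fst (pred C)"
      then have "i < length ?S" "j < length ?S" using constrD(1)[OF C] by auto
      then show "map x ?S ! i \<le> map x ?S ! j \<longleftrightarrow> map y ?S ! i \<le> map y ?S ! j"
        using False uv nth_mem[of i ?S] nth_mem[of j ?S] by (auto simp: x_def y_def)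
    qed (use constrD[OF C] in auto)
    ultimately show ?thesis by simp
  qed
  have "(\<Sum>C\<leftarrow>constrs I. weight C * (6 * snd (pred C) (rel_order \<phi> (scope C)) + bucket_table (pred C) (map y (scope C))))
      = (\<Sum>C\<leftarrow>constrs I. weight C * (6 * snd (pred C) (rel_order \<psi> (scope C)) + bucket_table (pred C) (map x (scope C))))"
    using C by (simp cong: map_cong)
  then have "6 * sat_weight I \<phi> + G y = 6 * sat_weight I \<psi> + G x"
    by (simp add: sat_weight_eq[OF inj(1)] sat_weight_eq[OF inj(2)] table_sum_def distrib_left
        sum_list_addf mult.left_commute[of _ 6] flip: sum_list_const_mult)
  \<comment> \<open>With \<open>v\<close> sent to bucket 0, \<open>u\<close> is alone in bucket 2 or
    in bucket 1, and either compares alike with the remaining buckets 0 and 3.\<close>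
  moreover have "G x = G y"
  proof -
    have vV: "v \<in> VV - essential I" using v uv by simp
    have "G x = G (x(v := 1))" using uv by (intro G_cong) (simp add: x_def)
    also have "\<dots> = G (x(v := 0))" by (rule inessential_G[OF vV]) (auto simp: x_def)
    also have "\<dots> = G (y(v := 0))"
    proof (rule table_sum_cong)
      fix C assume C: "C \<in> set (constrs I)"
      let ?S = "scope C"
      show "bucket_table (pred C) (map (x(v := 0)) ?S) = bucket_table (pred C) (map (y(v := 0)) ?S)"
      proof (rule bucket_table_cong)
        fix i j assume "i < fst (pred C)" "j < fst (pred C)"
        then have "i < length ?S" "j < length ?S" using constrD(1)[OF C] by auto
        then show "map (x(v := 0)) ?S ! i \<le> map (x(v := 0)) ?S ! j \<longleftrightarrow> map (y(v := 0)) ?S ! i \<le> map (y(v := 0)) ?S ! j"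
          using uv by (auto simp: x_def y_def)
      qed (use constrD[OF C] in auto)
    qed
    also have "\<dots> = G (y(v := 2))" by (rule inessential_G[OF vV, symmetric]) (auto simp: y_def)
    also have "\<dots> = G y" using uv by (intro G_cong) (simp add: y_def)
    finally show ?thesis .
  qed
  ultimately show ?thesis by (simp add: \<phi>_def \<psi>_def)
qed

lemma sat_weight_move:
  assumes "distinct (xs @ v # zs @ ws)" "set (xs @ v # zs @ ws) = VV" "v \<notin> essential I"
  shows "sat_weight I (pos (xs @ v # zs @ ws)) = sat_weight I (pos (xs @ zs @ v # ws))"
  using assms(1,2)
proof (induction zs arbitrary: xs)
  case (Cons u zs)
  have "sat_weight I (pos (xs @ v # u # (zs @ ws))) = sat_weight I (pos (xs @ u # v # (zs @ ws)))"
    by (rule sat_weight_swap) (use Cons.prems assms(3) in auto)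
  also have "\<dots> = sat_weight I (pos ((xs @ [u]) @ zs @ v # ws))"
    using Cons.IH[of "xs @ [u]"] Cons.prems by (simp add: insert_commute)
  finally show ?case by simp
qed simp

text \<open>Induction on \<open>nes\<close>: each inessential variable is moved to the front of the
  tail assembled so far.\<close>

lemma sat_weight_inessential_last:
  assumes "distinct ys" "set ys = VV" "distinct nes" "set nes \<subseteq> VV - essential I"
  shows "sat_weight I (pos ys) = sat_weight I (pos (filter (\<lambda>v. v \<notin> set nes) ys @ nes))"
  using assms(3,4)
proof (induction nes)
  case (Cons v nes)
  let ?zs = "filter (\<lambda>w. w \<notin> set nes) ys"
  have v: "v \<in> VV" "v \<notin> essential I" "v \<notin> set nes" using Cons.prems by auto
  then have "v \<in> set ?zs" using assms(2) by simp
  then obtain as bs where ab: "?zs = as @ v # bs" by (meson split_list)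
  have dz: "distinct (?zs @ nes)" "set (?zs @ nes) = VV"
    using assms Cons.prems by auto
  have "sat_weight I (pos ys) = sat_weight I (pos (as @ v # bs @ nes))"
    using Cons ab by simp
  also have "\<dots> = sat_weight I (pos (as @ bs @ v # nes))"
    by (rule sat_weight_move) (use dz ab v in auto)
  also have "as @ bs @ v # nes = (as @ bs) @ v # nes" by simp
  also have "as @ bs = filter (\<lambda>w. w \<noteq> v) ?zs"
  proof -
    have "v \<notin> set as" "v \<notin> set bs" using dz(1) ab by auto
    then have "filter (\<lambda>w. w \<noteq> v) as = as" "filter (\<lambda>w. w \<noteq> v) bs = bs"
      by (auto simp: filter_id_conv)
    then show ?thesis unfolding ab by simp
  qed
  also have "\<dots> = filter (\<lambda>w. w \<notin> set (v # nes)) ys"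
    by (simp add: conj_commute)
  finally show ?case by simp
qed simp

lemma suffix_sum_gain:
  assumes "distinct ys" "set ys = VV"
  shows "suffix_sum (gain I) ys
     = (\<Sum>C\<leftarrow>constrs I. if fst (pred C) \<le> 1 then 0 else 384 * (weight C * snd (pred C) (rel_order (pos ys) (scope C))))"
proof -
  have lin: "suffix_sum (gain I) zs
      = (\<Sum>C\<leftarrow>constrs I. weight C * suffix_sum (\<lambda>Z y. gain_table (pred C) (map (place_label Z y) (scope C))) zs)" for zs
    by (induction zs) (simp_all add: gain_def table_sum_def distrib_left sum_list_addf)
  have "weight C * suffix_sum (\<lambda>Z y. gain_table (pred C) (map (place_label Z y) (scope C))) ys
      = (if fst (pred C) \<le> 1 then 0 else 384 * (weight C * snd (pred C) (rel_order (pos ys) (scope C))))"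
    if C: "C \<in> set (constrs I)" for C
  proof (cases "fst (pred C) \<le> 1")
    case True
    \<comment> \<open>A scope of length at most 1 cannot show both label 0 and label 1.\<close>
    have "gain_table (pred C) ls = 0" if "length ls \<le> 1" for ls
      using that by (cases ls) (auto simp: gain_table_def)
    then have "suffix_sum (\<lambda>Z y. gain_table (pred C) (map (place_label Z y) (scope C))) zs = 0" for zs
      using True constrD(1)[OF C] by (induction zs) auto
    then show ?thesis using True by simp
  next
    case False
    have "set (scope C) - set ys = {}" using constrD(3)[OF C] assms by auto
    then have "card (set (scope C) - set ys) \<le> 1" by (simp only: card.empty)
    moreover have "rel_order (\<lambda>v. if v \<in> set ys then Suc (pos ys v) else 0) (scope C) = rel_order (pos ys) (scope C)"
      using constrD(3)[OF C] assms by (intro rel_order_cong) auto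
    ultimately show ?thesis
      using suffix_sum_constraint[OF assms(1) constrD(2)[OF C], of "pred C"] constrD(1,5)[OF C] False by simp
  qed
  then show ?thesis unfolding lin by (simp cong: map_cong)
qed

definition low_arity_weight :: nat where
  "low_arity_weight = (\<Sum>C\<leftarrow>constrs I. if fst (pred C) \<le> 1 then 384 * (weight C * snd (pred C) id) else 0)"

lemma perms_le_1: "a \<le> 1 \<Longrightarrow> perms a = {id}"
proof -
  assume "a \<le> 1"
  then have "a = 0 \<or> a = 1" by arith
  then show ?thesis by (auto simp: perms_def)
qed

lemma suffix_sum_sat_weight:
  assumes "distinct ys" "set ys = VV"
  shows "suffix_sum (gain I) ys + low_arity_weight = 384 * sat_weight I (pos ys)"
proof -
  have "inj_on (pos ys) VV" using pos_inj[of ys] assms by simp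
  note sw = sat_weight_eq[OF this]
  have "rel_order (pos ys) (scope C) = id" if C: "C \<in> set (constrs I)" "fst (pred C) \<le> 1" for C
    using rel_order_perms[of "scope C" "pos ys"] perms_le_1[OF C(2)] constrD[OF C(1)]
      inj_on_subset[OF \<open>inj_on (pos ys) VV\<close>] by auto
  then have "(if fst (pred C) \<le> 1 then 0 else 384 * (weight C * snd (pred C) (rel_order (pos ys) (scope C))))
     + (if fst (pred C) \<le> 1 then 384 * (weight C * snd (pred C) id) else 0)
     = 384 * (weight C * snd (pred C) (rel_order (pos ys) (scope C)))" if "C \<in> set (constrs I)" for C
    using that by simp
  then show ?thesis
    unfolding suffix_sum_gain[OF assms] low_arity_weight_def sw
    by (simp add: sum_list_addf[symmetric] sum_list_const_mult[symmetric] cong: map_cong)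
qed

text \<open>By symmetry each constraint is satisfied with probability equal to its fraction of
  satisfying permutations, so no orderings are enumerated and \<open>h\<close> has no influence. The
  scaling agrees since 64 * 6 = 384.\<close>

lemma mean_table_sum: "real (table_sum mean_table I h) + low_arity_weight = 384 * mean_weight"
proof -
  let ?N = "card (orderings VV)"
  have N: "real ?N > 0" by (simp add: card_gt_0_iff orderings_nonempty finite_orderings)
  have "?N * (weight C * mean_table (pred C) (map h (scope C))
      + (if fst (pred C) \<le> 1 then 384 * (weight C * snd (pred C) id) else 0))
     = 384 * (weight C * (\<Sum>\<phi>\<in>orderings VV. snd (pred C) (rel_order \<phi> (scope C))))"
    if C: "C \<in> set (constrs I)" for C
  proof -
    let ?a = "fst (pred C)"
    let ?s = "\<Sum>\<phi>\<in>orderings VV. snd (pred C) (rel_order \<phi> (scope C))"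
    let ?t = "\<Sum>\<pi>\<in>perms ?a. snd (pred C) \<pi>"
    have st: "fact ?a * ?s = ?N * ?t"
      using sum_orderings_rel_order[OF constrD(2,3)[OF C], of "snd (pred C)"] constrD(1)[OF C] by simp
    show ?thesis
    proof (cases "?a \<le> 1")
      case True
      then have "fact ?a = (1 :: nat)" by (cases ?a) auto
      then have "?s = ?N * snd (pred C) id" using st perms_le_1[OF True] by simp
      then show ?thesis using True by (simp add: mean_table_def)
    next
      case False
      have "?N * (weight C * (64 * (6 div fact ?a) * ?t)) = weight C * 64 * (6 div fact ?a) * (?N * ?t)"
        by simp
      also have "\<dots> = weight C * 64 * ((6 div fact ?a) * fact ?a) * ?s" unfolding st[symmetric] by simp
      also have "\<dots> = 384 * (weight C * ?s)" unfolding six_div_fact[OF constrD(5)[OF C]] by simp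
      finally show ?thesis using False by (simp add: mean_table_def)
    qed
  qed
  then have "?N * (table_sum mean_table I h + low_arity_weight)
      = (\<Sum>C\<leftarrow>constrs I. 384 * (weight C * (\<Sum>\<phi>\<in>orderings VV. snd (pred C) (rel_order \<phi> (scope C)))))"
    unfolding table_sum_def low_arity_weight_def
    by (simp add: sum_list_addf[symmetric] sum_list_const_mult[symmetric] cong: map_cong)
  also have "\<dots> = 384 * (\<Sum>\<phi>\<in>orderings VV. sat_weight I \<phi>)"
    by (simp add: sat_weight_eq[OF orderings_inj] sum_distrib_left sum_list_sum_swap sum_list_const_mult)
  finally have "real (?N * (table_sum mean_table I h + low_arity_weight)) = real (384 * (\<Sum>\<phi>\<in>orderings VV. sat_weight I \<phi>))"
    by simp
  then show ?thesis using N by (simp add: mean_weight_def field_simps)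
qed

text \<open>Scaled by 384, the excess k / (c! 4^c) becomes 12 k for c = 2 and k for c = 3, and the
  low-arity weight cancels. By \<open>sat_weight_inessential_last\<close> only orders with the fixed
  tail \<open>nes\<close> have to compete.\<close>

lemma above_average_iff:
  assumes "c \<in> {2, 3}" "distinct nes" "set nes = VV - essential I"
  shows "above_average c I \<longleftrightarrow> (\<exists>es. distinct es \<and> set es = essential I \<and>
     table_sum mean_table I h + (if c = 2 then 12 else 1) * param I \<le> suffix_sum (gain I) (es @ nes))"
proof -
  let ?k = "(if c = 2 then 12 else 1) * param I"
  have k: "384 * (real (param I) / (fact c * 4 ^ c)) = ?k"
    using assms(1) by (auto simp: fact_numeral)
  have iff: "mean_weight + real (param I) / (fact c * 4 ^ c) \<le> real (sat_weight I (pos ys))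
     \<longleftrightarrow> table_sum mean_table I h + ?k \<le> suffix_sum (gain I) ys"
    if "distinct ys" "set ys = VV" for ys
  proof -
    have "mean_weight + real (param I) / (fact c * 4 ^ c) \<le> real (sat_weight I (pos ys))
       \<longleftrightarrow> 384 * mean_weight + 384 * (real (param I) / (fact c * 4 ^ c)) \<le> real (384 * sat_weight I (pos ys))"
      by auto
    also have "\<dots> \<longleftrightarrow> real (table_sum mean_table I h + low_arity_weight + ?k) \<le> real (suffix_sum (gain I) ys + low_arity_weight)"
      unfolding k suffix_sum_sat_weight[OF that] using mean_table_sum[of h] by simp
    also have "\<dots> \<longleftrightarrow> table_sum mean_table I h + ?k \<le> suffix_sum (gain I) ys"
      unfolding of_nat_le_iff by simp
    finally show ?thesis .
  qed
  have ess: "essential I \<subseteq> VV" by (auto simp: essential_def)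
  show ?thesis
  proof
    assume "above_average c I"
    then obtain \<phi> where \<phi>: "\<phi> \<in> orderings VV"
      "mean_weight + real (param I) / (fact c * 4 ^ c) \<le> real (sat_weight I \<phi>)"
      by (auto simp: above_average_def avg_fraction_eq)
    obtain ys where ys: "distinct ys" "set ys = VV"
      "\<And>u v. u \<in> VV \<Longrightarrow> v \<in> VV \<Longrightarrow> pos ys u \<le> pos ys v \<longleftrightarrow> \<phi> u \<le> \<phi> v"
      using pos_sorted[OF _ orderings_inj[OF \<phi>(1)]] by blast
    let ?es = "filter (\<lambda>v. v \<notin> set nes) ys"
    have "sat_weight I \<phi> = sat_weight I (pos ys)" by (rule sat_weight_cong) (use ys(3) in auto)
    also have "\<dots> = sat_weight I (pos (?es @ nes))"
      by (rule sat_weight_inessential_last) (use ys assms in auto)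
    finally have "mean_weight + real (param I) / (fact c * 4 ^ c) \<le> real (sat_weight I (pos (?es @ nes)))"
      using \<phi>(2) by simp
    moreover have "distinct (?es @ nes)" "set (?es @ nes) = VV" using ys assms by auto
    moreover have "set ?es = essential I" using ys(2) assms(3) ess by auto
    ultimately show "\<exists>es. distinct es \<and> set es = essential I \<and>
       table_sum mean_table I h + ?k \<le> suffix_sum (gain I) (es @ nes)"
      using iff ys(1) by (intro exI[of _ ?es]) auto
  next
    assume "\<exists>es. distinct es \<and> set es = essential I \<and>
       table_sum mean_table I h + ?k \<le> suffix_sum (gain I) (es @ nes)"
    then obtain es where es: "distinct es" "set es = essential I"
      "table_sum mean_table I h + ?k \<le> suffix_sum (gain I) (es @ nes)" by blast
    then have d: "distinct (es @ nes)" "set (es @ nes) = VV" using assms ess by auto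
    then have "inj_on (pos (es @ nes)) VV" using pos_inj[of "es @ nes"] by simp
    then obtain \<psi> where \<psi>: "\<psi> \<in> orderings VV"
      "\<And>u v. u \<in> VV \<Longrightarrow> v \<in> VV \<Longrightarrow> \<psi> u \<le> \<psi> v \<longleftrightarrow> pos (es @ nes) u \<le> pos (es @ nes) v"
      using ordering_of_inj[of VV] by blast
    have "sat_weight I \<psi> = sat_weight I (pos (es @ nes))" by (rule sat_weight_cong) (rule \<psi>(2))
    then show "above_average c I"
      using iff[OF d] es(3) unfolding above_average_def avg_fraction_eq by (intro bexI[OF _ \<psi>(1)]) simp
  qed
qed

end

section \<open>A structured language for random access machines\<close>

datatype aid = Label | Ess | Rest | Table

datatype loc = Var nat | Arr aid nat

type_synonym state = "loc \<Rightarrow> nat"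

datatype exp =
    N nat | V nat | A aid exp | Plus exp exp | Minus exp exp | Halve exp | In exp

datatype com =
    Assign nat exp
  | Write aid exp exp
  | Seq com com (infixr ";;" 60)
  | While exp com
  | Cond exp com com
  | Skip

definition read_input :: "nat list \<Rightarrow> nat \<Rightarrow> nat" where
  "read_input xs i = (if i < length xs then xs ! i else 0)"

fun eval :: "nat list \<Rightarrow> state \<Rightarrow> exp \<Rightarrow> nat" where
  "eval xs s (N n) = n"
| "eval xs s (V x) = s (Var x)"
| "eval xs s (A a e) = s (Arr a (eval xs s e))"
| "eval xs s (Plus e f) = eval xs s e + eval xs s f"
| "eval xs s (Minus e f) = eval xs s e - eval xs s f"
| "eval xs s (Halve e) = eval xs s e div 2"
| "eval xs s (In e) = read_input xs (eval xs s e)"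

text \<open>Registers are divided by their residue modulo 8: residue 0 holds the program variables, residue
  1 the intermediate results of expressions, and residues 2 to 5 hold one array each.\<close>

fun array_offset :: "aid \<Rightarrow> nat" where
  "array_offset Label = 2"
| "array_offset Ess = 3"
| "array_offset Rest = 4"
| "array_offset Table = 5"

fun addr :: "loc \<Rightarrow> nat" where
  "addr (Var x) = 8 * x"
| "addr (Arr a i) = 8 * i + array_offset a"

definition tmp :: "nat \<Rightarrow> nat" where
  "tmp d = 8 * d + 1"

text \<open>Three doublings stand in for the multiplication by 8.\<close>

definition array_addr_code :: "aid \<Rightarrow> nat \<Rightarrow> instr list" where
  "array_addr_code a d =
     [Add (tmp d) (tmp d) (tmp d), Add (tmp d) (tmp d) (tmp d), Add (tmp d) (tmp d) (tmp d),
      SetConst (tmp (d + 1)) (array_offset a), Add (tmp d) (tmp d) (tmp (d + 1))]"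

text \<open>\<open>d\<close> acts as a stack pointer: the result lands in \<open>tmp d\<close>, and
  shallower temporaries survive. For want of a move instruction, copying is addition to a
  zero.\<close>

fun compile_exp :: "exp \<Rightarrow> nat \<Rightarrow> instr list" where
  "compile_exp (N n) d = [SetConst (tmp d) n]"
| "compile_exp (V x) d = [SetConst (tmp d) 0, Add (tmp d) (tmp d) (addr (Var x))]"
| "compile_exp (A a e) d = compile_exp e d @ array_addr_code a d @ [Load (tmp d) (tmp d)]"
| "compile_exp (Plus e f) d =
     compile_exp e d @ compile_exp f (d + 1) @ [Add (tmp d) (tmp d) (tmp (d + 1))]"
| "compile_exp (Minus e f) d =
     compile_exp e d @ compile_exp f (d + 1) @ [Sub (tmp d) (tmp d) (tmp (d + 1))]"
| "compile_exp (Halve e) d = compile_exp e d @ [Half (tmp d) (tmp d)]"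
| "compile_exp (In e) d = compile_exp e d @ [ReadInput (tmp d) (tmp d)]"

definition assign_code :: "nat \<Rightarrow> exp \<Rightarrow> instr list" where
  "assign_code x e = compile_exp e 0 @ [SetConst (tmp 1) 0, Add (addr (Var x)) (tmp 0) (tmp 1)]"

definition write_code :: "aid \<Rightarrow> exp \<Rightarrow> exp \<Rightarrow> instr list" where
  "write_code a e f = compile_exp e 0 @ array_addr_code a 0 @ compile_exp f 1 @ [Store (tmp 0) (tmp 1)]"

text \<open>Jump targets are absolute, hence the argument \<open>pc\<close> for the address at which
  the code will be placed.\<close>

fun compile :: "com \<Rightarrow> nat \<Rightarrow> instr list" where
  "compile (Assign x e) pc = assign_code x e"
| "compile (Write a e f) pc = write_code a e f"
| "compile (Seq c d) pc = (let p = compile c pc in p @ compile d (pc + length p))"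
| "compile (While e c) pc =
     (let g = compile_exp e 0; p = compile c (pc + length g + 1)
      in g @ [JumpZero (tmp 0) (pc + length g + length p + 2)] @ p @ [Jump pc])"
| "compile (Cond e c d) pc =
     (let g = compile_exp e 0; p = compile c (pc + length g + 1);
          q = compile d (pc + length g + length p + 2)
      in g @ [JumpZero (tmp 0) (pc + length g + length p + 2)] @ p
           @ [Jump (pc + length g + length p + length q + 2)] @ q)"
| "compile Skip pc = []"

text \<open>The time component is the exact number of machine steps: a guard costs its code and one
  \<open>JumpZero\<close>, and a branch that ends in a \<open>Jump\<close> costs one step
  more.\<close>

inductive big_step :: "nat list \<Rightarrow> com \<Rightarrow> state \<Rightarrow> nat \<Rightarrow> state \<Rightarrow> bool" for xs where
  Assign: "big_step xs (Assign x e) s (length (assign_code x e)) (s(Var x := eval xs s e))"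
| Write: "big_step xs (Write a e f) s (length (write_code a e f))
            (s(Arr a (eval xs s e) := eval xs s f))"
| Seq: "big_step xs c s t s' \<Longrightarrow> big_step xs d s' t' s'' \<Longrightarrow> big_step xs (Seq c d) s (t + t') s''"
| WhileF: "eval xs s e = 0 \<Longrightarrow> big_step xs (While e c) s (length (compile_exp e 0) + 1) s"
| WhileT: "eval xs s e \<noteq> 0 \<Longrightarrow> big_step xs c s t s' \<Longrightarrow> big_step xs (While e c) s' t' s'' \<Longrightarrow>
     big_step xs (While e c) s (length (compile_exp e 0) + t + t' + 2) s''"
| CondT: "eval xs s e \<noteq> 0 \<Longrightarrow> big_step xs c s t s' \<Longrightarrow>
     big_step xs (Cond e c d) s (length (compile_exp e 0) + t + 2) s'"
| CondF: "eval xs s e = 0 \<Longrightarrow> big_step xs d s t s' \<Longrightarrow>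
     big_step xs (Cond e c d) s (length (compile_exp e 0) + t + 1) s'"
| Skip: "big_step xs Skip s 0 s"

definition represents :: "(nat \<Rightarrow> nat) \<Rightarrow> state \<Rightarrow> bool" where
  "represents r s \<longleftrightarrow> (\<forall>l. r (addr l) = s l)"

section \<open>Correctness of the compiler\<close>

lemma addr_inj: "addr l = addr l' \<longleftrightarrow> l = l'"
proof
  assume "addr l = addr l'"
  then show "l = l'"
    by (cases l; cases l'; cases "case l of Arr a _ \<Rightarrow> a | _ \<Rightarrow> Label";
        cases "case l' of Arr a _ \<Rightarrow> a | _ \<Rightarrow> Label") (simp_all, presburger+)
qed simp

lemma addr_tmp: "addr l \<noteq> tmp d"
proof (cases l)
  case (Arr a i)
  then show ?thesis by (cases a) (simp_all add: tmp_def, presburger+)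
qed (simp add: tmp_def, presburger)

lemma tmp_inj [simp]: "tmp d = tmp d' \<longleftrightarrow> d = d'"
  by (simp add: tmp_def)

lemmas addr_simps = addr_inj addr_tmp addr_tmp[symmetric]

definition effect :: "nat list \<Rightarrow> instr list \<Rightarrow> (nat \<Rightarrow> nat) \<Rightarrow> nat \<Rightarrow> nat" where
  "effect xs is r = fold (\<lambda>i r. snd (exec xs i (0, r))) is r"

lemma effect_simps [simp]:
  "effect xs [] r = r"
  "effect xs (i # is) r = effect xs is (snd (exec xs i (0, r)))"
  "effect xs (is @ js) r = effect xs js (effect xs is r)"
  by (simp_all add: effect_def)

fun straight :: "instr \<Rightarrow> bool" where
  "straight (Jump l) = False"
| "straight (JumpZero i l) = False"
| "straight _ = True"

lemma exec_straight: "straight i \<Longrightarrow> exec xs i (pc, r) = (pc + 1, snd (exec xs i (0, r)))"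
  by (cases i) auto

definition steps :: "program \<Rightarrow> nat list \<Rightarrow> nat \<Rightarrow> config \<Rightarrow> config" where
  "steps p xs t = step p xs ^^ t"

lemma steps_0 [simp]: "steps p xs 0 c = c"
  by (simp add: steps_def)

lemma steps_Suc: "steps p xs (Suc t) c = steps p xs t (step p xs c)"
  by (simp add: steps_def funpow_Suc_right del: funpow.simps)

lemma steps_add: "steps p xs (t + t') c = steps p xs t' (steps p xs t c)"
  by (simp add: steps_def add.commute[of t] funpow_add)

lemma steps_trans:
  "steps p xs t c = c' \<Longrightarrow> steps p xs t' c' = c'' \<Longrightarrow> steps p xs (t + t') c = c''"
  by (simp add: steps_add)

lemma steps_1: "steps p xs 1 c = step p xs c"
  by (simp add: steps_def)

lemma steps_straight:
  assumes "list_all straight is"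
  shows "steps (p @ is @ q) xs (length is) (length p, r) = (length p + length is, effect xs is r)"
  using assms
proof (induction "is" arbitrary: p r)
  case (Cons i "is")
  have "step (p @ (i # is) @ q) xs (length p, r) = (length (p @ [i]), snd (exec xs i (0, r)))"
    using Cons.prems exec_straight[of i xs "length p" r] by (simp add: step_def)
  then show ?case using Cons.IH[of "p @ [i]"] Cons.prems by (simp add: steps_Suc)
qed simp

lemma straight_code [simp]:
  "list_all straight (array_addr_code a d)"
  "list_all straight (compile_exp e d)"
  "list_all straight (assign_code x e)"
  "list_all straight (write_code a e f)"
proof -
  show 1: "list_all straight (array_addr_code a d)" for a d by (simp add: array_addr_code_def)
  show 2: "list_all straight (compile_exp e d)" for e d by (induction e d rule: compile_exp.induct) (simp_all add: 1)
  show "list_all straight (assign_code x e)" "list_all straight (write_code a e f)"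
    by (simp_all add: assign_code_def write_code_def 1 2)
qed

lemma effect_array_addr_code:
  "\<exists>v. effect xs (array_addr_code a d) r = r(tmp d := 8 * r (tmp d) + array_offset a, tmp (d + 1) := v)"
  by (rule exI[of _ "array_offset a"]) (auto simp: array_addr_code_def fun_eq_iff)

lemma effect_compile_exp:
  assumes "represents r s"
  shows "effect xs (compile_exp e d) r (tmp d) = eval xs s e"
    and "represents (effect xs (compile_exp e d) r) s"
    and "d' < d \<Longrightarrow> effect xs (compile_exp e d) r (tmp d') = r (tmp d')"
proof -
  have "effect xs (compile_exp e d) r (tmp d) = eval xs s e \<and>
    represents (effect xs (compile_exp e d) r) s \<and>
    (\<forall>d'<d. effect xs (compile_exp e d) r (tmp d') = r (tmp d'))"
    using assms
  proof (induction e d arbitrary: r rule: compile_exp.induct)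
    case (3 a e d)
    let ?r = "effect xs (compile_exp e d) r"
    obtain v where v: "effect xs (array_addr_code a d) ?r
        = ?r(tmp d := 8 * ?r (tmp d) + array_offset a, tmp (d + 1) := v)"
      using effect_array_addr_code by blast
    have "8 * ?r (tmp d) + array_offset a = addr (Arr a (eval xs s e))"
      using 3 by simp
    then show ?case using 3 v
      by (simp add: represents_def addr_simps del: addr.simps)
  next
    case (4 e f d)
    let ?r = "effect xs (compile_exp e d) r"
    show ?case using "4.IH"(1)[OF "4.prems"] "4.IH"(2)[of ?r]
      by (auto simp: represents_def addr_simps)
  next
    case (5 e f d)
    let ?r = "effect xs (compile_exp e d) r"
    show ?case using "5.IH"(1)[OF "5.prems"] "5.IH"(2)[of ?r]
      by (auto simp: represents_def addr_simps)
  qed (auto simp: represents_def addr_simps read_input_def simp del: addr.simps)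
  then show "effect xs (compile_exp e d) r (tmp d) = eval xs s e"
    "represents (effect xs (compile_exp e d) r) s"
    "d' < d \<Longrightarrow> effect xs (compile_exp e d) r (tmp d') = r (tmp d')" by auto
qed

lemma effect_assign_code:
  assumes "represents r s"
  shows "represents (effect xs (assign_code x e) r) (s(Var x := eval xs s e))"
  using effect_compile_exp(1,2)[OF assms, of xs e 0]
  by (auto simp: assign_code_def represents_def addr_simps simp del: addr.simps)

lemma effect_write_code:
  assumes "represents r s"
  shows "represents (effect xs (write_code a e f) r) (s(Arr a (eval xs s e) := eval xs s f))"
proof -
  let ?r = "effect xs (compile_exp e 0) r"
  let ?r' = "effect xs (array_addr_code a 0) ?r"
  obtain v where v: "?r' = ?r(tmp 0 := 8 * ?r (tmp 0) + array_offset a, tmp 1 := v)"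
    using effect_array_addr_code[of xs a 0 ?r] by auto
  note e = effect_compile_exp(1,2)[OF assms, of xs e 0]
  have r': "represents ?r' s" using e v by (simp add: represents_def addr_simps)
  have "?r' (tmp 0) = addr (Arr a (eval xs s e))" using e v by simp
  then show ?thesis
    using effect_compile_exp(1,2)[OF r', of xs f 1] effect_compile_exp(3)[OF r', of 0 1 xs f]
    by (auto simp: write_code_def represents_def addr_simps simp del: addr.simps)
qed

lemma step_at: "length p = pc \<Longrightarrow> step (p @ i # q) xs (pc, r) = exec xs i (pc, r)"
  by (auto simp: step_def)

lemma steps_guard:
  assumes "represents r s"
  shows "\<exists>r'. steps (p @ compile_exp e 0 @ JumpZero (tmp 0) l # q) xs
      (length (compile_exp e 0) + 1) (length p, r)
    = (if eval xs s e = 0 then l else length p + length (compile_exp e 0) + 1, r') \<and> represents r' s"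
proof -
  let ?g = "compile_exp e 0" and ?r = "effect xs (compile_exp e 0) r"
  have 1: "steps (p @ ?g @ JumpZero (tmp 0) l # q) xs (length ?g) (length p, r) = (length p + length ?g, ?r)"
    by (rule steps_straight) simp
  have 2: "steps (p @ ?g @ JumpZero (tmp 0) l # q) xs 1 (length p + length ?g, ?r)
      = exec xs (JumpZero (tmp 0) l) (length p + length ?g, ?r)"
    unfolding steps_1 using step_at[of "p @ ?g" "length p + length ?g"] by simp
  show ?thesis
    unfolding steps_trans[OF 1 2] using effect_compile_exp(1,2)[OF assms, of xs e 0] by auto
qed

text \<open>The surrounding code \<open>p\<close> and \<open>q\<close> is arbitrary because
  subprograms are always executed inside a larger program, at address
  \<open>length p\<close>.\<close>

lemma compile_correct:
  assumes "big_step xs c s t s'" "represents r s"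
  shows "\<exists>r'. steps (p @ compile c (length p) @ q) xs t (length p, r)
            = (length p + length (compile c (length p)), r') \<and> represents r' s'"
  using assms
proof (induction arbitrary: p q r rule: big_step.induct)
  case (Assign x e s)
  from effect_assign_code[OF this] show ?case by (auto simp: steps_straight simp del: fun_upd_apply)
next
  case (Write a e f s)
  from effect_write_code[OF this] show ?case by (auto simp: steps_straight simp del: fun_upd_apply)
next
  case (Seq c s t s' d t' s'')
  let ?c = "compile c (length p)"
  let ?d = "compile d (length (p @ ?c))"
  obtain r' where r': "steps (p @ ?c @ (?d @ q)) xs t (length p, r) = (length p + length ?c, r')"
    "represents r' s'" using Seq.IH(1)[OF Seq.prems] by blast
  obtain r'' where "steps ((p @ ?c) @ ?d @ q) xs t' (length (p @ ?c), r')
      = (length (p @ ?c) + length ?d, r'')" "represents r'' s''"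
    using Seq.IH(2)[OF r'(2)] by blast
  then show ?case using r' by (simp add: steps_add Let_def)
next
  case (WhileF s e c)
  let ?g = "compile_exp e 0"
  let ?c = "compile c (length p + length ?g + 1)"
  obtain r' where "steps (p @ ?g @ JumpZero (tmp 0) (length p + length ?g + length ?c + 2) # ?c @ Jump (length p) # q)
      xs (length ?g + 1) (length p, r) = (length p + length ?g + length ?c + 2, r')" "represents r' s"
    using steps_guard[OF WhileF(2), of p e "length p + length ?g + length ?c + 2" "?c @ Jump (length p) # q" xs]
      WhileF(1) by auto
  then show ?case by (auto simp: Let_def add.assoc)
next
  case (WhileT s e c t s' t' s'')
  let ?g = "compile_exp e 0"
  let ?c = "compile c (length p + length ?g + 1)"
  let ?j = "JumpZero (tmp 0) (length p + length ?g + length ?c + 2)"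
  let ?P = "p @ compile (While e c) (length p) @ q"
  have P: "?P = p @ ?g @ ?j # ?c @ Jump (length p) # q"
    "?P = (p @ ?g @ [?j]) @ ?c @ (Jump (length p) # q)"
    "?P = (p @ ?g @ [?j] @ ?c) @ Jump (length p) # q"
    by (simp_all add: Let_def)
  obtain r1 where r1: "steps ?P xs (length ?g + 1) (length p, r) = (length (p @ ?g @ [?j]), r1)"
    "represents r1 s"
    using steps_guard[OF WhileT.prems, of p e "length p + length ?g + length ?c + 2" "?c @ Jump (length p) # q" xs]
      WhileT.hyps(1) unfolding P(1) by auto
  obtain r2 where r2: "steps ?P xs t (length (p @ ?g @ [?j]), r1) = (length (p @ ?g @ [?j] @ ?c), r2)"
    "represents r2 s'"
    unfolding P(2) using WhileT.IH(1)[OF r1(2), of "p @ ?g @ [?j]"] by (auto simp: add.assoc)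
  have r3: "steps ?P xs 1 (length (p @ ?g @ [?j] @ ?c), r2) = (length p, r2)"
    unfolding P(3) steps_1 step_at[OF refl] by simp
  obtain r4 where r4: "steps ?P xs t' (length p, r2) = (length p + length (compile (While e c) (length p)), r4)"
    "represents r4 s''" using WhileT.IH(2)[OF r2(2)] by blast
  have "length ?g + t + t' + 2 = length ?g + 1 + (t + (1 + t'))" by simp
  then show ?case
    using steps_trans[OF r1(1) steps_trans[OF r2(1) steps_trans[OF r3 r4(1)]]] r4(2) by metis
next
  case (CondT s e c t s' d)
  let ?g = "compile_exp e 0"
  let ?c = "compile c (length p + length ?g + 1)"
  let ?d = "compile d (length p + length ?g + length ?c + 2)"
  let ?j = "JumpZero (tmp 0) (length p + length ?g + length ?c + 2)"
  let ?k = "Jump (length p + length ?g + length ?c + length ?d + 2)"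
  let ?P = "p @ compile (Cond e c d) (length p) @ q"
  have P: "?P = p @ ?g @ ?j # ?c @ ?k # ?d @ q" "?P = (p @ ?g @ [?j]) @ ?c @ (?k # ?d @ q)"
    "?P = (p @ ?g @ [?j] @ ?c) @ ?k # ?d @ q"
    by (simp_all add: Let_def)
  obtain r1 where r1: "steps ?P xs (length ?g + 1) (length p, r) = (length (p @ ?g @ [?j]), r1)"
    "represents r1 s"
    using steps_guard[OF CondT.prems, of p e "length p + length ?g + length ?c + 2" "?c @ ?k # ?d @ q" xs]
      CondT.hyps(1) unfolding P(1) by auto
  obtain r2 where r2: "steps ?P xs t (length (p @ ?g @ [?j]), r1) = (length (p @ ?g @ [?j] @ ?c), r2)"
    "represents r2 s'"
    unfolding P(2) using CondT.IH[OF r1(2), of "p @ ?g @ [?j]"] by (auto simp: add.assoc)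
  have r3: "steps ?P xs 1 (length (p @ ?g @ [?j] @ ?c), r2)
      = (length p + length (compile (Cond e c d) (length p)), r2)"
    unfolding P(3) steps_1 step_at[OF refl] by (simp add: Let_def)
  have "length ?g + t + 2 = length ?g + 1 + (t + 1)" by simp
  then show ?case using steps_trans[OF r1(1) steps_trans[OF r2(1) r3]] r2(2) by auto
next
  case (CondF s e d t s' c)
  let ?g = "compile_exp e 0"
  let ?c = "compile c (length p + length ?g + 1)"
  let ?d = "compile d (length p + length ?g + length ?c + 2)"
  let ?j = "JumpZero (tmp 0) (length p + length ?g + length ?c + 2)"
  let ?k = "Jump (length p + length ?g + length ?c + length ?d + 2)"
  let ?P = "p @ compile (Cond e c d) (length p) @ q" and ?p = "p @ ?g @ [?j] @ ?c @ [?k]"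
  have P: "?P = p @ ?g @ ?j # ?c @ ?k # ?d @ q" "?P = ?p @ ?d @ q"
    by (simp_all add: Let_def)
  obtain r1 where r1: "steps ?P xs (length ?g + 1) (length p, r) = (length ?p, r1)" "represents r1 s"
    using steps_guard[OF CondF.prems, of p e "length p + length ?g + length ?c + 2" "?c @ ?k # ?d @ q" xs]
      CondF.hyps(1) unfolding P(1) by auto
  obtain r2 where r2: "steps ?P xs t (length ?p, r1)
      = (length p + length (compile (Cond e c d) (length p)), r2)" "represents r2 s'"
    unfolding P(2) using CondF.IH[OF r1(2), of ?p] by (auto simp: add.assoc Let_def)
  have "length ?g + t + 1 = length ?g + 1 + t" by simp
  then show ?case using steps_trans[OF r1(1) r2(1)] r2(2) by auto
qed auto

lemma steps_halted: "length p \<le> fst c \<Longrightarrow> steps p xs t c = c"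
  by (induction t) (simp_all add: steps_Suc step_def)


fun csize :: "com \<Rightarrow> nat" where
  "csize (Assign x e) = length (assign_code x e)"
| "csize (Write a e f) = length (write_code a e f)"
| "csize (Seq c d) = csize c + csize d"
| "csize (While e c) = length (compile_exp e 0) + 2 + csize c"
| "csize (Cond e c d) = length (compile_exp e 0) + 2 + csize c + csize d"
| "csize Skip = 0"

text \<open>Running time is measured in units of the program size, so that the bound \<open>M\<close> is multiplicative
  in nested loops and does not change under sequential composition.\<close>

definition runs :: "nat list \<Rightarrow> com \<Rightarrow> state \<Rightarrow> nat \<Rightarrow> (state \<Rightarrow> bool) \<Rightarrow> bool" where
  "runs xs c s M Q \<longleftrightarrow> (\<exists>t s'. big_step xs c s t s' \<and> t \<le> csize c * M \<and> Q s')"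

text \<open>A halted configuration is fixed by further steps, so a bound on the time may replace the
  exact time.\<close>

lemma halts_within_compile:
  assumes "runs xs c (\<lambda>_. 0) M (\<lambda>s. s (Var 0) = out)" "csize c * M \<le> T"
  shows "halts_within (compile c 0) xs T out"
proof -
  obtain t s where ts: "big_step xs c (\<lambda>_. 0) t s" "t \<le> T" "s (Var 0) = out"
    using assms by (auto simp: runs_def)
  have "represents (\<lambda>_. 0) (\<lambda>_. 0)" by (simp add: represents_def)
  from compile_correct[OF ts(1) this, of "[]" "[]"] obtain r where
    r: "steps (compile c 0) xs t (0, \<lambda>_. 0) = (length (compile c 0), r)" "represents r s" by auto
  have "run (compile c 0) xs T = steps (compile c 0) xs (t + (T - t)) (0, \<lambda>_. 0)"
    using ts(2) by (simp add: run_def steps_def)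
  also have "\<dots> = (length (compile c 0), r)"
    unfolding steps_add r(1) by (rule steps_halted) simp
  finally show ?thesis
    using r(2) ts(3) by (auto simp: halts_within_def represents_def dest: spec[of _ "Var 0"])
qed

section \<open>Proof rules with time bounds\<close>

lemma runs_mono:
  assumes "runs xs c s M Q" "M \<le> M'" "\<And>s'. Q s' \<Longrightarrow> Q' s'"
  shows "runs xs c s M' Q'"
  using assms unfolding runs_def by (meson mult_le_mono2 order_trans)

lemma runs_Assign: "Q (s(Var x := eval xs s e)) \<Longrightarrow> 1 \<le> M \<Longrightarrow> runs xs (Assign x e) s M Q"
  unfolding runs_def
  by (intro exI[of _ "length (assign_code x e)"] exI[of _ "s(Var x := eval xs s e)"])
     (simp add: big_step.Assign)

lemma runs_Write:
  "Q (s(Arr a (eval xs s e) := eval xs s f)) \<Longrightarrow> 1 \<le> M \<Longrightarrow> runs xs (Write a e f) s M Q"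
  unfolding runs_def
  by (intro exI[of _ "length (write_code a e f)"] exI[of _ "s(Arr a (eval xs s e) := eval xs s f)"])
     (simp add: big_step.Write)

lemma runs_Skip: "Q s \<Longrightarrow> runs xs Skip s M Q"
  unfolding runs_def using big_step.Skip by fastforce

lemma runs_Seq:
  assumes "runs xs c s M R" "\<And>s'. R s' \<Longrightarrow> runs xs d s' M Q"
  shows "runs xs (Seq c d) s M Q"
proof -
  obtain t s' where 1: "big_step xs c s t s'" "t \<le> csize c * M" "R s'"
    using assms(1) by (auto simp: runs_def)
  obtain t' s'' where 2: "big_step xs d s' t' s''" "t' \<le> csize d * M" "Q s''"
    using assms(2)[OF 1(3)] by (auto simp: runs_def)
  show ?thesis unfolding runs_def using big_step.Seq[OF 1(1) 2(1)] 1(2) 2(2,3)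
    by (intro exI[of _ "t + t'"] exI[of _ s'']) (simp add: distrib_right)
qed

lemma runs_Assign_Seq:
  "runs xs d (s(Var x := eval xs s e)) M Q \<Longrightarrow> 1 \<le> M \<Longrightarrow> runs xs (Seq (Assign x e) d) s M Q"
  by (rule runs_Seq[OF runs_Assign[where Q = "\<lambda>s'. s' = s(Var x := eval xs s e)"]]) auto

lemma runs_Write_Seq:
  "runs xs d (s(Arr a (eval xs s e) := eval xs s f)) M Q \<Longrightarrow> 1 \<le> M \<Longrightarrow>
     runs xs (Seq (Write a e f) d) s M Q"
  by (rule runs_Seq[OF runs_Write[where Q = "\<lambda>s'. s' = s(Arr a (eval xs s e) := eval xs s f)"]]) auto

lemma runs_Cond:
  assumes "eval xs s e \<noteq> 0 \<Longrightarrow> runs xs c s M Q" "eval xs s e = 0 \<Longrightarrow> runs xs d s M Q" "1 \<le> M"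
  shows "runs xs (Cond e c d) s M Q"
proof -
  have g: "length (compile_exp e 0) + 2 \<le> (length (compile_exp e 0) + 2) * M"
    using mult_le_mono2[OF assms(3), of "length (compile_exp e 0) + 2"] by simp
  show ?thesis
  proof (cases "eval xs s e = 0")
    case True
    then obtain t s' where t: "big_step xs d s t s'" "t \<le> csize d * M" "Q s'"
      using assms(2) by (auto simp: runs_def)
    have "length (compile_exp e 0) + t + 1 \<le> csize (Cond e c d) * M"
      using g t(2) by (simp add: distrib_right)
    then show ?thesis unfolding runs_def using big_step.CondF[OF True t(1)] t(3) by blast
  next
    case False
    then obtain t s' where t: "big_step xs c s t s'" "t \<le> csize c * M" "Q s'"
      using assms(1) by (auto simp: runs_def)
    have "length (compile_exp e 0) + t + 2 \<le> csize (Cond e c d) * M"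
      using g t(2) by (simp add: distrib_right)
    then show ?thesis unfolding runs_def using big_step.CondT[OF False t(1)] t(3) by blast
  qed
qed

text \<open>\<open>n\<close> rounds and the final failing test of the guard make n + 1 units, hence
  the strict bound \<open>n < B\<close>.\<close>

lemma runs_While:
  assumes "J 0 s"
    and "\<And>i s. i < n \<Longrightarrow> J i s \<Longrightarrow> eval xs s e \<noteq> 0 \<and> runs xs c s M (J (Suc i))"
    and "\<And>s. J n s \<Longrightarrow> eval xs s e = 0 \<and> Q s"
    and "n < B" "1 \<le> M"
  shows "runs xs (While e c) s (B * M) Q"
proof -
  let ?T = "csize c * M + length (compile_exp e 0) + 2"
  have "\<exists>t s'. big_step xs (While e c) s t s' \<and> t \<le> (n - i + 1) * ?T \<and> Q s'"
    if "J i s" "i \<le> n" for i s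
    using that
  proof (induction "n - i" arbitrary: i s)
    case 0
    then have "eval xs s e = 0" "Q s" using assms(3) by auto
    then show ?case using big_step.WhileF[of xs s e c] 0
      by (intro exI[of _ "length (compile_exp e 0) + 1"] exI[of _ s]) auto
  next
    case (Suc m)
    then have "i < n" by simp
    with assms(2)[OF this Suc.prems(1)] obtain t s' where 1: "eval xs s e \<noteq> 0"
      "big_step xs c s t s'" "t \<le> csize c * M" "J (Suc i) s'" by (auto simp: runs_def)
    have "m = n - Suc i" "Suc i \<le> n" using Suc.hyps(2) \<open>i < n\<close> by auto
    from Suc.hyps(1)[OF this(1) 1(4) this(2)] obtain t' s'' where
      2: "big_step xs (While e c) s' t' s''" "t' \<le> (n - Suc i + 1) * ?T" "Q s''" by blast
    have "(n - i + 1) * ?T = (n - Suc i + 1) * ?T + ?T"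
      using \<open>i < n\<close> by (metis Suc_diff_Suc Suc_eq_plus1 add.commute mult_Suc)
    then have "length (compile_exp e 0) + t + t' + 2 \<le> (n - i + 1) * ?T" using 1(3) 2(2) by linarith
    then show ?case using big_step.WhileT[OF 1(1,2) 2(1)] 2(3) by blast
  qed
  from this[of 0 s] assms(1) obtain t s' where
    t: "big_step xs (While e c) s t s'" "t \<le> (n + 1) * ?T" "Q s'" by auto
  have "?T \<le> csize (While e c) * M"
    using mult_le_mono2[OF assms(5), of "length (compile_exp e 0) + 2"] by (simp add: distrib_right)
  then have "(n + 1) * ?T \<le> B * (csize (While e c) * M)"
    using assms(4) by (intro mult_le_mono) simp_all
  then have "t \<le> csize (While e c) * (B * M)" using t(2) by (simp add: mult.left_commute del: csize.simps)
  then show ?thesis unfolding runs_def using t by blast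
qed

text \<open>Loops over fixed lists are unrolled into the program, so they enlarge its size but cost
  no factor in the time bound \<open>M\<close>.\<close>

fun seqs :: "com list \<Rightarrow> com" where
  "seqs [] = Skip"
| "seqs (c # cs) = Seq c (seqs cs)"

lemma runs_seqs:
  assumes "J [] s" "\<And>ys y s. J ys s \<Longrightarrow> y \<in> set zs \<Longrightarrow> runs xs (f y) s M (J (ys @ [y]))"
  shows "runs xs (seqs (map f zs)) s M (J zs)"
proof -
  have "runs xs (seqs (map f us)) s M (J (ys @ us))" if "J ys s" "set us \<subseteq> set zs" for us ys s
    using that
  proof (induction us arbitrary: ys s)
    case Nil
    then show ?case by (simp add: runs_Skip)
  next
    case (Cons u us)
    have "runs xs (f u) s M (J (ys @ [u]))" using assms(2) Cons.prems by simp
    moreover have "runs xs (seqs (map f us)) s' M (J (ys @ u # us))" if "J (ys @ [u]) s'" for s'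
      using Cons.IH[OF that] Cons.prems(2) by simp
    ultimately show ?case by (simp add: runs_Seq)
  qed
  from this[of "[]" s zs] assms(1) show ?thesis by simp
qed

section \<open>The algorithm\<close>

text \<open>Multiplication by a constant, unrolled into additions.\<close>

fun scaled :: "nat \<Rightarrow> exp \<Rightarrow> exp" where
  "scaled 0 e = N 0"
| "scaled (Suc t) e = Plus e (scaled t e)"

lemma eval_scaled [simp]: "eval xs s (scaled t e) = t * eval xs s e"
  by (induction t) simp_all

text \<open>A Horner scheme in base 4, which the machine can build digit by digit while it scans a
  scope.\<close>

definition label_code :: "nat list \<Rightarrow> nat" where
  "label_code ls = foldl (\<lambda>l x. x + 4 * l) 1 ls"

lemma foldl_label_inj:
  assumes "foldl (\<lambda>l x. x + 4 * l) a ls = foldl (\<lambda>l x. x + 4 * l) b ms" "length ls = length ms"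
    "\<forall>x\<in>set ls. x < 4" "\<forall>x\<in>set ms. x < (4 :: nat)"
  shows "a = b \<and> ls = ms"
  using assms(2,1,3,4)
proof (induction ls ms arbitrary: a b rule: list_induct2)
  case (Cons x ls y ms)
  then have "x + 4 * a = y + 4 * b" "ls = ms" by auto
  moreover have "x < 4" "y < 4" using Cons.prems by auto
  ultimately have "a = b" "x = y" by presburger+
  with \<open>ls = ms\<close> show ?case by simp
qed simp

definition all_labels :: "nat \<Rightarrow> nat list list" where
  "all_labels n = List.n_lists n [0..<4]"

lemma set_all_labels: "set (all_labels n) = {ls. length ls = n \<and> (\<forall>x\<in>set ls. x < 4)}"
  by (auto simp: all_labels_def set_n_lists)

lemma distinct_all_labels: "distinct (all_labels n)"
  by (simp add: all_labels_def distinct_n_lists)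

text \<open>The function \<open>t\<close> on predicates in \<open>Ps\<close> and labels below 4, as
  a finite list independent of the instance.\<close>

definition entries ::
  "(predicate \<Rightarrow> nat) \<Rightarrow> predicate list \<Rightarrow> (predicate \<Rightarrow> nat list \<Rightarrow> nat) \<Rightarrow> (nat \<times> nat \<times> nat) list" where
  "entries code Ps t =
     concat (map (\<lambda>P. map (\<lambda>ls. (code P, label_code ls, t P ls)) (all_labels (fst P))) Ps)"

definition entry_value :: "nat \<Rightarrow> nat \<Rightarrow> nat \<times> nat \<times> nat \<Rightarrow> nat" where
  "entry_value c l en = (case en of (c', l', t) \<Rightarrow> if c' = c \<and> l' = l then t else 0)"

lemma sum_list_if_eq:
  assumes "distinct xs" "x \<in> set xs"
  shows "(\<Sum>y\<leftarrow>xs. if y = x then f y else 0) = (f x :: nat)"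
  using assms by (simp add: sum_list_distinct_conv_sum_set)

text \<open>Codes of predicates and of label lists of equal length are injective, so exactly one
  entry matches. The sum over all entries is the form in which \<open>lookup\<close>
  accumulates.\<close>

lemma entries_value:
  assumes "distinct Ps" "P \<in> set Ps" "inj_on code (set Ps)" "length ls = fst P" "\<forall>x\<in>set ls. x < 4"
  shows "(\<Sum>en\<leftarrow>entries code Ps t. entry_value (code P) (label_code ls) en) = t P ls"
proof -
  have "(\<Sum>en\<leftarrow>entries code Ps t. entry_value (code P) (label_code ls) en)
      = (\<Sum>Q\<leftarrow>Ps. \<Sum>ms\<leftarrow>all_labels (fst Q). if code Q = code P \<and> label_code ms = label_code ls then t Q ms else 0)"
    unfolding entries_def by (induction Ps) (simp_all add: comp_def entry_value_def)
  also have "\<dots> = (\<Sum>Q\<leftarrow>Ps. if Q = P then t P ls else 0)"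
  proof (intro arg_cong[of _ _ sum_list] map_cong refl)
    fix Q assume Q: "Q \<in> set Ps"
    show "(\<Sum>ms\<leftarrow>all_labels (fst Q). if code Q = code P \<and> label_code ms = label_code ls then t Q ms else 0)
        = (if Q = P then t P ls else 0)"
    proof (cases "Q = P")
      case True
      have "(\<Sum>ms\<leftarrow>all_labels (fst P). if label_code ms = label_code ls then t P ms else 0)
          = (\<Sum>ms\<leftarrow>all_labels (fst P). if ms = ls then t P ms else 0)"
      proof (intro arg_cong[of _ _ sum_list] map_cong refl)
        fix ms assume "ms \<in> set (all_labels (fst P))"
        then have "label_code ms = label_code ls \<longleftrightarrow> ms = ls"
          using foldl_label_inj[of 1 ms 1 ls] assms(4,5) by (auto simp: set_all_labels label_code_def)
        then show "(if label_code ms = label_code ls then t P ms else 0) = (if ms = ls then t P ms else 0)"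
          by simp
      qed
      also have "\<dots> = t P ls"
        by (rule sum_list_if_eq[OF distinct_all_labels]) (use assms in \<open>simp add: set_all_labels\<close>)
      finally show ?thesis unfolding True by simp
    next
      case False
      then have "code Q \<noteq> code P" using assms(2,3) Q by (simp add: inj_on_eq_iff)
      then show ?thesis using False by simp
    qed
  qed
  also have "\<dots> = t P ls" by (rule sum_list_if_eq[OF assms(1,2), of "\<lambda>_. t P ls"])
  finally show ?thesis .
qed

section \<open>Evaluating a table sum on the machine\<close>

abbreviation (input) "vAcc \<equiv> 2 :: nat"
abbreviation (input) "vPos \<equiv> 3 :: nat"
abbreviation (input) "vCount \<equiv> 4 :: nat"
abbreviation (input) "vCode \<equiv> 5 :: nat"
abbreviation (input) "vArity \<equiv> 6 :: nat"
abbreviation (input) "vLabels \<equiv> 7 :: nat"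
abbreviation (input) "vWeight \<equiv> 8 :: nat"

text \<open>An equality test under truncated subtraction: one of the two differences is always
  0.\<close>

definition distance :: "exp \<Rightarrow> exp \<Rightarrow> exp" where
  "distance e f = Plus (Minus e f) (Minus f e)"

lemma eval_distance [simp]: "eval xs s (distance e f) = 0 \<longleftrightarrow> eval xs s e = eval xs s f"
  by (auto simp: distance_def)

definition lookup :: "(nat \<times> nat \<times> nat) list \<Rightarrow> com" where
  "lookup tab = seqs (map (\<lambda>(c, l, t). Cond (Plus (distance (V vCode) (N c)) (distance (V vLabels) (N l))) Skip
     (Assign vAcc (Plus (V vAcc) (scaled t (V vWeight))))) tab)"

lemma lookup_runs:
  assumes "1 \<le> M"
  shows "runs xs (lookup tab) s M (\<lambda>s'. s' = s(Var vAcc := s (Var vAcc) +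
     s (Var vWeight) * (\<Sum>en\<leftarrow>tab. entry_value (s (Var vCode)) (s (Var vLabels)) en)))"
proof -
  let ?J = "\<lambda>ys s'. s' = s(Var vAcc := s (Var vAcc) +
     s (Var vWeight) * (\<Sum>en\<leftarrow>ys. entry_value (s (Var vCode)) (s (Var vLabels)) en))"
  show ?thesis unfolding lookup_def
  proof (rule runs_seqs[where J = ?J])
    fix ys en s' assume s': "?J ys s'" and "en \<in> set tab"
    obtain c l t where en: "en = (c, l, t)" by (cases en) auto
    show "runs xs (case en of (c, l, t) \<Rightarrow> Cond (Plus (distance (V vCode) (N c)) (distance (V vLabels) (N l))) Skip
       (Assign vAcc (Plus (V vAcc) (scaled t (V vWeight))))) s' M (?J (ys @ [en]))"
      unfolding en prod.case
    proof (rule runs_Cond)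
      assume "eval xs s' (Plus (distance (V vCode) (N c)) (distance (V vLabels) (N l))) \<noteq> 0"
      then show "runs xs Skip s' M (?J (ys @ [(c, l, t)]))"
        using s' by (intro runs_Skip) (auto simp: entry_value_def)
    next
      assume "eval xs s' (Plus (distance (V vCode) (N c)) (distance (V vLabels) (N l))) = 0"
      then show "runs xs (Assign vAcc (Plus (V vAcc) (scaled t (V vWeight)))) s' M (?J (ys @ [(c, l, t)]))"
        using s' assms by (intro runs_Assign) (auto simp: entry_value_def distrib_left)
    qed (rule assms)
  qed simp
qed

text \<open>Program variables are numbered from the innermost subprogram outwards, so that a bound
  on the index separates scratch variables from those of the callers.\<close>

definition frame :: "nat \<Rightarrow> state \<Rightarrow> state \<Rightarrow> bool" where
  "frame n s s' \<longleftrightarrow> (\<forall>a i. s' (Arr a i) = s (Arr a i)) \<and> (\<forall>x\<ge>n. s' (Var x) = s (Var x))"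

definition labels_body :: com where
  "labels_body =
     Assign vLabels (Plus (A Label (In (V vPos))) (scaled 4 (V vLabels))) ;;
     Assign vPos (Plus (V vPos) (N 1)) ;;
     Assign vArity (Minus (V vArity) (N 1))"

definition constraint_com :: "(nat \<times> nat \<times> nat) list \<Rightarrow> com" where
  "constraint_com tab =
     Assign vCount (Minus (V vCount) (N 1)) ;;
     Assign vCode (In (V vPos)) ;;
     Assign vArity (In (Plus (V vPos) (N 1))) ;;
     Assign vPos (Plus (V vPos) (N 2)) ;;
     Assign vLabels (N 1) ;;
     While (V vArity) labels_body ;;
     Assign vWeight (In (V vPos)) ;;
     Assign vPos (Plus (V vPos) (N 1)) ;;
     lookup tab"

text \<open>Input entry 0 is the parameter and entry 1 the number n of variables, so entry n + 2
  counts the constraints and the first of them starts at n + 3.\<close>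

definition table_sum_com :: "(nat \<times> nat \<times> nat) list \<Rightarrow> com" where
  "table_sum_com tab =
     Assign vAcc (N 0) ;;
     Assign vPos (Plus (In (N 1)) (N 3)) ;;
     Assign vCount (In (Plus (In (N 1)) (N 2))) ;;
     While (V vCount) (constraint_com tab)"

lemma read_input_drop: "drop i xs = y # ys \<Longrightarrow> read_input xs i = y \<and> drop (Suc i) xs = ys"
  by (metis drop_Suc drop_eq_Nil list.distinct(1) list.sel(1,3) hd_drop_conv_nth linorder_not_le
      read_input_def tl_drop)

lemma encode_read:
  shows "read_input (encode code I) 0 = param I"
    and "read_input (encode code I) 1 = length (vars I)"
    and "i < length (vars I) \<Longrightarrow> read_input (encode code I) (i + 2) = vars I ! i"
    and "read_input (encode code I) (length (vars I) + 2) = length (constrs I)"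
    and "drop (length (vars I) + 3) (encode code I) = concat (map (enc_constr code) (constrs I))"
  by (auto simp: read_input_def encode_def nth_append numeral_eq_Suc)

definition insize :: "(predicate \<Rightarrow> nat) \<Rightarrow> inst \<Rightarrow> nat" where
  "insize code I = bit_size (encode code I)"

lemma length_le_bit_size: "length xs \<le> bit_size xs"
  by (induction xs) (simp_all add: bit_size_def)

lemma length_concat_ge:
  assumes "\<forall>x\<in>set xs. 1 \<le> length (f x)"
  shows "length xs \<le> length (concat (map f xs))"
  using assms by (induction xs) auto

lemma insize_ge:
  "length (vars I) < insize code I" "length (constrs I) < insize code I" "1 \<le> insize code I"
proof -
  have "length (constrs I) \<le> length (concat (map (enc_constr code) (constrs I)))"
    by (rule length_concat_ge) (simp add: enc_constr_def)
  then have "length (vars I) + length (constrs I) + 3 \<le> length (encode code I)"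
    by (simp add: encode_def)
  then have "length (vars I) + length (constrs I) + 3 \<le> insize code I"
    unfolding insize_def using length_le_bit_size[of "encode code I"] by linarith
  then show "length (vars I) < insize code I" "length (constrs I) < insize code I" "1 \<le> insize code I"
    by auto
qed

locale encoded_instance = csp_instance +
  fixes code :: "predicate \<Rightarrow> nat" and Ps :: "predicate list"
  assumes Ps: "distinct Ps" "set Ps = PP" and code: "inj_on code PP"
begin

abbreviation "xs \<equiv> encode code I"
abbreviation "B \<equiv> insize code I"
abbreviation "tsum t \<equiv> table_sum_com (entries code Ps t)"

text \<open>A scope has at most three elements, so with the final test the factor 4
  suffices.\<close>

lemma labels_loop_runs:
  assumes "drop (s (Var vPos)) xs = S @ rest" "s (Var vArity) = length S" "s (Var vLabels) = 1" "length S \<le> 3"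
  shows "runs xs (While (V vArity) labels_body) s (4 * 1)
     (\<lambda>s'. \<exists>p. s' = s(Var vLabels := label_code (map (\<lambda>v. s (Arr Label v)) S), Var vPos := p, Var vArity := 0)
        \<and> drop p xs = rest)"
proof -
  let ?J = "\<lambda>i s'. \<exists>p. s' = s(Var vLabels := label_code (map (\<lambda>v. s (Arr Label v)) (take i S)),
             Var vPos := p, Var vArity := length S - i) \<and> drop p xs = drop i S @ rest"
  show ?thesis
  proof (rule runs_While[where n = "length S" and J = ?J])
    show "?J 0 s"
      using assms by (intro exI[of _ "s (Var vPos)"]) (simp add: label_code_def fun_eq_iff)
  next
    fix i s' assume i: "i < length S" and "?J i s'"
    then obtain p where s': "s' = s(Var vLabels := label_code (map (\<lambda>v. s (Arr Label v)) (take i S)),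
               Var vPos := p, Var vArity := length S - i)" "drop p xs = drop i S @ rest" by blast
    have "drop p xs = S ! i # (drop (Suc i) S @ rest)"
      unfolding s'(2) using i by (simp flip: Cons_nth_drop_Suc)
    from read_input_drop[OF this] have p: "read_input xs p = S ! i" "drop (Suc p) xs = drop (Suc i) S @ rest"
      by auto
    have lc: "label_code (map (\<lambda>v. s (Arr Label v)) (take (Suc i) S))
        = s (Arr Label (S ! i)) + 4 * label_code (map (\<lambda>v. s (Arr Label v)) (take i S))"
      using i by (simp add: take_Suc_conv_app_nth label_code_def)
    have "runs xs labels_body s' 1 (?J (Suc i))"
      unfolding labels_body_def
      by (intro runs_Assign_Seq runs_Assign exI[of _ "Suc p"]) (use p in \<open>auto simp: s'(1) fun_eq_iff lc\<close>)
    then show "eval xs s' (V vArity) \<noteq> 0 \<and> runs xs labels_body s' 1 (?J (Suc i))"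
      using i s' by simp
  qed (use assms in auto)
qed

text \<open>The invariant describes the unread input as the encoding of the remaining constraints,
  which avoids computing read positions.\<close>

lemma table_sum_runs:
  assumes "\<And>v. s (Arr Label v) < 4"
  shows "runs xs (tsum t) s (4 * B) (\<lambda>s'. frame 9 s s' \<and>
     s' (Var vAcc) = table_sum t I (\<lambda>v. s (Arr Label v)))"
proof -
  let ?Cs = "constrs I" and ?h = "\<lambda>v. s (Arr Label v)" and ?tab = "entries code Ps t"
  let ?term = "\<lambda>C. weight C * t (pred C) (map ?h (scope C))"
  have B: "1 \<le> 4 * B" using insize_ge(3)[of code I] by simp
  let ?J = "\<lambda>i s'. frame 9 s s' \<and> s' (Var vCount) = length ?Cs - i \<and>
     s' (Var vAcc) = (\<Sum>C\<leftarrow>take i ?Cs. ?term C) \<and>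
     drop (s' (Var vPos)) xs = concat (map (enc_constr code) (drop i ?Cs))"
  have step: "runs xs (constraint_com ?tab) s' 4 (?J (Suc i))" if i: "i < length ?Cs" and J: "?J i s'" for i s'
  proof -
    define C where "C = ?Cs ! i"
    have C: "C \<in> set ?Cs" using i by (simp add: C_def)
    define p where "p = s' (Var vPos)"
    define rest where "rest = concat (map (enc_constr code) (drop (Suc i) ?Cs))"
    have "drop p xs = code (pred C) # (length (scope C) # scope C @ weight C # rest)"
      using J i unfolding p_def rest_def C_def by (simp add: enc_constr_def flip: Cons_nth_drop_Suc)
    from read_input_drop[OF this] have p0: "read_input xs p = code (pred C)"
      and "drop (Suc p) xs = length (scope C) # (scope C @ weight C # rest)" by auto
    from read_input_drop[OF this(2)] have p1: "read_input xs (Suc p) = length (scope C)"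
      and p2: "drop (Suc (Suc p)) xs = scope C @ weight C # rest" by auto
    define s1 where "s1 = s'(Var vCount := length ?Cs - Suc i, Var vCode := code (pred C),
       Var vArity := length (scope C), Var vPos := Suc (Suc p), Var vLabels := 1)"
    have h: "s' (Arr Label v) = ?h v" for v using J by (simp add: frame_def)
    let ?R = "\<lambda>s2. \<exists>p'. s2 = s1(Var vLabels := label_code (map ?h (scope C)), Var vPos := p', Var vArity := 0)
          \<and> drop p' xs = weight C # rest"
    have loop: "runs xs (While (V vArity) labels_body) s1 (4 * 1) ?R"
      using labels_loop_runs[of s1 "scope C" "weight C # rest"] p2 constrD(1,5)[OF C]
      by (simp add: s1_def h)
    have "runs xs (Assign vWeight (In (V vPos)) ;; Assign vPos (Plus (V vPos) (N 1)) ;; lookup ?tab) s2 4 (?J (Suc i))"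
      if "?R s2" for s2
    proof -
      from that obtain p' where s2: "s2 = s1(Var vLabels := label_code (map ?h (scope C)), Var vPos := p', Var vArity := 0)"
        "drop p' xs = weight C # rest" by blast
      from read_input_drop[OF s2(2)] have p': "read_input xs p' = weight C" "drop (Suc p') xs = rest" by auto
      have PC: "pred C \<in> PP" using C inst by (auto simp: instances_def wf_constr_def)
      have ent: "(\<Sum>en\<leftarrow>?tab. entry_value (code (pred C)) (label_code (map ?h (scope C))) en)
          = t (pred C) (map ?h (scope C))"
        by (rule entries_value) (use Ps code PC constrD(1)[OF C] assms in auto)
      have take: "(\<Sum>C\<leftarrow>take (Suc i) ?Cs. ?term C) = (\<Sum>C\<leftarrow>take i ?Cs. ?term C) + ?term C"
        using i by (simp add: take_Suc_conv_app_nth C_def)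
      show ?thesis
        by (intro runs_Assign_Seq, rule runs_mono[OF lookup_runs order_refl])
           (use J p' in \<open>auto simp: s2(1) s1_def ent take frame_def rest_def\<close>)
    qed
    note rest_runs = runs_Seq[OF loop[unfolded mult_1_right] this]
    have s1': "s1 = s'(Var vCount := eval xs s' (Minus (V vCount) (N 1)),
       Var vCode := read_input xs p, Var vArity := read_input xs (p + 1), Var vPos := p + 2, Var vLabels := 1)"
      using J by (simp add: s1_def p0 p1)
    show ?thesis unfolding constraint_com_def
      by (intro runs_Assign_Seq) (use rest_runs in \<open>simp_all add: s1' p_def\<close>)
  qed
  have loop: "runs xs (While (V vCount) (constraint_com ?tab)) s0 (B * 4)
      (\<lambda>s'. frame 9 s s' \<and> s' (Var vAcc) = table_sum t I ?h)" if "?J 0 s0" for s0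
  proof (rule runs_While[where J = ?J and n = "length ?Cs"])
    show "?J 0 s0" by fact
  next
    fix i s' assume "i < length ?Cs" "?J i s'"
    then show "eval xs s' (V vCount) \<noteq> 0 \<and> runs xs (constraint_com ?tab) s' 4 (?J (Suc i))"
      using step by simp
  next
    fix s' assume "?J (length ?Cs) s'"
    then show "eval xs s' (V vCount) = 0 \<and> frame 9 s s' \<and> s' (Var vAcc) = table_sum t I ?h"
      by (simp add: table_sum_def)
  qed (use insize_ge(2)[of I code] in auto)
  show ?thesis
    unfolding table_sum_com_def mult.commute[of 4]
    by (intro runs_Assign_Seq B[unfolded mult.commute[of 4]] loop)
       (use encode_read[where code = code and I = I] in \<open>simp add: frame_def\<close>)
qed

lemma table_sum_runs':
  assumes "\<And>v. s (Arr Label v) = h v" "\<And>v. h v < 4"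
  shows "runs xs (tsum t) s (4 * B) (\<lambda>s'. frame 9 s s' \<and> s' (Var vAcc) = table_sum t I h)"
proof -
  have "(\<lambda>v. s (Arr Label v)) = h" using assms(1) by (rule ext)
  then show ?thesis using table_sum_runs[of s t] assms by simp
qed

end

section \<open>Finding the essential variables\<close>

abbreviation (input) "vSave \<equiv> 9 :: nat"
abbreviation (input) "vDiff \<equiv> 10 :: nat"
abbreviation (input) "vI3 \<equiv> 11 :: nat"
abbreviation (input) "vW \<equiv> 12 :: nat"
abbreviation (input) "vI2 \<equiv> 13 :: nat"
abbreviation (input) "vU \<equiv> 14 :: nat"
abbreviation (input) "vI \<equiv> 15 :: nat"
abbreviation (input) "vV \<equiv> 16 :: nat"
abbreviation (input) "vEss \<equiv> 17 :: nat"
abbreviation (input) "vRest \<equiv> 18 :: nat"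

text \<open>Writing in the order w, u, v reproduces the nested updates in \<open>essential\<close>,
  where a later write wins if variables coincide. All three labels are 0 again at the end, ready for
  the next test.\<close>

definition test_com :: "com \<Rightarrow> nat \<Rightarrow> nat \<Rightarrow> nat \<Rightarrow> com" where
  "test_com sm p q r =
     Write Label (V vW) (N r) ;; Write Label (V vU) (N q) ;; Write Label (V vV) (N p) ;;
     sm ;; Assign vSave (V vAcc) ;; Write Label (V vV) (N 0) ;;
     sm ;; Assign vDiff (Plus (V vDiff) (distance (V vSave) (V vAcc))) ;;
     Write Label (V vU) (N 0) ;; Write Label (V vW) (N 0)"

text \<open>Counting down makes \<open>i\<close> both the loop guard and the index. Variables are
  visited from last to first, which explains \<open>rev\<close> in \<open>es\<close> and
  \<open>nes\<close>.\<close>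

definition for_vars :: "nat \<Rightarrow> nat \<Rightarrow> com \<Rightarrow> com" where
  "for_vars i x c =
     Assign i (In (N 1)) ;;
     While (V i) (Assign i (Minus (V i) (N 1)) ;; Assign x (In (Plus (V i) (N 2))) ;; c)"

definition combos :: "(nat \<times> nat \<times> nat) list" where
  "combos = List.product [0..<4] (List.product [0..<4] [0..<4])"

definition test_loop_com :: "com \<Rightarrow> com" where
  "test_loop_com sm = for_vars vI3 vW (seqs (map (\<lambda>(p, q, r). test_com sm p q r) combos))"

definition test_var_com :: "com \<Rightarrow> com" where
  "test_var_com sm = Assign vDiff (N 0) ;; for_vars vI2 vU (test_loop_com sm)"

definition essential_com :: "com \<Rightarrow> com" where
  "essential_com sm = for_vars vI vV (
     test_var_com sm ;;
     Cond (V vDiff)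
       (Write Ess (V vEss) (V vV) ;; Assign vEss (Plus (V vEss) (N 1)))
       (Write Rest (V vRest) (V vV) ;; Assign vRest (Plus (V vRest) (N 1))))"

text \<open>Labels are asserted to be 0 rather than unchanged, the state in which each test starts
  and ends.\<close>

definition frame0 :: "nat \<Rightarrow> state \<Rightarrow> state \<Rightarrow> bool" where
  "frame0 n s s' \<longleftrightarrow> (\<forall>i. s' (Arr Label i) = 0) \<and>
     (\<forall>a i. a \<noteq> Label \<longrightarrow> s' (Arr a i) = s (Arr a i)) \<and> (\<forall>x\<ge>n. s' (Var x) = s (Var x))"

definition stores :: "state \<Rightarrow> aid \<Rightarrow> nat list \<Rightarrow> bool" where
  "stores s a ys \<longleftrightarrow> (\<forall>i<length ys. s (Arr a i) = ys ! i)"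

lemma stores_append: "stores s a ys \<Longrightarrow> stores (s(Arr a (length ys) := y)) a (ys @ [y])"
  by (auto simp: stores_def nth_append less_Suc_eq)

context encoded_instance
begin

abbreviation "smG \<equiv> tsum bucket_table"

lemma B1: "1 \<le> B" "1 \<le> 4 * B" "1 \<le> B * (4 * B)" "1 \<le> B * (B * (4 * B))"
  using insize_ge(3)[of code I] by simp_all

definition same_G :: "nat \<Rightarrow> nat \<Rightarrow> nat \<Rightarrow> nat \<times> nat \<times> nat \<Rightarrow> bool" where
  "same_G v u w pqr = (case pqr of (p, q, r) \<Rightarrow>
     G ((\<lambda>_. 0)(w := r, u := q, v := p)) = G ((\<lambda>_. 0)(w := r, u := q, v := 0)))"

lemma test_com_runs:
  assumes "\<And>i. s (Arr Label i) = 0" "p < 4" "q < 4" "r < 4"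
  shows "runs xs (test_com smG p q r) s (4 * B) (\<lambda>s'. frame0 11 s s' \<and>
     (s' (Var vDiff) = 0 \<longleftrightarrow> s (Var vDiff) = 0 \<and> same_G (s (Var vV)) (s (Var vU)) (s (Var vW)) (p, q, r)))"
proof -
  let ?v = "s (Var vV)" and ?u = "s (Var vU)" and ?w = "s (Var vW)"
  let ?h = "(\<lambda>_. 0)(?w := r, ?u := q, ?v := p)"
  define s1 where "s1 = s(Arr Label ?w := r, Arr Label ?u := q, Arr Label ?v := p)"
  have s1: "s1 (Arr Label i) = ?h i" for i using assms by (simp add: s1_def)
  have sum1: "runs xs smG s1 (4 * B) (\<lambda>s'. frame 9 s1 s' \<and> s' (Var vAcc) = G ?h)"
    by (rule table_sum_runs') (use s1 assms in simp_all)
  have rest: "runs xs (Assign vSave (V vAcc) ;; Write Label (V vV) (N 0) ;;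
     smG ;; Assign vDiff (Plus (V vDiff) (distance (V vSave) (V vAcc))) ;;
     Write Label (V vU) (N 0) ;; Write Label (V vW) (N 0)) s2 (4 * B)
     (\<lambda>s'. frame0 11 s s' \<and>
     (s' (Var vDiff) = 0 \<longleftrightarrow> s (Var vDiff) = 0 \<and> same_G ?v ?u ?w (p, q, r)))"
    if s2: "frame 9 s1 s2 \<and> s2 (Var vAcc) = G ?h" for s2
  proof -
    define s3 where "s3 = s2(Var vSave := G ?h, Arr Label ?v := 0)"
    have s3: "s3 (Arr Label i) = (?h(?v := 0)) i" for i using s2 by (simp add: s3_def frame_def s1)
    have sum2: "runs xs smG s3 (4 * B) (\<lambda>s'. frame 9 s3 s' \<and> s' (Var vAcc) = G (?h(?v := 0)))"
      by (rule table_sum_runs') (use s3 assms in simp_all)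
    have v2: "s2 (Var vV) = ?v" using s2 by (simp add: frame_def s1_def)
    have "runs xs (Assign vDiff (Plus (V vDiff) (distance (V vSave) (V vAcc))) ;;
       Write Label (V vU) (N 0) ;; Write Label (V vW) (N 0)) s4 (4 * B)
       (\<lambda>s'. frame0 11 s s' \<and>
       (s' (Var vDiff) = 0 \<longleftrightarrow> s (Var vDiff) = 0 \<and> same_G ?v ?u ?w (p, q, r)))"
      if s4: "frame 9 s3 s4 \<and> s4 (Var vAcc) = G (?h(?v := 0))" for s4
    proof -
      have "s4 (Arr Label i) = (?h(?v := 0)) i" for i using s4 s3 by (simp add: frame_def)
      moreover have "s4 (Var x) = s (Var x)" if "x > 9" for x
        using s4 s2 that by (simp add: frame_def s3_def s1_def)
      moreover have "s4 (Var vSave) = G ?h" using s4 by (simp add: frame_def s3_def)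
      moreover have "s4 (Arr a i) = s (Arr a i)" if "a \<noteq> Label" for a i
        using s4 s2 that by (simp add: frame_def s3_def s1_def)
      ultimately show ?thesis
        by (intro runs_Assign_Seq runs_Write_Seq runs_Write B1)
           (use s4 in \<open>auto simp: frame0_def same_G_def\<close>)
    qed
    note R = runs_Seq[OF sum2 this]
    show ?thesis
      by (intro runs_Assign_Seq runs_Write_Seq B1)
         (use R s2 v2 in \<open>simp add: s3_def\<close>)
  qed
  note R = runs_Seq[OF sum1 rest]
  show ?thesis unfolding test_com_def
    by (intro runs_Write_Seq B1) (use R in \<open>simp add: s1_def\<close>)
qed

definition all_same :: "nat \<Rightarrow> nat \<Rightarrow> nat \<Rightarrow> bool" where
  "all_same v u w \<longleftrightarrow> (\<forall>c\<in>set combos. same_G v u w c)"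

lemma for_vars_runs:
  assumes "i \<noteq> x" "1 \<le> M" "J [] (s(Var i := length (vars I)))"
    and step: "\<And>v vs t k. J vs t \<Longrightarrow> v \<in> VV \<Longrightarrow>
      runs xs c (t(Var i := k, Var x := v)) M (\<lambda>t'. J (v # vs) t' \<and> t' (Var i) = k)"
  shows "runs xs (for_vars i x c) s (B * M) (J (vars I))"
proof -
  let ?n = "length (vars I)"
  let ?J = "\<lambda>j t. J (drop (?n - j) (vars I)) t \<and> t (Var i) = ?n - j"
  let ?body = "Assign i (Minus (V i) (N 1)) ;; Assign x (In (Plus (V i) (N 2))) ;; c"
  have BM: "1 \<le> B * M" using assms(2) B1(1) by simp
  show ?thesis unfolding for_vars_def
  proof (intro runs_Assign_Seq BM, rule runs_While[where J = ?J and n = ?n])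
    show "?J 0 (s(Var i := eval xs s (In (N 1))))"
      using assms(3) encode_read(2)[of code I] by simp
  next
    fix j t assume j: "j < ?n" and J: "?J j t"
    let ?k = "?n - Suc j"
    have k: "?k < ?n" "?n - j = Suc ?k" using j by auto
    have dr: "drop ?k (vars I) = vars I ! ?k # drop (?n - j) (vars I)"
      using k by (metis Cons_nth_drop_Suc)
    have "vars I ! ?k \<in> VV" using k by simp
    then have "runs xs c (t(Var i := ?k, Var x := vars I ! ?k)) M (?J (Suc j))"
      unfolding dr using step J by blast
    moreover have "eval xs t (Minus (V i) (N 1)) = ?k" using J by simp
    moreover have "read_input xs (?k + 2) = vars I ! ?k" by (rule encode_read(3)[OF k(1)])
    ultimately have "runs xs ?body t M (?J (Suc j))"
      using assms(1,2) by (intro runs_Assign_Seq) simp_all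
    then show "eval xs t (V i) \<noteq> 0 \<and> runs xs ?body t M (?J (Suc j))" using J j by simp
  qed (use insize_ge(1)[of I code] assms(2) in auto)
qed

lemma test_loop_runs:
  assumes "\<And>i. s (Arr Label i) = 0"
  shows "runs xs (test_loop_com smG) s (B * (4 * B)) (\<lambda>s'. frame0 13 s s' \<and>
     (s' (Var vDiff) = 0 \<longleftrightarrow> s (Var vDiff) = 0 \<and> (\<forall>w\<in>VV. all_same (s (Var vV)) (s (Var vU)) w)))"
  unfolding test_loop_com_def
proof (rule for_vars_runs)
  let ?v = "s (Var vV)" and ?u = "s (Var vU)"
  let ?J = "\<lambda>vs s'. frame0 13 s s' \<and>
     (s' (Var vDiff) = 0 \<longleftrightarrow> s (Var vDiff) = 0 \<and> (\<forall>w\<in>set vs. all_same ?v ?u w))"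
  show "?J [] (s(Var vI3 := length (vars I)))" using assms by (simp add: frame0_def)
  fix w vs t k assume J: "?J vs t"
  let ?K = "\<lambda>ys t'. frame0 13 s t' \<and> t' (Var vI3) = k \<and> t' (Var vW) = w \<and>
     (t' (Var vDiff) = 0 \<longleftrightarrow> t (Var vDiff) = 0 \<and> (\<forall>c\<in>set ys. same_G ?v ?u w c))"
  have "runs xs (seqs (map (\<lambda>(p, q, r). test_com smG p q r) combos)) (t(Var vI3 := k, Var vW := w)) (4 * B) (?K combos)"
  proof (rule runs_seqs[where J = ?K])
    show "?K [] (t(Var vI3 := k, Var vW := w))" using J by (simp add: frame0_def)
    fix ys c t' assume K: "?K ys t'" and c: "c \<in> set combos"
    obtain p q r where c': "c = (p, q, r)" "p < 4" "q < 4" "r < 4"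
      using c unfolding combos_def by auto
    have t': "t' (Var vV) = ?v" "t' (Var vU) = ?u" "t' (Var vW) = w" using K by (simp_all add: frame0_def)
    have "runs xs (test_com smG p q r) t' (4 * B) (\<lambda>s'. frame0 11 t' s' \<and>
      (s' (Var vDiff) = 0 \<longleftrightarrow> t' (Var vDiff) = 0 \<and> same_G ?v ?u w (p, q, r)))"
      using test_com_runs[of t' p q r] K c' t' by (simp add: frame0_def)
    then show "runs xs (case c of (p, q, r) \<Rightarrow> test_com smG p q r) t' (4 * B) (?K (ys @ [c]))"
      unfolding c' prod.case by (rule runs_mono) (use K in \<open>auto simp: frame0_def\<close>)
  qed
  then show "runs xs (seqs (map (\<lambda>(p, q, r). test_com smG p q r) combos)) (t(Var vI3 := k, Var vW := w)) (4 * B)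
      (\<lambda>t'. ?J (w # vs) t' \<and> t' (Var vI3) = k)"
    by (rule runs_mono) (use J in \<open>auto simp: all_same_def\<close>)
qed (use B1 in auto)

lemma all_same_iff_inessential:
  assumes "v \<in> VV" shows "(\<forall>u\<in>VV. \<forall>w\<in>VV. all_same v u w) \<longleftrightarrow> v \<notin> essential I"
proof -
  have "(p, q, r) \<in> set combos \<longleftrightarrow> p < 4 \<and> q < 4 \<and> r < 4" for p q r
    by (simp add: combos_def del: upt_conv_Cons_Cons)
  then have "all_same v u w \<longleftrightarrow> (\<forall>p<4. \<forall>q<4. \<forall>r<4.
      G ((\<lambda>_. 0)(w := r, u := q, v := p)) = G ((\<lambda>_. 0)(w := r, u := q, v := 0)))" for u w
    unfolding all_same_def same_G_def Ball_def split_paired_All prod.case by blast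
  then show ?thesis using assms unfolding essential_def by blast
qed

lemma test_var_runs:
  assumes "\<And>i. s (Arr Label i) = 0" "s (Var vV) \<in> VV"
  shows "runs xs (test_var_com smG) s (B * (B * (4 * B))) (\<lambda>s'. frame0 15 s s' \<and>
     (s' (Var vDiff) = 0 \<longleftrightarrow> s (Var vV) \<notin> essential I))"
  unfolding test_var_com_def all_same_iff_inessential[OF assms(2), symmetric]
proof (intro runs_Assign_Seq B1, rule for_vars_runs[where J = "\<lambda>vs s'. frame0 15 s s' \<and>
      (s' (Var vDiff) = 0 \<longleftrightarrow> (\<forall>u\<in>set vs. \<forall>w\<in>VV. all_same (s (Var vV)) u w))"])
  let ?v = "s (Var vV)"
  let ?J = "\<lambda>vs s'. frame0 15 s s' \<and> (s' (Var vDiff) = 0 \<longleftrightarrow> (\<forall>u\<in>set vs. \<forall>w\<in>VV. all_same ?v u w))"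
  show "?J [] (s(Var vDiff := eval xs s (N 0), Var vI2 := length (vars I)))"
    using assms by (simp add: frame0_def)
  fix u vs t k assume J: "?J vs t"
  have "t (Var vV) = ?v" using J by (simp add: frame0_def)
  then have "runs xs (test_loop_com smG) (t(Var vI2 := k, Var vU := u)) (B * (4 * B))
      (\<lambda>t'. frame0 13 (t(Var vI2 := k, Var vU := u)) t' \<and>
        (t' (Var vDiff) = 0 \<longleftrightarrow> t (Var vDiff) = 0 \<and> (\<forall>w\<in>VV. all_same ?v u w)))"
    using test_loop_runs[of "t(Var vI2 := k, Var vU := u)"] J by (simp add: frame0_def)
  then show "runs xs (test_loop_com smG) (t(Var vI2 := k, Var vU := u)) (B * (4 * B))
      (\<lambda>t'. ?J (u # vs) t' \<and> t' (Var vI2) = k)"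
    by (rule runs_mono) (use J in \<open>auto simp: frame0_def\<close>)
qed (use B1 in auto)

definition es :: "nat list" where
  "es = filter (\<lambda>v. v \<in> essential I) (rev (vars I))"

definition nes :: "nat list" where
  "nes = filter (\<lambda>v. v \<notin> essential I) (rev (vars I))"

lemma es: "distinct es" "set es = essential I" "length es < B" "length es = card (essential I)"
proof -
  have "distinct (vars I)" using inst by (simp add: instances_def)
  then show d: "distinct es" by (simp add: es_def)
  show s: "set es = essential I" by (auto simp: es_def essential_def)
  show "length es = card (essential I)" using distinct_card[OF d] s by simp
  have "length es \<le> length (vars I)" unfolding es_def by (metis length_filter_le length_rev)
  then show "length es < B" using insize_ge(1)[of I code] by simp
qed

lemma nes: "distinct nes" "set nes = VV - essential I" "length nes < B"
proof -
  have "distinct (vars I)" using inst by (simp add: instances_def)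
  then show "distinct nes" by (simp add: nes_def)
  show "set nes = VV - essential I" by (auto simp: nes_def)
  have "length nes \<le> length (vars I)" unfolding nes_def by (metis length_filter_le length_rev)
  then show "length nes < B" using insize_ge(1)[of I code] by simp
qed

lemma essential_runs:
  assumes "\<And>l. s l = 0"
  shows "runs xs (essential_com smG) s (B * (B * (B * (4 * B)))) (\<lambda>s'.
     (\<forall>i. s' (Arr Label i) = 0) \<and> stores s' Ess es \<and> stores s' Rest nes \<and>
     s' (Var vEss) = length es \<and> s' (Var vRest) = length nes)"
  unfolding essential_com_def es_def nes_def
proof (rule for_vars_runs)
  let ?es = "\<lambda>vs. filter (\<lambda>v. v \<in> essential I) (rev vs)"
  let ?nes = "\<lambda>vs. filter (\<lambda>v. v \<notin> essential I) (rev vs)"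
  let ?J = "\<lambda>vs s'. (\<forall>i. s' (Arr Label i) = 0) \<and> stores s' Ess (?es vs) \<and> stores s' Rest (?nes vs) \<and>
     s' (Var vEss) = length (?es vs) \<and> s' (Var vRest) = length (?nes vs)"
  let ?w = "Write Ess (V vEss) (V vV) ;; Assign vEss (Plus (V vEss) (N 1))"
  let ?w' = "Write Rest (V vRest) (V vV) ;; Assign vRest (Plus (V vRest) (N 1))"
  let ?M = "B * (B * (4 * B))"
  show "?J [] (s(Var vI := length (vars I)))" using assms by (simp add: stores_def)
  fix v vs t k assume J: "?J vs t" and v: "v \<in> VV"
  let ?t = "t(Var vI := k, Var vV := v)"
  let ?Q = "\<lambda>t'. ?J (v # vs) t' \<and> t' (Var vI) = k"
  have "runs xs (test_var_com smG) ?t ?M (\<lambda>t'. frame0 15 ?t t' \<and> (t' (Var vDiff) = 0 \<longleftrightarrow> v \<notin> essential I))"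
    using test_var_runs[of ?t] J v by simp
  then show "runs xs (test_var_com smG ;; Cond (V vDiff) ?w ?w') ?t ?M ?Q"
  proof (rule runs_Seq)
    fix t' assume K: "frame0 15 ?t t' \<and> (t' (Var vDiff) = 0 \<longleftrightarrow> v \<notin> essential I)"
    have E: "stores t' Ess (?es vs)" "stores t' Rest (?nes vs)"
      using J K by (auto simp: stores_def frame0_def)
    note app = stores_append[OF E(1), of v] stores_append[OF E(2), of v]
    have vars: "t' (Var vV) = v" "t' (Var vI) = k" "t' (Var vEss) = length (?es vs)"
      "t' (Var vRest) = length (?nes vs)" "\<And>j. t' (Arr Label j) = 0"
      using J K by (auto simp: frame0_def)
    show "runs xs (Cond (V vDiff) ?w ?w') t' ?M ?Q"
    proof (rule runs_Cond)
      assume "eval xs t' (V vDiff) \<noteq> 0"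
      then have "v \<in> essential I" using K by simp
      then show "runs xs ?w t' ?M ?Q"
        by (intro runs_Write_Seq runs_Assign B1) (use vars E app in \<open>auto simp: stores_def\<close>)
    next
      assume "eval xs t' (V vDiff) = 0"
      then have "v \<notin> essential I" using K by simp
      then show "runs xs ?w' t' ?M ?Q"
        by (intro runs_Write_Seq runs_Assign B1) (use vars E app in \<open>auto simp: stores_def\<close>)
    qed (rule B1)
  qed
qed (use B1 in auto)

end

section \<open>Dynamic programming over subsets\<close>

abbreviation (input) "vMask \<equiv> 19 :: nat"
abbreviation (input) "vLoop \<equiv> 20 :: nat"
abbreviation (input) "vBest \<equiv> 21 :: nat"
abbreviation (input) "vT \<equiv> 22 :: nat"
abbreviation (input) "vX \<equiv> 23 :: nat"
abbreviation (input) "vPow \<equiv> 24 :: nat"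

definition low_bit :: "nat \<Rightarrow> exp" where
  "low_bit x = Minus (V x) (Plus (Halve (V x)) (Halve (V x)))"

lemma eval_low_bit [simp]: "eval xs s (low_bit x) = s (Var x) mod 2"
  by (simp add: low_bit_def) presburger

text \<open>The inessential variables form a fixed tail, so their total charge is a constant
  computed once. They keep label 2, placed, during the dynamic program.\<close>

definition rest_com :: "com \<Rightarrow> com" where
  "rest_com sm =
     Assign vBest (N 0) ;; Assign vI (V vRest) ;;
     While (V vI) (
       Assign vI (Minus (V vI) (N 1)) ;; Assign vV (A Rest (V vI)) ;; Write Label (V vV) (N 1) ;;
       sm ;; Assign vBest (Plus (V vBest) (V vAcc)) ;; Write Label (V vV) (N 2))"

definition power_com :: com where
  "power_com =
     Assign vLoop (N 1) ;; Assign vT (V vEss) ;;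
     While (V vT) (Assign vT (Minus (V vT) (N 1)) ;; Assign vLoop (Plus (V vLoop) (V vLoop)))"

text \<open>Every essential variable is labelled afresh with 2 or 0, so nothing remains of the
  previous mask.\<close>

definition mark_com :: com where
  "mark_com =
     Assign vT (V vEss) ;; Assign vI (N 0) ;; Assign vX (V vMask) ;;
     While (V vT) (
       Assign vT (Minus (V vT) (N 1)) ;;
       Write Label (A Ess (V vI)) (Plus (low_bit vX) (low_bit vX)) ;;
       Assign vX (Halve (V vX)) ;; Assign vI (Plus (V vI) (N 1)))"

text \<open>Under truncated subtraction b + (x - b) is the maximum of b and x.\<close>

definition candidate :: exp where
  "candidate = Plus (V vBest) (Minus (Plus (A Table (Minus (V vMask) (V vPow))) (V vAcc)) (V vBest))"

text \<open>\<open>vX\<close> is the mask shifted so that the current bit is lowest, and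
  \<open>vPow\<close> is the value of that bit, so removing the current element from the mask is a
  subtraction.\<close>

definition try_com :: "com \<Rightarrow> com" where
  "try_com sm =
     Assign vT (V vEss) ;; Assign vI (N 0) ;; Assign vX (V vMask) ;; Assign vPow (N 1) ;;
     Assign vBest (N 0) ;;
     While (V vT) (
       Assign vT (Minus (V vT) (N 1)) ;; Assign vV (A Ess (V vI)) ;;
       Cond (low_bit vX)
         (Write Label (V vV) (N 1) ;; sm ;; Write Label (V vV) (N 2) ;; Assign vBest candidate)
         Skip ;;
       Assign vX (Halve (V vX)) ;; Assign vPow (Plus (V vPow) (V vPow)) ;;
       Assign vI (Plus (V vI) (N 1)))"

text \<open>Removing an element lowers the mask, so in increasing numerical order all needed table
  entries are ready. The last mask is the full set, where \<open>decide_com\<close> reads the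
  optimum.\<close>

definition dp_com :: "com \<Rightarrow> com" where
  "dp_com sm =
     Write Table (N 0) (V vBest) ;; power_com ;; Assign vMask (N 0) ;;
     Assign vLoop (Minus (V vLoop) (N 1)) ;;
     While (V vLoop) (
       Assign vLoop (Minus (V vLoop) (N 1)) ;; Assign vMask (Plus (V vMask) (N 1)) ;;
       mark_com ;; try_com sm ;; Write Table (V vMask) (V vBest))"

text \<open>The truncated difference is 0 exactly when the optimum reaches the threshold.\<close>

definition decide_com :: "com \<Rightarrow> nat \<Rightarrow> com" where
  "decide_com sm k =
     sm ;;
     Cond (Minus (Plus (V vAcc) (scaled k (In (N 0)))) (A Table (V vMask)))
       (Assign 0 (N 0)) (Assign 0 (N 1))"

definition unchanged :: "nat set \<Rightarrow> state \<Rightarrow> state \<Rightarrow> bool" where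
  "unchanged X s s' \<longleftrightarrow> (\<forall>a i. a \<noteq> Label \<longrightarrow> s' (Arr a i) = s (Arr a i)) \<and>
     (\<forall>x. x \<notin> X \<longrightarrow> s' (Var x) = s (Var x))"

lemma bit_imp_less: "bit S i \<Longrightarrow> S < 2 ^ n \<Longrightarrow> i < n" for S :: nat
proof -
  assume "bit S i" "S < 2 ^ n"
  then have "S div 2 ^ i \<noteq> 0" unfolding bit_iff_odd by (metis even_zero)
  then have "2 ^ i \<le> S" by (simp add: div_eq_0_iff)
  then have "(2 :: nat) ^ i < 2 ^ n" using \<open>S < 2 ^ n\<close> by linarith
  then show ?thesis by simp
qed

lemma bit_diff_power:
  includes bit_operations_syntax
  fixes S :: nat assumes "bit S i" shows "bit (S - 2 ^ i) j \<longleftrightarrow> bit S j \<and> j \<noteq> i"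
proof -
  have "unset_bit i S + 2 ^ i = unset_bit i S OR 2 ^ i"
    by (rule disjunctive_add_eq_or) (auto simp: bit_eq_iff bit_simps)
  also have "\<dots> = S" using assms by (intro bit_eqI) (auto simp: bit_simps)
  finally have "S - 2 ^ i = unset_bit i S" by (metis diff_add_inverse2)
  then show ?thesis by (auto simp: bit_unset_bit_iff)
qed

lemma div_power_mod_2: "S div 2 ^ j mod 2 = of_bool (bit S j)" for S :: nat
  by (simp add: bit_iff_odd mod_2_eq_odd)

context encoded_instance
begin

abbreviation "smD \<equiv> tsum gain_table"
abbreviation "smM \<equiv> tsum mean_table"

definition opt :: "nat set \<Rightarrow> nat" where
  "opt Z = Max ((\<lambda>ys. suffix_sum (gain I) (ys @ nes)) ` {ys. distinct ys \<and> set ys = Z})"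

lemma finite_orders: "finite Z \<Longrightarrow> finite {ys. distinct ys \<and> set ys = Z}"
  by (rule finite_subset[OF _ finite_lists_length_le[of Z "card Z"]]) (auto simp: distinct_card)

lemma opt_ge: "distinct ys \<Longrightarrow> suffix_sum (gain I) (ys @ nes) \<le> opt (set ys)"
  unfolding opt_def by (rule Max_ge) (auto intro: finite_orders)

lemma opt_attained:
  assumes "finite Z"
  obtains ys where "distinct ys" "set ys = Z" "opt Z = suffix_sum (gain I) (ys @ nes)"
proof -
  have "{ys. distinct ys \<and> set ys = Z} \<noteq> {}" using finite_distinct_list[OF assms] by auto
  then have "opt Z \<in> (\<lambda>ys. suffix_sum (gain I) (ys @ nes)) ` {ys. distinct ys \<and> set ys = Z}"
    unfolding opt_def by (intro Max_in finite_imageI finite_orders assms) simp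
  then show ?thesis using that by auto
qed

lemma opt_empty: "opt {} = suffix_sum (gain I) nes"
  by (rule opt_attained[of "{}"]) auto

text \<open>Recursion of Held-Karp type on the front element: its charge depends only on the set
  behind it, and the rest can be optimised independently.\<close>

lemma opt_rec:
  assumes "finite Z" "Z \<noteq> {}"
  shows "opt Z = Max ((\<lambda>y. opt (Z - {y}) + gain I (Z - {y} \<union> set nes) y) ` Z)" (is "_ = Max (?f ` Z)")
proof (rule antisym)
  obtain ys where ys: "distinct ys" "set ys = Z" "opt Z = suffix_sum (gain I) (ys @ nes)"
    using opt_attained[OF assms(1)] by blast
  then obtain y zs where y: "ys = y # zs" using assms(2) by (cases ys) auto
  have zs: "set zs = Z - {y}" "y \<in> Z" using ys y by auto
  have "opt Z = gain I (set zs \<union> set nes) y + suffix_sum (gain I) (zs @ nes)"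
    using ys(3) y by simp
  also have "\<dots> \<le> ?f y" using opt_ge[of zs] ys(1) y zs by simp
  also have "\<dots> \<le> Max (?f ` Z)" using assms zs by simp
  finally show "opt Z \<le> Max (?f ` Z)" .
next
  have "?f y \<le> opt Z" if "y \<in> Z" for y
  proof -
    obtain zs where zs: "distinct zs" "set zs = Z - {y}" "opt (Z - {y}) = suffix_sum (gain I) (zs @ nes)"
      using opt_attained[of "Z - {y}"] assms(1) by blast
    then have "?f y = suffix_sum (gain I) ((y # zs) @ nes)" by simp
    also have "\<dots> \<le> opt (set (y # zs))" by (rule opt_ge) (use zs in auto)
    also have "set (y # zs) = Z" using zs that by auto
    finally show ?thesis .
  qed
  then show "Max (?f ` Z) \<le> opt Z" using assms by simp
qed

definition subset_of :: "nat \<Rightarrow> nat set" where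
  "subset_of S = (!) es ` {i. i < length es \<and> bit S i}"

lemma subset_of_0: "subset_of 0 = {}"
  by (simp add: subset_of_def)

lemma subset_of_full: "subset_of (2 ^ length es - 1) = essential I"
proof -
  have "bit (2 ^ length es - 1 :: nat) i \<longleftrightarrow> i < length es" for i
    using bit_mask_iff[of "length es" i, where 'a = nat] by (simp add: mask_eq_exp_minus_1)
  then have "subset_of (2 ^ length es - 1) = (!) es ` {..<length es}"
    by (auto simp: subset_of_def)
  then show ?thesis using es(2) by (auto simp: set_conv_nth)
qed

lemma subset_of_diff:
  assumes "bit S i" "i < length es"
  shows "subset_of (S - 2 ^ i) = subset_of S - {es ! i}"
  using es(1) assms by (auto simp: subset_of_def bit_diff_power nth_eq_iff_index_eq)

text \<open>The inserted 0 is the initial value of the running maximum; as all values are natural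
  numbers and the mask is nonempty, it changes nothing.\<close>

lemma opt_subset_of:
  assumes "0 < S" "S < 2 ^ length es"
  shows "opt (subset_of S) = Max (insert 0 ((\<lambda>i. opt (subset_of (S - 2 ^ i)) +
     gain I (subset_of S - {es ! i} \<union> set nes) (es ! i)) ` {i. i < length es \<and> bit S i}))"
proof -
  let ?D = "{i. i < length es \<and> bit S i}"
  have "\<exists>i. bit S i"
  proof (rule ccontr)
    assume "\<not> ?thesis"
    then have "S = 0" by (intro bit_eqI) simp
    then show False using assms by simp
  qed
  then have D: "?D \<noteq> {}" using bit_imp_less[OF _ assms(2)] by auto
  let ?f = "\<lambda>y. opt (subset_of S - {y}) + gain I (subset_of S - {y} \<union> set nes) y"
  have "opt (subset_of S) = Max (?f ` subset_of S)"
    by (rule opt_rec) (use D in \<open>auto simp: subset_of_def\<close>)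
  also have "?f ` subset_of S = (\<lambda>i. ?f (es ! i)) ` ?D"
    unfolding subset_of_def image_image ..
  also have "\<dots> = (\<lambda>i. opt (subset_of (S - 2 ^ i)) + gain I (subset_of S - {es ! i} \<union> set nes) (es ! i)) ` ?D"
    by (rule image_cong[OF refl]) (simp add: subset_of_diff)
  finally show ?thesis using D by (simp add: Max_insert)
qed

lemma rest_runs:
  assumes "\<And>i. s (Arr Label i) = 0" "stores s Rest nes" "s (Var vRest) = length nes"
  shows "runs xs (rest_com smD) s (B * (4 * B)) (\<lambda>s'.
     unchanged ({..<9} \<union> {vI, vV, vBest}) s s' \<and> s' (Var vBest) = suffix_sum (gain I) nes \<and>
     (\<forall>v. s' (Arr Label v) = (if v \<in> set nes then 2 else 0)))"
proof -
  let ?n = "length nes"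
  let ?X = "{..<9} \<union> {vI, vV, vBest}"
  let ?body = "Assign vI (Minus (V vI) (N 1)) ;; Assign vV (A Rest (V vI)) ;;
       Write Label (V vV) (N 1) ;; smD ;; Assign vBest (Plus (V vBest) (V vAcc)) ;; Write Label (V vV) (N 2)"
  let ?J = "\<lambda>i s'. unchanged ?X s s' \<and> s' (Var vI) = ?n - i \<and>
     s' (Var vBest) = suffix_sum (gain I) (drop (?n - i) nes) \<and>
     (\<forall>v. s' (Arr Label v) = (if v \<in> set (drop (?n - i) nes) then 2 else 0))"
  show ?thesis unfolding rest_com_def
  proof (intro runs_Assign_Seq B1, rule runs_While[where J = ?J and n = ?n])
    show "?J 0 (s(Var vBest := eval xs s (N 0), Var vI := eval xs (s(Var vBest := eval xs s (N 0))) (V vRest)))"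
      using assms by (simp add: unchanged_def)
  next
    fix i s' assume i: "i < ?n" and J: "?J i s'"
    let ?k = "?n - Suc i"
    have k: "?k < ?n" "?n - i = Suc ?k" using i by auto
    let ?v = "nes ! ?k"
    let ?Z = "set (drop (?n - i) nes)"
    have dr: "drop ?k nes = ?v # drop (?n - i) nes"
      using k by (metis Cons_nth_drop_Suc)
    have vZ: "?v \<notin> ?Z" using nes(1) dr by (metis distinct.simps(2) distinct_drop)
    let ?s = "s'(Var vI := ?k, Var vV := ?v, Arr Label ?v := 1)"
    have "runs xs smD ?s (4 * B) (\<lambda>s''. frame 9 ?s s'' \<and> s'' (Var vAcc) = table_sum gain_table I (place_label ?Z ?v))"
      by (rule table_sum_runs') (use J in \<open>auto simp: place_label_def\<close>)
    moreover have "runs xs (Assign vBest (Plus (V vBest) (V vAcc)) ;; Write Label (V vV) (N 2)) s'' (4 * B) (?J (Suc i))"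
      if K: "frame 9 ?s s'' \<and> s'' (Var vAcc) = table_sum gain_table I (place_label ?Z ?v)" for s''
      by (intro runs_Assign_Seq runs_Write B1)
         (use K J in \<open>auto simp: dr frame_def unchanged_def gain_def\<close>)
    ultimately have R: "runs xs (smD ;; Assign vBest (Plus (V vBest) (V vAcc)) ;; Write Label (V vV) (N 2)) ?s (4 * B) (?J (Suc i))"
      by (rule runs_Seq)
    have e: "s' (Arr Rest ?k) = ?v" using J assms(2) k by (simp add: unchanged_def stores_def)
    let ?s1 = "s'(Var vI := eval xs s' (Minus (V vI) (N 1)))"
    let ?s2 = "?s1(Var vV := eval xs ?s1 (A Rest (V vI)))"
    have "?s2(Arr Label (eval xs ?s2 (V vV)) := eval xs ?s2 (N 1)) = ?s" using J e by simp
    then have "runs xs ?body s' (4 * B) (?J (Suc i))"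
      by (intro runs_Assign_Seq runs_Write_Seq B1) (simp only: R)
    then show "eval xs s' (V vI) \<noteq> 0 \<and> runs xs ?body s' (4 * B) (?J (Suc i))"
      using J i by simp
  qed (use nes(3) B1 in auto)
qed

lemma power_runs:
  assumes "s (Var vEss) = length es"
  shows "runs xs power_com s (B * 1) (\<lambda>s'. s' = s(Var vLoop := 2 ^ length es, Var vT := 0))"
  unfolding power_com_def
proof (intro runs_Assign_Seq, rule runs_While[where n = "length es" and
      J = "\<lambda>i s'. s' = s(Var vLoop := 2 ^ i, Var vT := length es - i)"])
  fix i s' assume "i < length es" "s' = s(Var vLoop := 2 ^ i, Var vT := length es - i)"
  then show "eval xs s' (V vT) \<noteq> 0 \<and> runs xs (Assign vT (Minus (V vT) (N 1)) ;; Assign vLoop (Plus (V vLoop) (V vLoop))) s' 1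
     (\<lambda>s'. s' = s(Var vLoop := 2 ^ Suc i, Var vT := length es - Suc i))"
    by (auto intro!: runs_Assign_Seq runs_Assign simp: fun_eq_iff)
qed (use assms es(3) B1 in \<open>auto simp: fun_eq_iff\<close>)

lemma mark_runs:
  assumes "stores s Ess es" "s (Var vEss) = length es"
    "\<And>v. v \<notin> set es \<Longrightarrow> s (Arr Label v) = (if v \<in> set nes then 2 else 0)"
  shows "runs xs mark_com s (B * 1) (\<lambda>s'. unchanged {vT, vI, vX} s s' \<and>
     (\<forall>v. s' (Arr Label v) = (if v \<in> subset_of (s (Var vMask)) \<union> set nes then 2 else 0)))"
proof -
  let ?S = "s (Var vMask)" and ?n = "length es"
  have disj: "set es \<inter> set nes = {}" using es(2) nes(2) by auto
  let ?body = "Assign vT (Minus (V vT) (N 1)) ;;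
       Write Label (A Ess (V vI)) (Plus (low_bit vX) (low_bit vX)) ;;
       Assign vX (Halve (V vX)) ;; Assign vI (Plus (V vI) (N 1))"
  let ?J = "\<lambda>j s'. unchanged {vT, vI, vX} s s' \<and> s' (Var vT) = ?n - j \<and> s' (Var vI) = j \<and>
     s' (Var vX) = ?S div 2 ^ j \<and>
     (\<forall>v. v \<notin> set es \<longrightarrow> s' (Arr Label v) = (if v \<in> set nes then 2 else 0)) \<and>
     (\<forall>i<j. s' (Arr Label (es ! i)) = (if bit ?S i then 2 else 0))"
  show ?thesis unfolding mark_com_def
  proof (intro runs_Assign_Seq, rule runs_While[where n = ?n and J = ?J])
    fix j s' assume j: "j < ?n" and J: "?J j s'"
    have e: "s' (Arr Ess j) = es ! j" using J assms(1) j by (simp add: unchanged_def stores_def)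
    have neq: "es ! i \<noteq> es ! j" if "i < j" for i
      using es(1) that j by (simp add: nth_eq_iff_index_eq)
    have b: "?S div 2 ^ j mod 2 + ?S div 2 ^ j mod 2 = (if bit ?S j then 2 else 0)"
      by (simp add: div_power_mod_2)
    have d: "?S div 2 ^ j div 2 = ?S div 2 ^ Suc j" by (simp add: div_mult2_eq[symmetric] mult.commute)
    have "runs xs ?body s' 1 (?J (Suc j))"
      by (intro runs_Assign_Seq runs_Write_Seq runs_Assign)
         (use J e j in \<open>auto simp: unchanged_def less_Suc_eq neq b d simp del: power_Suc\<close>)
    then show "eval xs s' (V vT) \<noteq> 0 \<and> runs xs ?body s' 1 (?J (Suc j))"
      using J j by simp
  next
    fix s' assume J: "?J ?n s'"
    have "s' (Arr Label v) = (if v \<in> subset_of ?S \<union> set nes then 2 else 0)" for v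
    proof (cases "v \<in> set es")
      case True
      then obtain i where i: "i < ?n" "v = es ! i" by (auto simp: in_set_conv_nth)
      have "v \<in> subset_of ?S \<longleftrightarrow> bit ?S i"
        using i es(1) by (auto simp: subset_of_def nth_eq_iff_index_eq)
      then show ?thesis using J i True disj by auto
    next
      case False
      then have "v \<notin> subset_of ?S" by (auto simp: subset_of_def)
      then show ?thesis using J False by simp
    qed
    then show "eval xs s' (V vT) = 0 \<and> unchanged {vT, vI, vX} s s' \<and>
       (\<forall>v. s' (Arr Label v) = (if v \<in> subset_of ?S \<union> set nes then 2 else 0))"
      using J by simp
  qed (use assms es(3) B1 in \<open>auto simp: unchanged_def\<close>)
qed

lemma try_runs:
  assumes "stores s Ess es" "s (Var vEss) = length es"
    "\<And>v. s (Arr Label v) = (if v \<in> subset_of (s (Var vMask)) \<union> set nes then 2 else 0)"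
  shows "runs xs (try_com smD) s (B * (4 * B)) (\<lambda>s'.
     unchanged ({..<9} \<union> {vT, vI, vX, vPow, vBest, vV}) s s' \<and>
     (\<forall>v. s' (Arr Label v) = s (Arr Label v)) \<and>
     s' (Var vBest) = Max (insert 0 ((\<lambda>i. s (Arr Table (s (Var vMask) - 2 ^ i)) +
       gain I (subset_of (s (Var vMask)) - {es ! i} \<union> set nes) (es ! i)) ` {i. i < length es \<and> bit (s (Var vMask)) i})))"
proof -
  let ?S = "s (Var vMask)" and ?n = "length es"
  let ?X = "{..<9} \<union> {vT, vI, vX, vPow, vBest, vV}"
  let ?f = "\<lambda>i. s (Arr Table (?S - 2 ^ i)) + gain I (subset_of ?S - {es ! i} \<union> set nes) (es ! i)"
  let ?cond = "Cond (low_bit vX)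
         (Write Label (V vV) (N 1) ;; smD ;; Write Label (V vV) (N 2) ;; Assign vBest candidate) Skip"
  let ?next = "Assign vX (Halve (V vX)) ;; Assign vPow (Plus (V vPow) (V vPow)) ;;
       Assign vI (Plus (V vI) (N 1))"
  let ?body = "Assign vT (Minus (V vT) (N 1)) ;; Assign vV (A Ess (V vI)) ;; ?cond ;; ?next"
  let ?J = "\<lambda>j s'. unchanged ?X s s' \<and> (\<forall>v. s' (Arr Label v) = s (Arr Label v)) \<and>
     s' (Var vT) = ?n - j \<and> s' (Var vI) = j \<and> s' (Var vX) = ?S div 2 ^ j \<and> s' (Var vPow) = 2 ^ j \<and>
     s' (Var vBest) = Max (insert 0 (?f ` {i. i < j \<and> bit ?S i}))"
  show ?thesis unfolding try_com_def
  proof (intro runs_Assign_Seq B1, rule runs_While[where n = ?n and J = ?J])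
    fix j s' assume j: "j < ?n" and J: "?J j s'"
    let ?y = "es ! j"
    let ?Z = "subset_of ?S - {?y} \<union> set nes"
    have ye: "?y \<in> set es" using j by simp
    have yn: "?y \<notin> set nes" using ye es(2) nes(2) by auto
    have e: "s' (Arr Ess j) = ?y" using J assms(1) j by (simp add: unchanged_def stores_def)
    have d: "?S div 2 ^ j div 2 = ?S div 2 ^ Suc j" by (simp add: div_mult2_eq[symmetric] mult.commute)
    let ?s = "s'(Var vT := ?n - Suc j, Var vV := ?y)"
    let ?K = "\<lambda>s''. unchanged ?X s s'' \<and> (\<forall>v. s'' (Arr Label v) = s (Arr Label v)) \<and>
      s'' (Var vT) = ?n - Suc j \<and> s'' (Var vI) = j \<and> s'' (Var vX) = ?S div 2 ^ j \<and> s'' (Var vPow) = 2 ^ j \<and>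
      s'' (Var vBest) = Max (insert 0 (?f ` {i. i < Suc j \<and> bit ?S i}))"
    have "runs xs ?cond ?s (4 * B) ?K"
    proof (rule runs_Cond)
      assume "eval xs ?s (low_bit vX) = 0"
      then have "\<not> bit ?S j" using J by (simp add: div_power_mod_2)
      then have "{i. i < Suc j \<and> bit ?S i} = {i. i < j \<and> bit ?S i}" by (auto simp: less_Suc_eq)
      then show "runs xs Skip ?s (4 * B) ?K"
        using J by (intro runs_Skip) (simp add: unchanged_def)
    next
      assume "eval xs ?s (low_bit vX) \<noteq> 0"
      then have bit: "bit ?S j" using J by (simp add: div_power_mod_2)
      then have "{i. i < Suc j \<and> bit ?S i} = insert j {i. i < j \<and> bit ?S i}" by (auto simp: less_Suc_eq)
      then have mx: "Max (insert 0 (?f ` {i. i < Suc j \<and> bit ?S i}))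
          = max (?f j) (Max (insert 0 (?f ` {i. i < j \<and> bit ?S i})))"
        by (simp add: insert_commute[of 0] del: Max_insert) (subst Max_insert, auto)
      have yS: "?y \<in> subset_of ?S" using bit j by (auto simp: subset_of_def)
      let ?s1 = "?s(Arr Label ?y := 1)"
      have "runs xs smD ?s1 (4 * B) (\<lambda>s''. frame 9 ?s1 s'' \<and> s'' (Var vAcc) = table_sum gain_table I (place_label ?Z ?y))"
        by (rule table_sum_runs') (use J assms(3) in \<open>auto simp: place_label_def\<close>)
      moreover have "runs xs (Write Label (V vV) (N 2) ;; Assign vBest candidate) s2 (4 * B) ?K"
        if K: "frame 9 ?s1 s2 \<and> s2 (Var vAcc) = table_sum gain_table I (place_label ?Z ?y)" for s2
      proof -
        have lab: "s2 (Arr Label v) = (if v = ?y then 1 else s (Arr Label v))" for v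
          using K J by (simp add: frame_def)
        have vars: "s2 (Var vV) = ?y" "s2 (Var vMask) = ?S" "s2 (Var vPow) = 2 ^ j"
          "s2 (Var vT) = ?n - Suc j" "s2 (Var vI) = j" "s2 (Var vX) = ?S div 2 ^ j"
          "s2 (Var vBest) = Max (insert 0 (?f ` {i. i < j \<and> bit ?S i}))"
          "s2 (Arr Table k) = s (Arr Table k)" for k
          using K J by (auto simp: frame_def unchanged_def)
        have un: "unchanged ?X s s2" using K J by (auto simp: frame_def unchanged_def)
        have acc: "s2 (Var vAcc) = gain I ?Z ?y" using K by (simp add: gain_def)
        have ly: "s (Arr Label ?y) = 2" using assms(3)[of ?y] yS by simp
        define m where "m = Max (insert 0 (?f ` {i. i < j \<and> bit ?S i}))"
        have m: "m + (F - m) = max F m" for F by simp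
        show ?thesis
        proof (intro runs_Write_Seq runs_Assign B1)
          let ?s3 = "s2(Arr Label (eval xs s2 (V vV)) := eval xs s2 (N 2))"
          have "eval xs ?s3 candidate = m + (?f j - m)"
            using vars[folded m_def] acc by (simp add: candidate_def)
          then have "eval xs ?s3 candidate = Max (insert 0 (?f ` {i. i < Suc j \<and> bit ?S i}))"
            by (simp only: m mx m_def[symmetric])
          then show "?K (?s3(Var vBest := eval xs ?s3 candidate))"
            using vars un lab ly by (auto simp: unchanged_def)
        qed
      qed
      ultimately have R: "runs xs (smD ;; Write Label (V vV) (N 2) ;; Assign vBest candidate) ?s1 (4 * B) ?K"
        by (rule runs_Seq)
      then show "runs xs (Write Label (V vV) (N 1) ;; smD ;; Write Label (V vV) (N 2) ;; Assign vBest candidate) ?s (4 * B) ?K"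
        by (intro runs_Write_Seq B1) simp
    qed (rule B1)
    moreover have "runs xs ?next s'' (4 * B) (?J (Suc j))" if K: "?K s''" for s''
      by (intro runs_Assign_Seq runs_Assign B1)
         (use K d in \<open>simp add: unchanged_def del: power_Suc, simp\<close>)
    ultimately have R: "runs xs (?cond ;; ?next) ?s (4 * B) (?J (Suc j))"
      by (rule runs_Seq)
    have "s'(Var vT := eval xs s' (Minus (V vT) (N 1)),
        Var vV := eval xs (s'(Var vT := eval xs s' (Minus (V vT) (N 1)))) (A Ess (V vI))) = ?s"
      using J e by simp
    then have "runs xs ?body s' (4 * B) (?J (Suc j))"
      by (intro runs_Assign_Seq B1) (simp only: R)
    then show "eval xs s' (V vT) \<noteq> 0 \<and> runs xs ?body s' (4 * B) (?J (Suc j))"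
      using J j by simp
  qed (use assms es(3) B1 in \<open>auto simp: unchanged_def\<close>)
qed

lemma dp_runs:
  assumes "stores s Ess es" "s (Var vEss) = length es" "s (Var vBest) = suffix_sum (gain I) nes"
    "\<And>v. s (Arr Label v) = (if v \<in> set nes then 2 else 0)"
  shows "runs xs (dp_com smD) s (2 ^ length es * (B * (4 * B))) (\<lambda>s'.
     s' (Arr Table (s' (Var vMask))) = opt (essential I) \<and> (\<forall>v. s' (Arr Label v) < 4))"
proof -
  let ?n = "length es"
  let ?M = "2 ^ ?n * (B * (4 * B))"
  have M: "1 \<le> ?M" "B * 1 \<le> ?M" using B1 by simp_all
  let ?J = "\<lambda>j s'. stores s' Ess es \<and> s' (Var vEss) = ?n \<and> s' (Var vLoop) = 2 ^ ?n - 1 - j \<and>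
     s' (Var vMask) = j \<and> (\<forall>S\<le>j. s' (Arr Table S) = opt (subset_of S)) \<and>
     (\<forall>v. v \<notin> set es \<longrightarrow> s' (Arr Label v) = (if v \<in> set nes then 2 else 0)) \<and>
     (\<forall>v. s' (Arr Label v) < 4)"
  let ?body = "Assign vLoop (Minus (V vLoop) (N 1)) ;; Assign vMask (Plus (V vMask) (N 1)) ;;
       mark_com ;; try_com smD ;; Write Table (V vMask) (V vBest)"
  let ?s1 = "s(Arr Table 0 := suffix_sum (gain I) nes)"
  have loop: "runs xs (While (V vLoop) ?body) s2 ?M (\<lambda>s'.
     s' (Arr Table (s' (Var vMask))) = opt (essential I) \<and> (\<forall>v. s' (Arr Label v) < 4))"
    if "?J 0 s2" for s2
  \<comment> \<open>Mask 0 is entered before the loop, which leaves \<open>2 ^ ?n - 1\<close>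
    rounds; the final test makes up the factor \<open>2 ^ ?n\<close>.\<close>
  proof (rule runs_While[where J = ?J and n = "2 ^ ?n - 1"])
    show "?J 0 s2" by fact
  next
    fix j s' assume j: "j < 2 ^ ?n - 1" and J: "?J j s'"
    let ?t = "s'(Var vLoop := 2 ^ ?n - 1 - Suc j, Var vMask := Suc j)"
    let ?Z = "subset_of (Suc j)"
    have "runs xs mark_com ?t (B * 1) (\<lambda>s'. unchanged {vT, vI, vX} ?t s' \<and>
       (\<forall>v. s' (Arr Label v) = (if v \<in> ?Z \<union> set nes then 2 else 0)))"
      using mark_runs[of ?t] J by (simp add: stores_def)
    then have "runs xs mark_com ?t (B * (4 * B)) (\<lambda>s'. unchanged {vT, vI, vX} ?t s' \<and>
       (\<forall>v. s' (Arr Label v) = (if v \<in> ?Z \<union> set nes then 2 else 0)))"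
      by (rule runs_mono) (use B1 in simp_all)
    moreover have "runs xs (try_com smD ;; Write Table (V vMask) (V vBest)) t1 (B * (4 * B)) (?J (Suc j))"
      if T1: "unchanged {vT, vI, vX} ?t t1 \<and> (\<forall>v. t1 (Arr Label v) = (if v \<in> ?Z \<union> set nes then 2 else 0))" for t1
    proof -
      have t1: "stores t1 Ess es" "t1 (Var vEss) = ?n" "t1 (Var vMask) = Suc j"
        "t1 (Var vLoop) = 2 ^ ?n - 1 - Suc j"
        "\<And>S. S \<le> j \<Longrightarrow> t1 (Arr Table S) = opt (subset_of S)"
        using T1 J by (auto simp: unchanged_def stores_def)
      have "Max (insert 0 ((\<lambda>i. t1 (Arr Table (Suc j - 2 ^ i)) +
          gain I (?Z - {es ! i} \<union> set nes) (es ! i)) ` {i. i < ?n \<and> bit (Suc j) i})) = opt ?Z"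
      proof -
        have "Suc j < 2 ^ ?n" using j by simp
        moreover have "t1 (Arr Table (Suc j - 2 ^ i)) = opt (subset_of (Suc j - 2 ^ i))" for i
        proof (rule t1(5))
          have "(1 :: nat) \<le> 2 ^ i" by simp
          then show "Suc j - 2 ^ i \<le> j" by linarith
        qed
        ultimately show ?thesis using opt_subset_of[of "Suc j"] by simp
      qed
      with try_runs[of t1] t1 T1 have "runs xs (try_com smD) t1 (B * (4 * B)) (\<lambda>s'.
         unchanged ({..<9} \<union> {vT, vI, vX, vPow, vBest, vV}) t1 s' \<and>
         (\<forall>v. s' (Arr Label v) = t1 (Arr Label v)) \<and> s' (Var vBest) = opt ?Z)"
        by simp
      then show ?thesis
      proof (rule runs_Seq)
        fix t2 assume T2: "unchanged ({..<9} \<union> {vT, vI, vX, vPow, vBest, vV}) t1 t2 \<and>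
         (\<forall>v. t2 (Arr Label v) = t1 (Arr Label v)) \<and> t2 (Var vBest) = opt ?Z"
        have t2: "t2 (Var vMask) = Suc j" "t2 (Var vEss) = ?n" "t2 (Var vLoop) = 2 ^ ?n - 1 - Suc j"
          "\<And>i. t2 (Arr Ess i) = t1 (Arr Ess i)" "\<And>i. t2 (Arr Table i) = t1 (Arr Table i)"
          using T2 t1 by (auto simp: unchanged_def)
        have nZ: "v \<notin> ?Z" if "v \<notin> set es" for v using that by (auto simp: subset_of_def)
        show "runs xs (Write Table (V vMask) (V vBest)) t2 (B * (4 * B)) (?J (Suc j))"
          by (intro runs_Write B1)
             (use T2 T1 t1 t2 nZ in \<open>auto simp: stores_def le_Suc_eq\<close>)
      qed
    qed
    ultimately have R: "runs xs (mark_com ;; try_com smD ;; Write Table (V vMask) (V vBest)) ?t (B * (4 * B)) (?J (Suc j))"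
      by (rule runs_Seq)
    have "s'(Var vLoop := eval xs s' (Minus (V vLoop) (N 1)),
        Var vMask := eval xs (s'(Var vLoop := eval xs s' (Minus (V vLoop) (N 1)))) (Plus (V vMask) (N 1))) = ?t"
      using J by simp
    then have "runs xs ?body s' (B * (4 * B)) (?J (Suc j))"
      by (intro runs_Assign_Seq B1) (simp only: R)
    then show "eval xs s' (V vLoop) \<noteq> 0 \<and> runs xs ?body s' (B * (4 * B)) (?J (Suc j))"
      using J j by simp
  next
    fix s' assume "?J (2 ^ ?n - 1) s'"
    then show "eval xs s' (V vLoop) = 0 \<and> s' (Arr Table (s' (Var vMask))) = opt (essential I) \<and>
       (\<forall>v. s' (Arr Label v) < 4)"
      by (simp add: subset_of_full[symmetric])
  qed (use B1 in auto)
  have "runs xs power_com ?s1 ?M (\<lambda>s'. s' = ?s1(Var vLoop := 2 ^ ?n, Var vT := 0))"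
    by (rule runs_mono[OF power_runs M(2)]) (use assms in auto)
  then have "runs xs (power_com ;; Assign vMask (N 0) ;; Assign vLoop (Minus (V vLoop) (N 1)) ;; While (V vLoop) ?body) ?s1 ?M
      (\<lambda>s'. s' (Arr Table (s' (Var vMask))) = opt (essential I) \<and> (\<forall>v. s' (Arr Label v) < 4))"
  proof (rule runs_Seq)
    fix t assume t: "t = ?s1(Var vLoop := 2 ^ ?n, Var vT := 0)"
    show "runs xs (Assign vMask (N 0) ;; Assign vLoop (Minus (V vLoop) (N 1)) ;; While (V vLoop) ?body) t ?M
      (\<lambda>s'. s' (Arr Table (s' (Var vMask))) = opt (essential I) \<and> (\<forall>v. s' (Arr Label v) < 4))"
      by (intro runs_Assign_Seq M loop)
         (use assms t in \<open>auto simp: stores_def subset_of_0 opt_empty\<close>)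
  qed
  then show ?thesis unfolding dp_com_def
    by (intro runs_Write_Seq M) (use assms(3) in simp)
qed

end

section \<open>The complete decision procedure\<close>

definition solver :: "(predicate \<Rightarrow> nat) \<Rightarrow> predicate list \<Rightarrow> nat \<Rightarrow> nat \<Rightarrow> com" where
  "solver code Ps K k =
     essential_com (table_sum_com (entries code Ps bucket_table)) ;;
     Cond (Minus (scaled K (In (N 0))) (V vEss))
       (rest_com (table_sum_com (entries code Ps gain_table)) ;;
        dp_com (table_sum_com (entries code Ps gain_table)) ;;
        decide_com (table_sum_com (entries code Ps mean_table)) k)
       (Assign 0 (N 1))"

context encoded_instance
begin

lemma above_average_opt:
  assumes "c \<in> {2, 3}"
  shows "above_average c I \<longleftrightarrow>
     table_sum mean_table I h + (if c = 2 then 12 else 1) * param I \<le> opt (essential I)"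
proof -
  have "finite (essential I)" using es(2) by (metis List.finite_set)
  then obtain ys where ys: "distinct ys" "set ys = essential I"
    "opt (essential I) = suffix_sum (gain I) (ys @ nes)" by (rule opt_attained)
  show ?thesis unfolding above_average_iff[OF assms nes(1,2), of h]
    using ys opt_ge by (metis order_trans)
qed

lemma decide_runs:
  assumes "c \<in> {2, 3}" "s (Arr Table (s (Var vMask))) = opt (essential I)" "\<And>v. s (Arr Label v) < 4"
  shows "runs xs (decide_com smM (if c = 2 then 12 else 1)) s (4 * B)
     (\<lambda>s'. s' (Var 0) = (if above_average c I then 1 else 0))"
  unfolding decide_com_def
proof (rule runs_Seq, rule table_sum_runs, rule assms(3))
  let ?k = "if c = 2 then 12 else 1 :: nat"
  let ?h = "\<lambda>v. s (Arr Label v)"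
  fix s' assume s': "frame 9 s s' \<and> s' (Var vAcc) = table_sum mean_table I ?h"
  have "s' (Arr Table (s' (Var vMask))) = opt (essential I)" using s' assms(2) by (simp add: frame_def)
  then have "eval xs s' (Minus (Plus (V vAcc) (scaled ?k (In (N 0)))) (A Table (V vMask))) = 0 \<longleftrightarrow> above_average c I"
    using s' encode_read(1)[of code I] above_average_opt[OF assms(1), of ?h] by simp
  then show "runs xs (Cond (Minus (Plus (V vAcc) (scaled ?k (In (N 0)))) (A Table (V vMask)))
       (Assign 0 (N 0)) (Assign 0 (N 1))) s' (4 * B) (\<lambda>s'. s' (Var 0) = (if above_average c I then 1 else 0))"
    by (intro runs_Cond runs_Assign B1) auto
qed

text \<open>If the guard evaluates to 0, there are at least \<open>K * param I\<close> essential
  variables and the hypothesis answers yes; otherwise \<open>2 ^ (K * param I)\<close> bounds the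
  number of masks. The power \<open>B ^ 4\<close> comes from testing essentiality, three nested
  loops over the variables around one over the constraints; a round of the dynamic program takes
  only order \<open>B ^ 2\<close>.\<close>

lemma solver_runs:
  assumes c: "c \<in> {2, 3}" and K: "K * param I \<le> card (essential I) \<Longrightarrow> above_average c I"
  shows "runs xs (solver code Ps K (if c = 2 then 12 else 1)) (\<lambda>_. 0) (4 * 2 ^ (K * param I) * B ^ 4)
     (\<lambda>s. s (Var 0) = (if above_average c I then 1 else 0))"
  unfolding solver_def
proof (rule runs_Seq)
  let ?M = "4 * 2 ^ (K * param I) * B ^ 4"
  let ?k = "if c = 2 then 12 else 1 :: nat"
  let ?Q = "\<lambda>s. s (Var 0) = (if above_average c I then 1 else 0 :: nat)"
  have M: "B * (B * (B * (4 * B))) \<le> ?M" "B * (4 * B) \<le> ?M" "4 * B \<le> ?M" "1 \<le> ?M"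
  proof -
    have "1 \<le> B" by (rule B1)
    then have "B \<le> B ^ 4" "B ^ 2 \<le> B ^ 4" "1 \<le> B ^ 4"
      using power_increasing[of 1 4 B] power_increasing[of 2 4 B] by simp_all
    moreover define Q where "Q = 2 ^ (K * param I) * B ^ 4"
    moreover have "1 * B ^ 4 \<le> Q" unfolding Q_def by (intro mult_le_mono1) simp
    moreover have "?M = 4 * Q" by (simp add: Q_def)
    moreover have "B * (B * (B * (4 * B))) = 4 * B ^ 4" "B * (4 * B) = 4 * B ^ 2" by (simp_all add: power4_eq_xxxx power2_eq_square)
    ultimately show "B * (B * (B * (4 * B))) \<le> ?M" "B * (4 * B) \<le> ?M" "4 * B \<le> ?M" "1 \<le> ?M"
      by linarith+
  qed
  let ?R = "\<lambda>s'. (\<forall>i. s' (Arr Label i) = 0) \<and> stores s' Ess es \<and> stores s' Rest nes \<and>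
     s' (Var vEss) = length es \<and> s' (Var vRest) = length nes"
  show "runs xs (essential_com smG) (\<lambda>_. 0) ?M ?R"
    by (rule runs_mono[OF essential_runs M(1)]) auto
  fix s1 assume s1: "?R s1"
  have ev: "eval xs s1 (Minus (scaled K (In (N 0))) (V vEss)) = K * param I - card (essential I)"
    using s1 encode_read(1)[of code I] es(4) by simp
  show "runs xs (Cond (Minus (scaled K (In (N 0))) (V vEss))
       (rest_com smD ;; dp_com smD ;; decide_com smM ?k) (Assign 0 (N 1))) s1 ?M ?Q"
  proof (rule runs_Cond)
    assume "eval xs s1 (Minus (scaled K (In (N 0))) (V vEss)) = 0"
    then show "runs xs (Assign 0 (N 1)) s1 ?M ?Q"
      using K ev M by (intro runs_Assign) auto
  next
    assume "eval xs s1 (Minus (scaled K (In (N 0))) (V vEss)) \<noteq> 0"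
    then have "length es \<le> K * param I" using ev es(4) by simp
    then have "(2 :: nat) ^ length es \<le> 2 ^ (K * param I)" by (intro power_increasing) auto
    then have "2 ^ length es * (B * (4 * B)) \<le> 2 ^ (K * param I) * (B * (4 * B))" by (rule mult_le_mono1)
    also have "\<dots> \<le> ?M"
    proof -
      have "B ^ 2 \<le> B ^ 4" using B1(1) by (intro power_increasing) auto
      then have "2 ^ (K * param I) * (4 * B ^ 2) \<le> 2 ^ (K * param I) * (4 * B ^ 4)" by simp
      then show ?thesis by (simp add: power2_eq_square mult.left_commute mult.assoc)
    qed
    finally have M': "2 ^ length es * (B * (4 * B)) \<le> ?M" .
    show "runs xs (rest_com smD ;; dp_com smD ;; decide_com smM ?k) s1 ?M ?Q"
    proof (rule runs_Seq)
      show "runs xs (rest_com smD) s1 ?M (\<lambda>s'.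
         unchanged ({..<9} \<union> {vI, vV, vBest}) s1 s' \<and> s' (Var vBest) = suffix_sum (gain I) nes \<and>
         (\<forall>v. s' (Arr Label v) = (if v \<in> set nes then 2 else 0)))"
        by (rule runs_mono[OF rest_runs M(2)]) (use s1 in auto)
      fix s2 assume s2: "unchanged ({..<9} \<union> {vI, vV, vBest}) s1 s2 \<and> s2 (Var vBest) = suffix_sum (gain I) nes \<and>
         (\<forall>v. s2 (Arr Label v) = (if v \<in> set nes then 2 else 0))"
      show "runs xs (dp_com smD ;; decide_com smM ?k) s2 ?M ?Q"
      proof (rule runs_Seq)
        show "runs xs (dp_com smD) s2 ?M (\<lambda>s'.
           s' (Arr Table (s' (Var vMask))) = opt (essential I) \<and> (\<forall>v. s' (Arr Label v) < 4))"
          by (rule runs_mono[OF dp_runs M']) (use s1 s2 in \<open>auto simp: unchanged_def stores_def\<close>)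
        fix s3 assume "s3 (Arr Table (s3 (Var vMask))) = opt (essential I) \<and> (\<forall>v. s3 (Arr Label v) < 4)"
        then show "runs xs (decide_com smM ?k) s3 ?M ?Q"
          by (intro runs_mono[OF decide_runs[OF c] M(3)]) auto
      qed
    qed
  qed (rule M)
qed

end

theorem theorem7:
  fixes c :: nat and PP :: "predicate set" and code :: "predicate \<Rightarrow> nat"
  assumes "c \<in> {2, 3}"
    and "finite PP"
    and "PP \<subseteq> predicates c"
    and "inj_on code PP"
  shows "\<exists>(p :: program) (A :: nat) (B :: nat) (D :: nat). \<forall>I\<in>instances PP.
           halts_within p (encode code I)
             (A * 2 ^ (B * param I) * bit_size (encode code I) ^ D)
             (if above_average c I then 1 else 0)"
proof -
  obtain Ps where Ps: "set Ps = PP" "distinct Ps" using finite_distinct_list[OF assms(2)] by blast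
  have "P \<in> predicates 3" if "P \<in> predicates c" for P
    using assms(1) that by (cases P) (auto simp only: predicates_def mem_Collect_eq prod.case insert_iff empty_iff)
  then have PP: "PP \<subseteq> predicates 3" using assms(3) by blast
  obtain K where K: "\<And>I. I \<in> instances PP \<Longrightarrow> K * param I \<le> card (essential I) \<Longrightarrow> above_average c I"
    using essential_bound[of c] PP by blast
  let ?c = "solver code Ps K (if c = 2 then 12 else 1)"
  \<comment> \<open>The program, and with it \<open>csize ?c\<close>, is fixed before
    \<open>I\<close>, so it may enter the constant factor.\<close>
  have "halts_within (compile ?c 0) (encode code I)
      ((csize ?c * 4) * 2 ^ (K * param I) * bit_size (encode code I) ^ 4)
      (if above_average c I then 1 else 0)" if I: "I \<in> instances PP" for I
  proof -
    interpret encoded_instance PP I code Ps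
      using I PP Ps assms(4) by unfold_locales auto
    show ?thesis
      by (rule halts_within_compile[OF solver_runs[OF assms(1) K[OF I]]]) (simp_all add: insize_def)
  qed
  then show ?thesis by blast
qed

end
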